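(* Assume $a$ is (WD) with degeneracy constant $K$, let $\beta,\gamma\ge0$, let $0<\varepsilon_0\le2-K$, and let $y$ be a mild solution of $$\begin{cases} y_{tt}(t,x)+(ay_{xx})_{xx}(t,x)=0, & t>0,\ x\in(0,1),\\ y(t,0)=0,\ y_x(t,0)=0, & t>0,\\ \beta y(t,1)-(ay_{xx})_x(t,1)+y_t(t,1)=0, & t>0,\\ \gamma y_x(t,1)+(ay_{xx})(t,1)+y_{tx}(t,1)=0, & t>0,\\ y(0,x)=y_0(x),\ y_t(0,x)=y_1(x), & x\in(0,1).\end{cases}$$ Let $C_1,A_\gamma,C_\beta,C_\gamma$ be the constants defined in the context, let $\nu:=\frac1{\max\{1,C_1\}(C_\beta+C_\gamma)A_\gamma}$ and, for $\delta\in(0,\nu)$, $$C_\delta:=1-\delta\max\{1,C_1\}(C_\beta+C_\gamma)A_\gamma,$$ $$C_3:=\left(\frac K4+\frac{K\beta}2+\beta+\varepsilon_0\frac\beta2\right)\frac2{C_\delta}+\left(\beta+1+\frac{2\gamma^2}{a(1)}+\varepsilon_0\frac\gamma2\right)\frac2{C_\delta},$$ $$C_4:=\vartheta+\varrho+\varsigma+\left(2-\frac K2\right)\frac{C_\gamma}2+C_5,$$ $$C_5:=\frac1{C_\delta}\left(2+2C_1^2A_\gamma^2C_\beta+2C_1A_\gamma^2C_\gamma+\frac1\delta+2\frac{C_1A_\gamma^2\max\{1,C_1\}}{\delta}\right)\left(\frac K4+\frac{K\beta}2+2\beta+\varepsilon_0\frac\beta2+1+\frac{2\gamma^2}{a(1)}+\varepsilon_0\frac\gamma2\right),$$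 where $$\vartheta:=K\max\left\{1,\frac2{a(1)(2-K)},C_\gamma\right\},\quad\varrho:=4\max\left\{C_\gamma,\frac2{a(1)(2-K)},1\right\},\quad\varsigma:=\max\left\{\frac K4+2,\frac2{a(1)}\right\}.$$ Then for all $t>0$ and for all $\delta\in\left(0,\min\left\{\nu,\frac{\varepsilon_0}{C_3}\right\}\right)$ (i.e. $\delta\in(0,\nu)$ with $\delta\,C_3<\varepsilon_0$, where $C_3=C_3(\delta)$), one has $$E_y(t)\le E_y(0)\,e^{1-\frac tM},\qquad M:=\frac{C_4}{\varepsilon_0-\delta C_3}.$$
   Context: $a$ is weakly degenerate (WD) if $a\in C[0,1]\cap C^1(0,1]$, $a(0)=0$, $a>0$ on $(0,1]$ and $K:=\sup_{x\in(0,1]}\frac{x|a'(x)|}{a(x)}\in(0,1)$ (then $1/a\in L^1(0,1)$). Constants. $C_1:=2\max\{1,\frac1{a(1)(2-K)}\}$; $A_\gamma:=\min\{\max\{1,\frac1\gamma\},\,1+\|\frac1a\|_{L^1(0,1)}\}$ if $\gamma\ne0$ and $A_0:=1+\|\frac1a\|_{L^1(0,1)}$; $C_\beta:=2\min\{\|\frac1a\|_{L^1(0,1)},\frac1\beta\}$ if $\beta\neq0$ and $C_\beta:=2\|\frac1a\|_{L^1(0,1)}$ if $\beta=0$; $C_\gamma:=2\min\{\|\frac1a\|_{L^1(0,1)},\frac1\gamma\}$ if $\gamma\ne0$ and $C_\gamma:=2\|\frac1a\|_{L^1(0,1)}$ if $\gamma=0$. Spaces. $K^2_{a,0}(0,1)$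 is the set of $u\in H^1(0,1)$ with $u'$ absolutely continuous on $[0,1]$, $u(0)=u'(0)=0$, $\sqrt au''\in L^2(0,1)$. $D(B):=\{u\in K^2_{a,0}(0,1): au''\in H^2(0,1)\}$, $Bu:=(au'')''$. $\mathcal K_0:=K^2_{a,0}(0,1)\times L^2(0,1)$ with norm $\|(u,v)\|^2_{\mathcal K_0}=\int_0^1a(u'')^2dx+\int_0^1v^2dx+\beta u^2(1)+\gamma(u'(1))^2$. $\mathcal B(u,v):=(v,-Bu)$ on $D(\mathcal B):=\{(u,v)\in D(B)\times K^2_{a,0}(0,1):\ \beta u(1)-(au'')'(1)+v(1)=0,\ \gamma u'(1)+(au'')(1)+v'(1)=0\}$; $\mathcal B$ generates a contraction semigroup $(R(t))_{t\ge0}$ on $\mathcal K_0$. The mild solution with data $(y_0,y_1)\in\mathcal K_0$ is the first component of $(y(t),y_t(t))=R(t)(y_0,y_1)$. Energy: $E_y(t):=\frac12\int_0^1\left(y_t^2(t,x)+a(x)y_{xx}^2(t,x)\right)dx+\frac\beta2y^2(t,1)+\frac\gamma2y_x^2(t,1)$. *)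

theory Defs
  imports "HOL-Analysis.Analysis"
begin

section \<open>Lebesgue and Sobolev classes on the unit interval\<close>

text \<open>
  Elements of \<open>L\<^sup>2(0,1)\<close> are represented by functions; only their values almost everywhere on
  \<open>(0,1)\<close> matter.
\<close>

abbreviation leb01 :: "real measure" where
  "leb01 \<equiv> lebesgue_on {0<..<1}"

definition in_L2 :: "(real \<Rightarrow> real) \<Rightarrow> bool" where
  "in_L2 f \<longleftrightarrow> f \<in> borel_measurable leb01 \<and> integrable leb01 (\<lambda>x. (f x)\<^sup>2)"

definition loc_integrable :: "(real \<Rightarrow> real) \<Rightarrow> bool" where
  "loc_integrable f \<longleftrightarrow> (\<forall>c d. 0 < c \<longrightarrow> d < 1 \<longrightarrow> set_integrable lebesgue {c..d} f)"

definition test_function :: "(real \<Rightarrow> real) \<Rightarrow> bool" where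
  "test_function \<phi> \<longleftrightarrow> \<phi> C1_differentiable_on UNIV \<and>
     (\<exists>c d. 0 < c \<and> d < 1 \<and> (\<forall>x. x \<notin> {c..d} \<longrightarrow> \<phi> x = 0))"

definition has_weak_deriv :: "(real \<Rightarrow> real) \<Rightarrow> (real \<Rightarrow> real) \<Rightarrow> bool" where
  "has_weak_deriv f g \<longleftrightarrow> loc_integrable f \<and> loc_integrable g \<and>
     (\<forall>\<phi>. test_function \<phi> \<longrightarrow> (\<integral>x. f x * deriv \<phi> x \<partial>leb01) = - (\<integral>x. g x * \<phi> x \<partial>leb01))"

text \<open>Determined up to a null set whenever some weak derivative exists.\<close>

definition wderiv :: "(real \<Rightarrow> real) \<Rightarrow> real \<Rightarrow> real" where
  "wderiv f = (SOME g. has_weak_deriv f g)"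

definition in_H1 :: "(real \<Rightarrow> real) \<Rightarrow> bool" where
  "in_H1 f \<longleftrightarrow> in_L2 f \<and> (\<exists>g. has_weak_deriv f g \<and> in_L2 g)"

definition in_H2 :: "(real \<Rightarrow> real) \<Rightarrow> bool" where
  "in_H2 f \<longleftrightarrow> in_L2 f \<and> (\<exists>g. has_weak_deriv f g \<and> in_H1 g)"

text \<open>The classical derivative on \<open>[0,1]\<close>, one-sided at the end points.\<close>

definition dx :: "(real \<Rightarrow> real) \<Rightarrow> real \<Rightarrow> real" where
  "dx f x = vector_derivative f (at x within {0..1})"

text \<open>
  The continuous representative on \<open>[0,1]\<close> of an a.e. class (its values on \<open>[0,1]\<close> are unique if
  it exists). It gives the meaning of the boundary values of a class in \<open>H\<^sup>2(0,1)\<close>; for such a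
  class it is continuously differentiable on \<open>[0,1]\<close>.
\<close>

definition cont_rep :: "(real \<Rightarrow> real) \<Rightarrow> real \<Rightarrow> real" where
  "cont_rep f = (SOME w. continuous_on {0..1} w \<and> (AE x in leb01. w x = f x))"

definition abs_continuous01 :: "(real \<Rightarrow> real) \<Rightarrow> bool" where
  "abs_continuous01 f \<longleftrightarrow>
     (\<forall>\<epsilon>>0. \<exists>\<delta>>0. \<forall>(n::nat) (s::nat \<Rightarrow> real) (t::nat \<Rightarrow> real).
        (\<forall>i<n. 0 \<le> s i \<and> s i \<le> t i \<and> t i \<le> 1) \<and>
        (\<forall>i<n. \<forall>j<n. i \<noteq> j \<longrightarrow> {s i<..<t i} \<inter> {s j<..<t j} = {}) \<and>
        (\<Sum>i<n. t i - s i) < \<delta>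
        \<longrightarrow> (\<Sum>i<n. \<bar>f (t i) - f (s i)\<bar>) < \<epsilon>)"

section \<open>The degenerate coefficient\<close>

definition degen_const :: "(real \<Rightarrow> real) \<Rightarrow> real" where
  "degen_const a = (SUP x\<in>{0<..1}. x * \<bar>dx a x\<bar> / a x)"

definition weakly_degenerate :: "(real \<Rightarrow> real) \<Rightarrow> bool" where
  "weakly_degenerate a \<longleftrightarrow>
     continuous_on {0..1} a \<and>
     (\<forall>x\<in>{0<..1}. a differentiable (at x within {0..1})) \<and> continuous_on {0<..1} (dx a) \<and>
     a 0 = 0 \<and> (\<forall>x\<in>{0<..1}. a x > 0) \<and>
     bdd_above ((\<lambda>x. x * \<bar>dx a x\<bar> / a x) ` {0<..1}) \<and>
     0 < degen_const a \<and> degen_const a < 1"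

section \<open>Function spaces and the operator\<close>

text \<open>
  A member of \<open>K\<^sup>2\<^bsub>a,0\<^esub>(0,1)\<close> is represented by its \<open>C\<^sup>1[0,1]\<close> representative, so that \<open>u'\<close>
  is the classical derivative \<open>dx u\<close>; only its values on \<open>[0,1]\<close> matter. The second
  derivative \<open>u''\<close> is the weak derivative of \<open>u'\<close>.
\<close>

definition dxx :: "(real \<Rightarrow> real) \<Rightarrow> real \<Rightarrow> real" where
  "dxx u = wderiv (dx u)"

definition in_K2 :: "(real \<Rightarrow> real) \<Rightarrow> (real \<Rightarrow> real) \<Rightarrow> bool" where
  "in_K2 a u \<longleftrightarrow>
     in_H1 u \<and> (\<forall>x\<in>{0..1}. u differentiable (at x within {0..1})) \<and>
     abs_continuous01 (dx u) \<and> u 0 = 0 \<and> dx u 0 = 0 \<and>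
     (\<exists>g. has_weak_deriv (dx u) g \<and> in_L2 (\<lambda>x. sqrt (a x) * g x))"

definition bending :: "(real \<Rightarrow> real) \<Rightarrow> (real \<Rightarrow> real) \<Rightarrow> real \<Rightarrow> real" where
  "bending a u = (\<lambda>x. a x * dxx u x)"

definition dom_B :: "(real \<Rightarrow> real) \<Rightarrow> (real \<Rightarrow> real) set" where
  "dom_B a = {u. in_K2 a u \<and> in_H2 (bending a u)}"

definition op_B :: "(real \<Rightarrow> real) \<Rightarrow> (real \<Rightarrow> real) \<Rightarrow> real \<Rightarrow> real" where
  "op_B a u = wderiv (wderiv (bending a u))"

type_synonym state = "(real \<Rightarrow> real) \<times> (real \<Rightarrow> real)"

definition space_K0 :: "(real \<Rightarrow> real) \<Rightarrow> state set" where
  "space_K0 a = {(u, v). in_K2 a u \<and> in_L2 v}"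

text \<open>Equality in \<open>K\<^sup>2\<^bsub>a,0\<^esub>(0,1) \<times> L\<^sup>2(0,1)\<close> of the elements represented by two pairs.\<close>

definition state_eq :: "state \<Rightarrow> state \<Rightarrow> bool" where
  "state_eq p q \<longleftrightarrow> (\<forall>x\<in>{0..1}. fst p x = fst q x) \<and> (AE x in leb01. snd p x = snd q x)"

definition lincomb :: "real \<Rightarrow> state \<Rightarrow> real \<Rightarrow> state \<Rightarrow> state" where
  "lincomb c p d q = ((\<lambda>x. c * fst p x + d * fst q x), (\<lambda>x. c * snd p x + d * snd q x))"

definition norm_K0 :: "(real \<Rightarrow> real) \<Rightarrow> real \<Rightarrow> real \<Rightarrow> state \<Rightarrow> real" where
  "norm_K0 a \<beta> \<gamma> p =
     sqrt ((\<integral>x. a x * (dxx (fst p) x)\<^sup>2 \<partial>leb01) + (\<integral>x. (snd p x)\<^sup>2 \<partial>leb01)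
           + \<beta> * (fst p 1)\<^sup>2 + \<gamma> * (dx (fst p) 1)\<^sup>2)"

definition dom_calB :: "(real \<Rightarrow> real) \<Rightarrow> real \<Rightarrow> real \<Rightarrow> state set" where
  "dom_calB a \<beta> \<gamma> = {(u, v). u \<in> dom_B a \<and> in_K2 a v \<and>
     \<beta> * u 1 - dx (cont_rep (bending a u)) 1 + v 1 = 0 \<and>
     \<gamma> * dx u 1 + cont_rep (bending a u) 1 + dx v 1 = 0}"

definition op_calB :: "(real \<Rightarrow> real) \<Rightarrow> state \<Rightarrow> state" where
  "op_calB a p = (snd p, (\<lambda>x. - op_B a (fst p) x))"

section \<open>Semigroups and mild solutions\<close>

definition contraction_semigroup ::
    "(real \<Rightarrow> real) \<Rightarrow> real \<Rightarrow> real \<Rightarrow> (real \<Rightarrow> state \<Rightarrow> state) \<Rightarrow> bool" where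
  "contraction_semigroup a \<beta> \<gamma> R \<longleftrightarrow>
     (\<forall>t\<ge>0. \<forall>p\<in>space_K0 a. R t p \<in> space_K0 a) \<and>
     (\<forall>t\<ge>0. \<forall>p\<in>space_K0 a. \<forall>q\<in>space_K0 a. \<forall>c d.
        state_eq (R t (lincomb c p d q)) (lincomb c (R t p) d (R t q))) \<and>
     (\<forall>t\<ge>0. \<forall>p\<in>space_K0 a. norm_K0 a \<beta> \<gamma> (R t p) \<le> norm_K0 a \<beta> \<gamma> p) \<and>
     (\<forall>p\<in>space_K0 a. state_eq (R 0 p) p) \<and>
     (\<forall>s\<ge>0. \<forall>t\<ge>0. \<forall>p\<in>space_K0 a. state_eq (R (s + t) p) (R s (R t p))) \<and>
     (\<forall>p\<in>space_K0 a. ((\<lambda>t. norm_K0 a \<beta> \<gamma> (lincomb 1 (R t p) (- 1) p)) \<longlongrightarrow> 0) (at_right 0))"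

text \<open>
  The infinitesimal generator of \<open>R\<close> is the operator \<open>\<B>\<close> with domain \<open>dom_calB\<close>, equality of
  their graphs being understood modulo \<open>state_eq\<close>.
\<close>

definition generated_by_calB ::
    "(real \<Rightarrow> real) \<Rightarrow> real \<Rightarrow> real \<Rightarrow> (real \<Rightarrow> state \<Rightarrow> state) \<Rightarrow> bool" where
  "generated_by_calB a \<beta> \<gamma> R \<longleftrightarrow>
     (\<forall>p\<in>space_K0 a. \<forall>q\<in>space_K0 a.
        ((\<lambda>h. norm_K0 a \<beta> \<gamma> (lincomb 1 (lincomb (1 / h) (R h p) (- 1 / h) p) (- 1) q))
            \<longlongrightarrow> 0) (at_right 0)
        \<longleftrightarrow> (\<exists>p'\<in>dom_calB a \<beta> \<gamma>. state_eq p' p \<and> state_eq (op_calB a p') q))"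

text \<open>
  The functions \<open>y t\<close> and \<open>yt t\<close> stand for \<open>y(t,\<cdot>)\<close> and \<open>y\<^sub>t(t,\<cdot>)\<close>, the two components of
  \<open>R(t)(y0,y1)\<close>. The boundary and initial conditions are those carried by the semigroup.
\<close>

definition mild_solution ::
    "(real \<Rightarrow> real) \<Rightarrow> real \<Rightarrow> real \<Rightarrow> (real \<Rightarrow> real) \<Rightarrow> (real \<Rightarrow> real)
      \<Rightarrow> (real \<Rightarrow> real \<Rightarrow> real) \<Rightarrow> (real \<Rightarrow> real \<Rightarrow> real) \<Rightarrow> bool" where
  "mild_solution a \<beta> \<gamma> y0 y1 y yt \<longleftrightarrow>
     (y0, y1) \<in> space_K0 a \<and>
     (\<exists>R. contraction_semigroup a \<beta> \<gamma> R \<and> generated_by_calB a \<beta> \<gamma> R \<and>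
          (\<forall>t\<ge>0. state_eq (y t, yt t) (R t (y0, y1))))"

definition energy ::
    "(real \<Rightarrow> real) \<Rightarrow> real \<Rightarrow> real \<Rightarrow> (real \<Rightarrow> real \<Rightarrow> real) \<Rightarrow> (real \<Rightarrow> real \<Rightarrow> real) \<Rightarrow> real \<Rightarrow> real" where
  "energy a \<beta> \<gamma> y yt t =
     1 / 2 * (\<integral>x. (yt t x)\<^sup>2 + a x * (dxx (y t) x)\<^sup>2 \<partial>leb01)
     + \<beta> / 2 * (y t 1)\<^sup>2 + \<gamma> / 2 * (dx (y t) 1)\<^sup>2"

section \<open>Constants\<close>

definition inv_a_L1 :: "(real \<Rightarrow> real) \<Rightarrow> real" where
  "inv_a_L1 a = (\<integral>x. \<bar>1 / a x\<bar> \<partial>leb01)"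

definition C1_const :: "(real \<Rightarrow> real) \<Rightarrow> real" where
  "C1_const a = 2 * max 1 (1 / (a 1 * (2 - degen_const a)))"

definition A_const :: "(real \<Rightarrow> real) \<Rightarrow> real \<Rightarrow> real" where
  "A_const a \<gamma> = (if \<gamma> \<noteq> 0 then min (max 1 (1 / \<gamma>)) (1 + inv_a_L1 a) else 1 + inv_a_L1 a)"

text \<open>Both \<open>C\<^sub>\<beta>\<close> and \<open>C\<^sub>\<gamma>\<close> are values of the following function.\<close>

definition Cb_const :: "(real \<Rightarrow> real) \<Rightarrow> real \<Rightarrow> real" where
  "Cb_const a \<beta> = (if \<beta> \<noteq> 0 then 2 * min (inv_a_L1 a) (1 / \<beta>) else 2 * inv_a_L1 a)"

definition nu_const :: "(real \<Rightarrow> real) \<Rightarrow> real \<Rightarrow> real \<Rightarrow> real" where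
  "nu_const a \<beta> \<gamma> =
     1 / (max 1 (C1_const a) * (Cb_const a \<beta> + Cb_const a \<gamma>) * A_const a \<gamma>)"

definition Cdelta_const :: "(real \<Rightarrow> real) \<Rightarrow> real \<Rightarrow> real \<Rightarrow> real \<Rightarrow> real" where
  "Cdelta_const a \<beta> \<gamma> \<delta> =
     1 - \<delta> * max 1 (C1_const a) * (Cb_const a \<beta> + Cb_const a \<gamma>) * A_const a \<gamma>"

definition C3_const :: "(real \<Rightarrow> real) \<Rightarrow> real \<Rightarrow> real \<Rightarrow> real \<Rightarrow> real \<Rightarrow> real" where
  "C3_const a \<beta> \<gamma> \<epsilon>0 \<delta> =
     (let K = degen_const a; Cd = Cdelta_const a \<beta> \<gamma> \<delta> in
        (K / 4 + K * \<beta> / 2 + \<beta> + \<epsilon>0 * (\<beta> / 2)) * (2 / Cd)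
      + (\<beta> + 1 + 2 * \<gamma>\<^sup>2 / a 1 + \<epsilon>0 * (\<gamma> / 2)) * (2 / Cd))"

definition C5_const :: "(real \<Rightarrow> real) \<Rightarrow> real \<Rightarrow> real \<Rightarrow> real \<Rightarrow> real \<Rightarrow> real" where
  "C5_const a \<beta> \<gamma> \<epsilon>0 \<delta> =
     (let K = degen_const a; C1 = C1_const a; A = A_const a \<gamma>;
          Cb = Cb_const a \<beta>; Cg = Cb_const a \<gamma> in
        1 / Cdelta_const a \<beta> \<gamma> \<delta>
        * (2 + 2 * C1\<^sup>2 * A\<^sup>2 * Cb + 2 * C1 * A\<^sup>2 * Cg + 1 / \<delta>
           + 2 * (C1 * A\<^sup>2 * max 1 C1 / \<delta>))
        * (K / 4 + K * \<beta> / 2 + 2 * \<beta> + \<epsilon>0 * (\<beta> / 2) + 1 + 2 * \<gamma>\<^sup>2 / a 1 + \<epsilon>0 * (\<gamma> / 2)))"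

definition theta_const :: "(real \<Rightarrow> real) \<Rightarrow> real \<Rightarrow> real" where
  "theta_const a \<gamma> =
     degen_const a * Max {1, 2 / (a 1 * (2 - degen_const a)), Cb_const a \<gamma>}"

definition rho_const :: "(real \<Rightarrow> real) \<Rightarrow> real \<Rightarrow> real" where
  "rho_const a \<gamma> = 4 * Max {Cb_const a \<gamma>, 2 / (a 1 * (2 - degen_const a)), 1}"

definition sigma_const :: "(real \<Rightarrow> real) \<Rightarrow> real" where
  "sigma_const a = max (degen_const a / 4 + 2) (2 / a 1)"

definition C4_const :: "(real \<Rightarrow> real) \<Rightarrow> real \<Rightarrow> real \<Rightarrow> real \<Rightarrow> real \<Rightarrow> real" where
  "C4_const a \<beta> \<gamma> \<epsilon>0 \<delta> =
     theta_const a \<gamma> + rho_const a \<gamma> + sigma_const a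
     + (2 - degen_const a / 2) * (Cb_const a \<gamma> / 2) + C5_const a \<beta> \<gamma> \<epsilon>0 \<delta>"

end

(*
  For a state (u, v) of the domain, multiply the equation by 2 x u' - (K/2) u and integrate by parts:
  the interior terms control the energy E, up to multiples of u(1)^2 + u'(1)^2 and of the
  dissipation v(1)^2 + v'(1)^2 = - dE/dt. The first are removed with a further multiplier, the solution z
  of the static problem (a z'')'' = 0 with boundary data u(1), u'(1), for which a z'' is affine. All
  this amounts to a pointwise in time inequality dPsi/dt <= - rate * E for a quadratic form Psi of the state
  with 0 <= Psi <= C4 * E, so that no time integral is needed: Psi decays exponentially, and with
  M = C4 / rate the monotonicity of E gives rate * M * E(t) <= Psi(t - M) (Komornik's argument).
  Data outside of the domain are reached by density, for which one takes u'' = p / a and v = x^2 q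
  with polynomials p and q.
*)
theory Submission
  imports Defs
begin

section \<open>Integration and absolutely continuous functions on the unit interval\<close>

text \<open>Since \<open>a\<close> vanishes at 0, \<open>u''\<close> is only a quotient
  \<open>W / a\<close> with a regular moment \<open>W\<close>, and pointwise derivatives at 0 may
  fail to exist. Hence every integration by parts is an identity between an absolutely continuous
  function and its density, and weak derivatives are translated into that form first. The critical
  expression for the multiplier \<open>x u'\<close> is \<open>W^2 x / a\<close>; it is admissible
  because \<open>x / a\<close> is absolutely continuous, which uses \<open>K < 1\<close>. The static
  multiplier produces \<open>u(1)^2 + u'(1)^2\<close> exactly, apart from the products
  \<open>v(1) z(1)\<close> and \<open>v'(1) z'(1)\<close>. Young's inequality with parameter
  \<open>\<delta>\<close> leaves the fraction \<open>Cd\<close> of this gain, so the multiplier is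
  given the weight \<open>Qs / Cd\<close>. The second price is \<open>\<delta>\<close> times the
  kinetic energy, because \<open>z\<close> itself moves in time; this is the origin of the loss
  \<open>\<delta> * C3\<close> in the rate. The product \<open>u'(1) v'(1)\<close> is a time
  derivative and is cancelled by a multiple of \<open>u'(1)^2\<close> in the functional. A large
  multiple of the energy absorbs the squares of \<open>v(1)\<close>, \<open>v'(1)\<close> and makes
  the functional nonnegative.\<close>

lemma space_leb01 [simp]: "space leb01 = {0<..<1}"
  by simp

lemma sets_Ioo_lebesgue [measurable, simp]: "{a<..<b::real} \<in> sets lebesgue"
  by auto

lemma finite_measure_leb01: "finite_measure leb01"
  by (rule finite_measure_lebesgue_on) auto

interpretation leb01: finite_measure leb01
  by (rule finite_measure_leb01)

interpretation leb01_pair: pair_sigma_finite leb01 leb01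
  ..

lemma measure_leb01: "measure leb01 {0<..<1} = 1"
  by (simp add: measure_restrict_space)

lemma integral_const_leb01 [simp]: "(\<integral>x. c \<partial>leb01) = (c::real)"
  by (simp add: measure_leb01)

lemma measurable_ident_leb01 [measurable]: "(\<lambda>x. x) \<in> leb01 \<rightarrow>\<^sub>M borel"
  by (simp add: measurable_completion measurable_restrict_space1)

lemma borel_measurable_leb01_continuous:
  fixes f :: "real \<Rightarrow> real"
  assumes "continuous_on {0<..<1} f"
  shows "f \<in> borel_measurable leb01"
  using assms by (intro continuous_imp_measurable_on_sets_lebesgue) auto

lemma integrable_leb01_continuous:
  fixes f :: "real \<Rightarrow> real"
  assumes "continuous_on {0..1} f"
  shows "integrable leb01 f"
proof -
  have "f absolutely_integrable_on cbox 0 1"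
    using assms by (intro absolutely_integrable_continuous) auto
  hence "f absolutely_integrable_on box 0 1"
    by (simp only: absolutely_integrable_on_open_interval)
  hence "f absolutely_integrable_on {0<..<1}"
    by (simp add: box_real)
  thus ?thesis
    by (intro absolutely_integrable_imp_integrable) auto
qed

lemma AE_leb01_neq: "AE x in leb01. x \<noteq> (c::real)"
proof -
  have "AE x in lborel. x \<noteq> c"
    by (rule AE_lborel_singleton)
  hence "AE x in lebesgue. x \<noteq> c"
    by (rule AE_completion)
  thus ?thesis
    by (subst AE_restrict_space_iff) auto
qed

lemma AE_leb01_Ioo: "AE x in leb01. x \<in> {0<..<1}"
  using AE_space[of leb01] by simp

text \<open>Rests on the completeness of Lebesgue measure. Weak derivatives are selected by a choice
  operator and are known only almost everywhere, so their measurability has to be transferred in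
  this way.\<close>

lemma borel_measurable_leb01_cong_AE:
  fixes f g :: "real \<Rightarrow> real"
  assumes "f \<in> borel_measurable leb01" "AE x in leb01. f x = g x"
  shows "g \<in> borel_measurable leb01"
proof -
  let ?f = "\<lambda>x. if x \<in> {0<..<1} then f x else 0" and ?g = "\<lambda>x. if x \<in> {0<..<1} then g x else 0"
  have "?f \<in> borel_measurable lebesgue"
    using assms(1) by (subst borel_measurable_if) auto
  moreover have "AE x in lebesgue. ?f x = ?g x"
    using assms(2) by (subst (asm) AE_restrict_space_iff) auto
  ultimately have "?g \<in> borel_measurable lebesgue"
    by (rule borel_measurable_AE)
  thus ?thesis
    by (subst (asm) borel_measurable_if) auto
qed

text \<open>Truncating inside one fixed integral makes \<open>prim g\<close> total: it is 0 to the
  left of 0 and constant from 1 on. Fubini's theorem then applies directly, and test functions on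
  the whole line can be obtained as primitives.\<close>

definition prim :: "(real \<Rightarrow> real) \<Rightarrow> real \<Rightarrow> real" where
  "prim g x = (\<integral>t. indicator {..<x} t * g t \<partial>leb01)"

lemma integrable_indicator_mult:
  fixes g :: "real \<Rightarrow> real"
  assumes "integrable leb01 g" "A \<in> sets borel"
  shows "integrable leb01 (\<lambda>t. indicator A t * g t)"
proof -
  have [measurable]: "A \<in> sets borel" by fact
  have [measurable]: "g \<in> borel_measurable leb01" using assms by auto
  show ?thesis
    by (rule Bochner_Integration.integrable_bound[OF assms(1)]) (auto simp: indicator_def)
qed

lemma measurable_prod_leb01 [measurable]:
  "fst \<in> leb01 \<Otimes>\<^sub>M leb01 \<rightarrow>\<^sub>M (borel :: real measure)" "snd \<in> leb01 \<Otimes>\<^sub>M leb01 \<rightarrow>\<^sub>M (borel :: real measure)"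
  using measurable_compose[OF measurable_fst measurable_ident_leb01]
        measurable_compose[OF measurable_snd measurable_ident_leb01] by simp_all

lemma integrable_leb01_product:
  fixes f g :: "real \<Rightarrow> real"
  assumes f: "integrable leb01 f" and g: "integrable leb01 g"
  shows "integrable (leb01 \<Otimes>\<^sub>M leb01) (\<lambda>(x, y). f x * g y)"
proof -
  have [measurable]: "f \<in> borel_measurable leb01" "g \<in> borel_measurable leb01" using f g by auto
  show ?thesis
  proof (rule leb01_pair.Fubini_integrable)
    show "integrable leb01 (\<lambda>x. \<integral>y. norm (case (x, y) of (x, y) \<Rightarrow> f x * g y) \<partial>leb01)"
      using f by (simp add: abs_mult)
    show "AE x in leb01. integrable leb01 (\<lambda>y. case (x, y) of (x, y) \<Rightarrow> f x * g y)"
      using g by simp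
  qed measurable
qed

text \<open>Fubini on the unit square: the triangles on the two sides of the diagonal carry the two
  integrals of the left-hand side, and the diagonal is a null set.\<close>

lemma integral_prim_by_parts:
  assumes f: "integrable leb01 f" and g: "integrable leb01 g"
  shows "integrable leb01 (\<lambda>x. f x * prim g x)"
    and "(\<integral>x. f x * prim g x \<partial>leb01) + (\<integral>x. prim f x * g x \<partial>leb01)
           = (\<integral>x. f x \<partial>leb01) * (\<integral>x. g x \<partial>leb01)"
proof -
  have [measurable]: "f \<in> borel_measurable leb01" "g \<in> borel_measurable leb01" using f g by auto
  define H1 where "H1 = (\<lambda>x y::real. indicator {..<x} y * (f x * g y))"
  define H2 where "H2 = (\<lambda>x y::real. indicator {..<y} x * (f x * g y))"
  have fg: "integrable (leb01 \<Otimes>\<^sub>M leb01) (\<lambda>(x, y). f x * g y)"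
    by (rule integrable_leb01_product[OF f g])
  have m1: "case_prod H1 \<in> borel_measurable (leb01 \<Otimes>\<^sub>M leb01)"
    unfolding H1_def lessThan_def indicator_def by measurable
  have m2: "case_prod H2 \<in> borel_measurable (leb01 \<Otimes>\<^sub>M leb01)"
    unfolding H2_def lessThan_def indicator_def by measurable
  have i1: "integrable (leb01 \<Otimes>\<^sub>M leb01) (case_prod H1)"
    by (rule Bochner_Integration.integrable_bound[OF fg m1]) (auto simp: H1_def indicator_def)
  have i2: "integrable (leb01 \<Otimes>\<^sub>M leb01) (case_prod H2)"
    by (rule Bochner_Integration.integrable_bound[OF fg m2]) (auto simp: H2_def indicator_def)
  have H1i: "(\<integral>y. H1 x y \<partial>leb01) = f x * prim g x" for x
    unfolding H1_def prim_def by (simp add: mult.left_commute)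
  have H2i: "(\<integral>x. H2 x y \<partial>leb01) = prim f y * g y" for y
    unfolding H2_def prim_def
    by (subst Bochner_Integration.integral_mult_left_zero[symmetric]) (simp add: mult.assoc)
  show "integrable leb01 (\<lambda>x. f x * prim g x)"
    using leb01_pair.integrable_fst[OF i1] unfolding H1i .
  have "(\<integral>x. f x * prim g x \<partial>leb01) = (\<integral>x. \<integral>y. H1 x y \<partial>leb01 \<partial>leb01)"
    unfolding H1i ..
  moreover have "(\<integral>y. prim f y * g y \<partial>leb01) = (\<integral>x. \<integral>y. H2 x y \<partial>leb01 \<partial>leb01)"
    unfolding leb01_pair.Fubini_integral[OF i2, symmetric] H2i ..
  moreover have "(\<integral>x. \<integral>y. H1 x y \<partial>leb01 \<partial>leb01) + (\<integral>x. \<integral>y. H2 x y \<partial>leb01 \<partial>leb01)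
      = (\<integral>x. (\<integral>y. H1 x y \<partial>leb01) + (\<integral>y. H2 x y \<partial>leb01) \<partial>leb01)"
    by (rule Bochner_Integration.integral_add[symmetric])
       (rule leb01_pair.integrable_fst[OF i1] leb01_pair.integrable_fst[OF i2])+
  moreover have "(\<integral>x. (\<integral>y. H1 x y \<partial>leb01) + (\<integral>y. H2 x y \<partial>leb01) \<partial>leb01)
      = (\<integral>x. f x * (\<integral>y. g y \<partial>leb01) \<partial>leb01)"
  proof (rule Bochner_Integration.integral_cong[OF refl])
    fix x :: real
    have "(\<integral>y. H1 x y \<partial>leb01) + (\<integral>y. H2 x y \<partial>leb01) = (\<integral>y. H1 x y + H2 x y \<partial>leb01)"
    proof (rule Bochner_Integration.integral_add[symmetric])
      show "integrable leb01 (H1 x)"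
        using integrable_indicator_mult[OF g, of "{..<x}"]
        unfolding H1_def by (simp add: mult.left_commute)
      show "integrable leb01 (H2 x)"
        using integrable_indicator_mult[OF g, of "{x<..}"]
        unfolding H2_def by (simp add: mult.left_commute indicator_def)
    qed
    also have "\<dots> = (\<integral>y. f x * g y \<partial>leb01)"
    proof (rule integral_cong_AE)
      show "AE y in leb01. H1 x y + H2 x y = f x * g y"
        using AE_leb01_neq[of x] by eventually_elim (auto simp: H1_def H2_def indicator_def)
    qed (auto simp: H1_def H2_def indicator_def)
    finally show "(\<integral>y. H1 x y \<partial>leb01) + (\<integral>y. H2 x y \<partial>leb01) = f x * (\<integral>y. g y \<partial>leb01)"
      by simp
  qed
  ultimately show "(\<integral>x. f x * prim g x \<partial>leb01) + (\<integral>x. prim f x * g x \<partial>leb01)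
           = (\<integral>x. f x \<partial>leb01) * (\<integral>x. g x \<partial>leb01)"
    by simp
qed

lemma prim_0 [simp]: "prim g 0 = 0"
proof -
  have "prim g 0 = (\<integral>t. 0 \<partial>leb01)"
    unfolding prim_def by (rule Bochner_Integration.integral_cong) (auto simp: indicator_def)
  thus ?thesis by simp
qed

lemma prim_ge_1: "1 \<le> x \<Longrightarrow> prim g x = (\<integral>t. g t \<partial>leb01)"
  unfolding prim_def by (rule Bochner_Integration.integral_cong) (auto simp: indicator_def)

lemma prim_indicator:
  "y \<le> x \<Longrightarrow> prim (\<lambda>t. indicator {..<x} t * g t) y = prim g y"
  "x \<le> y \<Longrightarrow> prim (\<lambda>t. indicator {..<x} t * g t) y = prim g x"
  unfolding prim_def by (rule Bochner_Integration.integral_cong; auto simp: indicator_def)+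

lemma prim_diff:
  assumes "integrable leb01 g" "x \<le> y"
  shows "prim g y - prim g x = (\<integral>t. indicator {x..<y} t * g t \<partial>leb01)"
proof -
  have "prim g y - prim g x = (\<integral>t. indicator {..<y} t * g t - indicator {..<x} t * g t \<partial>leb01)"
    unfolding prim_def
    by (rule Bochner_Integration.integral_diff[symmetric]) (intro integrable_indicator_mult assms; simp)+
  also have "\<dots> = (\<integral>t. indicator {x..<y} t * g t \<partial>leb01)"
    using assms(2) by (intro Bochner_Integration.integral_cong) (auto simp: indicator_def)
  finally show ?thesis .
qed

lemma prim_cong_AE:
  assumes "f \<in> borel_measurable leb01" "AE x in leb01. f x = g x"
  shows "prim f x = prim g x"
proof -
  have [measurable]: "f \<in> borel_measurable leb01" "g \<in> borel_measurable leb01"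
    using assms borel_measurable_leb01_cong_AE[OF assms] by auto
  show ?thesis
    unfolding prim_def by (rule integral_cong_AE) (use assms(2) in auto)
qed

section \<open>Absolute continuity of primitives and the calculus of absolutely continuous
  functions\<close>

lemma integral_indicator_small:
  fixes g :: "real \<Rightarrow> real"
  assumes g: "integrable leb01 g" and e: "0 < e"
  obtains d where "0 < d"
    and "\<And>A. A \<in> sets borel \<Longrightarrow> measure leb01 (A \<inter> {0<..<1}) < d \<Longrightarrow> (\<integral>x. indicator A x * \<bar>g x\<bar> \<partial>leb01) < e"
proof -
  have [measurable]: "g \<in> borel_measurable leb01" using g by auto
  \<comment> \<open>Truncation at height \<open>n\<close>: the part of |g| above \<open>n\<close>
    has small integral, and the part below contributes at most \<open>n\<close> times the measure of
    the set.\<close>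
  have "(\<lambda>n::nat. \<integral>x. \<bar>g x\<bar> - min \<bar>g x\<bar> (real n) \<partial>leb01) \<longlonglongrightarrow> (\<integral>x. 0 \<partial>leb01)"
  proof (rule integral_dominated_convergence[where w = "\<lambda>x. \<bar>g x\<bar>"])
    show "AE x in leb01. (\<lambda>n. \<bar>g x\<bar> - min \<bar>g x\<bar> (real n)) \<longlonglongrightarrow> 0"
    proof (rule AE_I2)
      fix x :: real
      obtain N :: nat where "\<bar>g x\<bar> \<le> real N" using real_arch_simple by blast
      hence "eventually (\<lambda>n. \<bar>g x\<bar> - min \<bar>g x\<bar> (real n) = 0) sequentially"
        by (auto simp: eventually_sequentially min_def intro!: exI[of _ N])
      thus "(\<lambda>n. \<bar>g x\<bar> - min \<bar>g x\<bar> (real n)) \<longlonglongrightarrow> 0" by (rule tendsto_eventually)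
    qed
  qed (use g in \<open>auto simp: min_def\<close>)
  hence "eventually (\<lambda>n::nat. (\<integral>x. \<bar>g x\<bar> - min \<bar>g x\<bar> (real n) \<partial>leb01) < e / 2) sequentially"
    using e by (intro order_tendstoD(2)) auto
  then obtain n :: nat where n: "(\<integral>x. \<bar>g x\<bar> - min \<bar>g x\<bar> (real n) \<partial>leb01) < e / 2"
    by (auto simp: eventually_sequentially)
  have im: "integrable leb01 (\<lambda>x. \<bar>g x\<bar> - min \<bar>g x\<bar> (real n))"
    by (rule Bochner_Integration.integrable_bound[OF g]) auto
  show thesis
  proof (rule that)
    show "0 < e / (2 * (real n + 1))" using e by simp
    fix A :: "real set" assume A [measurable]: "A \<in> sets borel"
      and m: "measure leb01 (A \<inter> {0<..<1}) < e / (2 * (real n + 1))"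
    have As: "A \<inter> {0<..<1} \<in> sets leb01"
      by (subst sets_restrict_space_iff) auto
    have ii: "integrable leb01 (indicator (A \<inter> {0<..<1}) :: real \<Rightarrow> real)"
      using As by (intro integrable_real_indicator) (auto simp: leb01.emeasure_finite less_top[symmetric])
    have "(\<integral>x. indicator A x * \<bar>g x\<bar> \<partial>leb01)
       \<le> (\<integral>x. (\<bar>g x\<bar> - min \<bar>g x\<bar> (real n)) + real n * indicator (A \<inter> {0<..<1}) x \<partial>leb01)"
    proof (rule integral_mono_AE)
      show "integrable leb01 (\<lambda>x. indicator A x * \<bar>g x\<bar>)"
        by (rule integrable_indicator_mult) (use g in auto)
      show "integrable leb01 (\<lambda>x. (\<bar>g x\<bar> - min \<bar>g x\<bar> (real n)) + real n * indicator (A \<inter> {0<..<1}) x)"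
        by (intro Bochner_Integration.integrable_add im integrable_mult_right ii)
    qed (auto intro!: AE_I2 simp: indicator_def min_def)
    also have "\<dots> = (\<integral>x. \<bar>g x\<bar> - min \<bar>g x\<bar> (real n) \<partial>leb01) + real n * measure leb01 (A \<inter> {0<..<1})"
      using im ii As by simp
    also have "\<dots> < e"
    proof -
      have "real n * measure leb01 (A \<inter> {0<..<1}) \<le> real n * (e / (2 * (real n + 1)))"
        using m by (intro mult_left_mono) auto
      also have "\<dots> \<le> e / 2" using e by (simp add: field_simps)
      finally show ?thesis using n by simp
    qed
    finally show "(\<integral>x. indicator A x * \<bar>g x\<bar> \<partial>leb01) < e" .
  qed
qed

text \<open>The disjoint intervals are merged into one set of small measure, so that smallness of
  the integral of |g| over small sets is applied only once.\<close>

lemma abs_continuous01_prim: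
  assumes g: "integrable leb01 g"
  shows "abs_continuous01 (prim g)"
  unfolding abs_continuous01_def
proof (intro allI impI)
  fix e :: real assume "0 < e"
  then obtain d where d: "0 < d" "\<And>A. A \<in> sets borel \<Longrightarrow> measure leb01 (A \<inter> {0<..<1}) < d
      \<Longrightarrow> (\<integral>x. indicator A x * \<bar>g x\<bar> \<partial>leb01) < e"
    using integral_indicator_small[OF g] by blast
  show "\<exists>d>0. \<forall>(n::nat) s t. (\<forall>i<n. 0 \<le> s i \<and> s i \<le> t i \<and> t i \<le> 1) \<and>
        (\<forall>i<n. \<forall>j<n. i \<noteq> j \<longrightarrow> {s i<..<t i} \<inter> {s j<..<t j} = {}) \<and>
        (\<Sum>i<n. t i - s i) < d \<longrightarrow> (\<Sum>i<n. \<bar>prim g (t i) - prim g (s i)\<bar>) < e"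
  proof (intro exI conjI allI impI)
    show "0 < d" by fact
    fix n :: nat and s t :: "nat \<Rightarrow> real"
    assume *: "(\<forall>i<n. 0 \<le> s i \<and> s i \<le> t i \<and> t i \<le> 1) \<and>
        (\<forall>i<n. \<forall>j<n. i \<noteq> j \<longrightarrow> {s i<..<t i} \<inter> {s j<..<t j} = {}) \<and> (\<Sum>i<n. t i - s i) < d"
    define A where "A = (\<Union>i<n. {s i<..<t i})"
    have A: "A \<in> sets borel" unfolding A_def by auto
    have As: "A \<inter> {0<..<1} = A" using * unfolding A_def by force
    have mA: "measure leb01 A \<le> (\<Sum>i<n. t i - s i)"
    proof -
      have "measure leb01 A \<le> (\<Sum>i<n. measure leb01 {s i<..<t i})"
        unfolding A_def
      proof (rule leb01.finite_measure_subadditive_finite)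
        show "(\<lambda>i. {s i<..<t i}) ` {..<n} \<subseteq> sets leb01"
        proof (intro image_subsetI)
          fix i assume "i \<in> {..<n}"
          hence "{s i<..<t i} \<subseteq> {0<..<1}" using * by force
          thus "{s i<..<t i} \<in> sets leb01" by (subst sets_restrict_space_iff) auto
        qed
      qed auto
      also have "\<dots> = (\<Sum>i<n. t i - s i)"
      proof (intro sum.cong refl)
        fix i assume "i \<in> {..<n}"
        hence "{s i<..<t i} \<subseteq> {0<..<1}" "s i \<le> t i" using * by force+
        thus "measure leb01 {s i<..<t i} = t i - s i"
          by (subst measure_restrict_space) auto
      qed
      finally show ?thesis .
    qed
    have ind: "(\<Sum>i<n. indicator {s i<..<t i} x) = (indicator A x :: real)" for x
      unfolding A_def using *
      by (subst indicator_UN_disjoint) (auto simp: disjoint_family_on_def)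
    have "(\<Sum>i<n. \<bar>prim g (t i) - prim g (s i)\<bar>) \<le> (\<Sum>i<n. \<integral>x. indicator {s i<..<t i} x * \<bar>g x\<bar> \<partial>leb01)"
    proof (intro sum_mono)
      fix i assume i: "i \<in> {..<n}"
      have "prim g (t i) - prim g (s i) = (\<integral>x. indicator {s i..<t i} x * g x \<partial>leb01)"
        using * i by (intro prim_diff g) auto
      also have "\<bar>\<dots>\<bar> \<le> (\<integral>x. \<bar>indicator {s i..<t i} x * g x\<bar> \<partial>leb01)"
        by (rule integral_abs_bound)
      also have "\<dots> = (\<integral>x. indicator {s i<..<t i} x * \<bar>g x\<bar> \<partial>leb01)"
      proof (rule integral_cong_AE)
        have [measurable]: "g \<in> borel_measurable leb01" using g by auto
        show "(\<lambda>x. \<bar>indicator {s i..<t i} x * g x\<bar>) \<in> borel_measurable leb01"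
             "(\<lambda>x. indicator {s i<..<t i} x * \<bar>g x\<bar>) \<in> borel_measurable leb01"
          by measurable
        show "AE x in leb01. \<bar>indicator {s i..<t i} x * g x\<bar> = indicator {s i<..<t i} x * \<bar>g x\<bar>"
          using AE_leb01_neq[of "s i"] by eventually_elim (auto simp: indicator_def)
      qed
      finally show "\<bar>prim g (t i) - prim g (s i)\<bar> \<le> (\<integral>x. indicator {s i<..<t i} x * \<bar>g x\<bar> \<partial>leb01)" .
    qed
    also have "\<dots> = (\<integral>x. (\<Sum>i<n. indicator {s i<..<t i} x * \<bar>g x\<bar>) \<partial>leb01)"
      by (rule Bochner_Integration.integral_sum[symmetric], rule integrable_indicator_mult) (use g in auto)
    also have "\<dots> = (\<integral>x. indicator A x * \<bar>g x\<bar> \<partial>leb01)"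
      by (simp add: sum_distrib_right[symmetric] ind)
    also have "\<dots> < e" using A * mA by (intro d(2)) (auto simp: As)
    finally show "(\<Sum>i<n. \<bar>prim g (t i) - prim g (s i)\<bar>) < e" .
  qed
qed

lemma abs_continuous01_imp_continuous_on:
  assumes "abs_continuous01 f"
  shows "continuous_on {0..1} f"
  unfolding continuous_on_iff
proof (intro ballI allI impI)
  fix x e :: real assume x: "x \<in> {0..1}" and "0 < e"
  from mp[OF spec[OF assms[unfolded abs_continuous01_def]] this(2)]
  obtain d where "0 < d" and d: "\<forall>(n::nat) s t. (\<forall>i<n. 0 \<le> s i \<and> s i \<le> t i \<and> t i \<le> 1) \<and>
        (\<forall>i<n. \<forall>j<n. i \<noteq> j \<longrightarrow> {s i<..<t i} \<inter> {s j<..<t j} = {}) \<and>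
        (\<Sum>i<n. t i - s i) < d \<longrightarrow> (\<Sum>i<n. \<bar>f (t i) - f (s i)\<bar>) < e"
    by (elim exE conjE)
  show "\<exists>d>0. \<forall>y\<in>{0..1}. dist y x < d \<longrightarrow> dist (f y) (f x) < e"
  proof (intro exI conjI ballI impI)
    show "0 < d" by fact
    fix y :: real assume y: "y \<in> {0..1}" "dist y x < d"
    have "\<bar>f (max x y) - f (min x y)\<bar> < e"
      using d[THEN spec, of 1, THEN spec, of "\<lambda>_. min x y", THEN spec, of "\<lambda>_. max x y"] x y
      by (simp add: dist_real_def max_def min_def split: if_splits)
    thus "dist (f y) (f x) < e"
      by (simp add: dist_real_def max_def min_def abs_minus_commute split: if_splits)
  qed
qed

lemma continuous_on_prim: "integrable leb01 g \<Longrightarrow> continuous_on {0..1} (prim g)"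
  by (intro abs_continuous01_imp_continuous_on abs_continuous01_prim)

text \<open>Bridge from the Lebesgue integral in \<open>prim\<close> to the gauge integral, for
  which the fundamental theorem of calculus is stated.\<close>

lemma prim_eq_integral:
  assumes "integrable leb01 g" "x \<in> {0..1}"
  shows "(g has_integral prim g x) {0..x}"
proof -
  have "((\<lambda>t. indicator {..<x} t * g t) has_integral prim g x) {0<..<1}"
    unfolding prim_def using integrable_indicator_mult[OF assms(1), of "{..<x}"]
    by (intro has_integral_integral_lebesgue_on) auto
  hence "((\<lambda>t. if t \<in> {0<..<1} then indicator {..<x} t * g t else 0) has_integral prim g x) UNIV"
    by (subst has_integral_restrict_UNIV)
  also have "(\<lambda>t. if t \<in> {0<..<1} then indicator {..<x} t * g t else 0) = (\<lambda>t. if t \<in> {0<..<x} then g t else 0)"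
    using assms(2) by (auto simp: indicator_def)
  finally have "(g has_integral prim g x) {0<..<x}"
    by (subst (asm) has_integral_restrict_UNIV)
  thus ?thesis
    by (simp add: has_integral_open_interval[of g _ 0 x, symmetric, simplified box_real])
qed

text \<open>Absolute continuity on \<open>[0,1]\<close> with the density carried as an argument. The
  density takes the place of the derivative, which may fail to exist at 0; only the values of
  \<open>F\<close> on \<open>[0,1]\<close> and of \<open>f\<close> almost everywhere matter.\<close>

definition ac :: "(real \<Rightarrow> real) \<Rightarrow> (real \<Rightarrow> real) \<Rightarrow> bool" where
  "ac F f \<longleftrightarrow> integrable leb01 f \<and> (\<forall>x\<in>{0..1}. F x = F 0 + prim f x)"

lemma acI:
  "integrable leb01 f \<Longrightarrow> (\<And>x. x \<in> {0..1} \<Longrightarrow> F x = F 0 + prim f x) \<Longrightarrow> ac F f"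
  unfolding ac_def by blast

lemma acD:
  assumes "ac F f"
  shows "integrable leb01 f" "x \<in> {0..1} \<Longrightarrow> F x = F 0 + prim f x"
  using assms unfolding ac_def by blast+

lemma ac_prim: "integrable leb01 g \<Longrightarrow> ac (prim g) g"
  by (simp add: ac_def)

lemma ac_continuous_on:
  assumes "ac F f"
  shows "continuous_on {0..1} F"
proof (rule continuous_on_eq)
  show "continuous_on {0..1} (\<lambda>x. F 0 + prim f x)"
    by (intro continuous_intros continuous_on_prim acD(1)[OF assms])
  show "F 0 + prim f x = F x" if "x \<in> {0..1}" for x using acD(2)[OF assms that] ..
qed

lemma ac_abs_continuous01:
  assumes "ac F f"
  shows "abs_continuous01 F"
proof -
  have "(\<Sum>i<(n::nat). \<bar>F (t i) - F (s i)\<bar>) = (\<Sum>i<n. \<bar>prim f (t i) - prim f (s i)\<bar>)"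
    if st: "\<forall>i<n. 0 \<le> s i \<and> s i \<le> t i \<and> t i \<le> 1" for n s t
  proof (intro sum.cong refl)
    fix i assume "i \<in> {..<n}"
    hence *: "t i \<in> {0..1}" "s i \<in> {0..1}" using st by force+
    show "\<bar>F (t i) - F (s i)\<bar> = \<bar>prim f (t i) - prim f (s i)\<bar>"
      unfolding acD(2)[OF assms *(1)] acD(2)[OF assms *(2)] by simp
  qed
  thus ?thesis
    using abs_continuous01_prim[OF acD(1)[OF assms]] unfolding abs_continuous01_def
    by (simp cong: conj_cong)
qed

lemma ac_integral: "ac F f \<Longrightarrow> (\<integral>x. f x \<partial>leb01) = F 1 - F 0"
  using acD(2)[of F f 1] by (simp add: prim_ge_1)

lemma ac_cong:
  assumes "ac F f" "\<And>x. x \<in> {0..1} \<Longrightarrow> F x = G x" "AE x in leb01. f x = g x"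
  shows "ac G g"
proof -
  have m: "f \<in> borel_measurable leb01" using acD(1)[OF assms(1)] by auto
  have g: "g \<in> borel_measurable leb01"
    by (rule borel_measurable_leb01_cong_AE[OF m assms(3)])
  have "integrable leb01 g"
    using acD(1)[OF assms(1)] integrable_cong_AE[OF m g assms(3)] by simp
  moreover have "G x = G 0 + prim g x" if "x \<in> {0..1}" for x
    using acD(2)[OF assms(1) that] unfolding assms(2)[OF that] assms(2)[of 0, simplified] prim_cong_AE[OF m assms(3)] .
  ultimately show ?thesis by (rule acI)
qed

lemma ac_const: "ac (\<lambda>_. c) (\<lambda>_. 0)"
  by (simp add: ac_def prim_def)

lemma ac_add:
  assumes "ac F f" "ac G g"
  shows "ac (\<lambda>x. F x + G x) (\<lambda>x. f x + g x)"
proof -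
  note i = acD(1)[OF assms(1)] acD(1)[OF assms(2)]
  have "prim (\<lambda>x. f x + g x) x = prim f x + prim g x" for x
    unfolding prim_def using integrable_indicator_mult[OF i(1), of "{..<x}"] integrable_indicator_mult[OF i(2), of "{..<x}"]
    by (simp add: distrib_left)
  note p = this
  show ?thesis
  proof (rule acI)
    show "integrable leb01 (\<lambda>x. f x + g x)" using i by simp
    show "F x + G x = F 0 + G 0 + prim (\<lambda>x. f x + g x) x" if "x \<in> {0..1}" for x
      unfolding p acD(2)[OF assms(1) that] acD(2)[OF assms(2) that] by simp
  qed
qed

lemma ac_cmult:
  assumes "ac F f"
  shows "ac (\<lambda>x. c * F x) (\<lambda>x. c * f x)"
proof -
  have p: "prim (\<lambda>x. c * f x) x = c * prim f x" for x
    unfolding prim_def by (simp add: mult.left_commute)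
  show ?thesis
  proof (rule acI)
    show "integrable leb01 (\<lambda>x. c * f x)" using acD(1)[OF assms] by simp
    show "c * F x = c * F 0 + prim (\<lambda>x. c * f x) x" if "x \<in> {0..1}" for x
      unfolding p acD(2)[OF assms that] by (rule distrib_left)
  qed
qed

lemma ac_minus: "ac F f \<Longrightarrow> ac (\<lambda>x. - F x) (\<lambda>x. - f x)"
  using ac_cmult[of F f "-1"] by simp

lemma ac_diff:
  assumes "ac F f" "ac G g"
  shows "ac (\<lambda>x. F x - G x) (\<lambda>x. f x - g x)"
  using ac_add[OF assms(1) ac_minus[OF assms(2)]] by simp

lemma integrable_mult_continuous:
  fixes F f :: "real \<Rightarrow> real"
  assumes "continuous_on {0..1} F" "integrable leb01 f"
  shows "integrable leb01 (\<lambda>x. F x * f x)"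
proof -
  have [measurable]: "F \<in> borel_measurable leb01"
    by (rule borel_measurable_leb01_continuous) (rule continuous_on_subset[OF assms(1)], auto)
  have [measurable]: "f \<in> borel_measurable leb01" using assms(2) by auto
  have "bounded (F ` {0..1})"
    by (intro compact_imp_bounded compact_continuous_image assms(1)) auto
  then obtain B where B: "\<forall>y \<in> F ` {0..1}. norm y \<le> B" unfolding bounded_iff by blast
  have "AE x in leb01. norm (F x * f x) \<le> norm (B * f x)"
    using AE_leb01_Ioo
  proof eventually_elim
    fix x :: real assume "x \<in> {0<..<1}"
    hence "norm (F x) \<le> B" using B by auto
    hence "\<bar>F x\<bar> \<le> \<bar>B\<bar>" by simp
    thus "norm (F x * f x) \<le> norm (B * f x)" by (simp add: abs_mult mult_right_mono)
  qed
  thus ?thesis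
    using assms(2) by (intro Bochner_Integration.integrable_bound[OF integrable_mult_right[of B, OF assms(2)]]) measurable
qed

text \<open>Integration by parts for the two densities truncated at \<open>x\<close> gives the
  product rule for primitives; the initial values enter linearly. Each multiplier identity below is
  this rule followed by evaluation at the end points.\<close>

lemma ac_mult:
  assumes F: "ac F f" and G: "ac G g"
  shows "ac (\<lambda>x. F x * G x) (\<lambda>x. f x * G x + F x * g x)"
proof -
  note f = acD(1)[OF F] and g = acD(1)[OF G]
  have i1: "integrable leb01 (\<lambda>x. f x * G x)" "integrable leb01 (\<lambda>x. F x * g x)"
    using integrable_mult_continuous[OF ac_continuous_on[OF G] f]
      integrable_mult_continuous[OF ac_continuous_on[OF F] g] by (simp_all add: mult.commute)
  have i2: "integrable leb01 (\<lambda>x. f x * prim g x)" "integrable leb01 (\<lambda>x. prim f x * g x)"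
    using integrable_mult_continuous[OF continuous_on_prim[OF g] f]
      integrable_mult_continuous[OF continuous_on_prim[OF f] g] by (simp_all add: mult.commute)
  have "F x * G x = F 0 * G 0 + prim (\<lambda>x. f x * G x + F x * g x) x" if x: "x \<in> {0..1}" for x
  proof -
    let ?f = "\<lambda>t. indicator {..<x} t * f t" and ?g = "\<lambda>t. indicator {..<x} t * g t"
    have if': "integrable leb01 ?f" and ig': "integrable leb01 ?g"
      using integrable_indicator_mult[OF f, of "{..<x}"] integrable_indicator_mult[OF g, of "{..<x}"] by simp_all
    have eq: "prim f x * prim g x = (\<integral>t. ?f t * prim ?g t \<partial>leb01) + (\<integral>t. prim ?f t * ?g t \<partial>leb01)"
      using integral_prim_by_parts(2)[OF if' ig'] by (simp add: prim_def)
    have e1: "?f t * prim ?g t = indicator {..<x} t * (f t * prim g t)" for t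
      by (cases "t < x") (simp_all add: prim_indicator)
    have e2: "prim ?f t * ?g t = indicator {..<x} t * (prim f t * g t)" for t
      by (cases "t < x") (simp_all add: prim_indicator)
    have "prim (\<lambda>x. f x * G x + F x * g x) x =
        (\<integral>t. G 0 * (indicator {..<x} t * f t) + F 0 * (indicator {..<x} t * g t)
           + (indicator {..<x} t * (f t * prim g t) + indicator {..<x} t * (prim f t * g t)) \<partial>leb01)"
      unfolding prim_def[of "\<lambda>x. f x * G x + F x * g x"]
    proof (rule Bochner_Integration.integral_cong[OF refl])
      fix t assume "t \<in> space leb01"
      hence "t \<in> {0..1}" by auto
      thus "indicator {..<x} t * (f t * G t + F t * g t) = G 0 * (indicator {..<x} t * f t) + F 0 * (indicator {..<x} t * g t)
           + (indicator {..<x} t * (f t * prim g t) + indicator {..<x} t * (prim f t * g t))"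
        unfolding acD(2)[OF F \<open>t \<in> {0..1}\<close>] acD(2)[OF G \<open>t \<in> {0..1}\<close>] by (simp add: algebra_simps)
    qed
    also have "\<dots> = G 0 * prim f x + F 0 * prim g x
        + ((\<integral>t. indicator {..<x} t * (f t * prim g t) \<partial>leb01) + (\<integral>t. indicator {..<x} t * (prim f t * g t) \<partial>leb01))"
      unfolding prim_def[of f x] prim_def[of g x]
      using integrable_indicator_mult[OF i2(1), of "{..<x}"] integrable_indicator_mult[OF i2(2), of "{..<x}"] if' ig'
      by simp
    also have "\<dots> = G 0 * prim f x + F 0 * prim g x + prim f x * prim g x"
      unfolding eq e1 e2 ..
    finally show ?thesis
      unfolding acD(2)[OF F x] acD(2)[OF G x] by (simp add: algebra_simps)
  qed
  moreover have "integrable leb01 (\<lambda>x. f x * G x + F x * g x)" using i1 by simp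
  ultimately show ?thesis by (intro acI)
qed

text \<open>Differentiability is asked for in the open interval only, with a density that may be
  unbounded; this is the form that fits \<open>x / a x\<close> near 0.\<close>

lemma ac_interior_derivative:
  assumes "continuous_on {0..1} F" "\<And>x. x \<in> {0<..<1} \<Longrightarrow> (F has_real_derivative f x) (at x)"
    and "integrable leb01 f"
  shows "ac F f"
  unfolding ac_def
proof (intro conjI ballI assms(3))
  fix x :: real assume x: "x \<in> {0..1}"
  have "(f has_integral (F x - F 0)) {0..x}"
    using x assms(2) by (intro fundamental_theorem_of_calculus_interior continuous_on_subset[OF assms(1)])
      (auto simp: has_real_derivative_iff_has_vector_derivative)
  from has_integral_unique[OF this prim_eq_integral[OF assms(3) x]] show "F x = F 0 + prim f x" by simp
qed

lemma ac_derivative: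
  assumes "continuous_on {0..1} f" "\<And>x. x \<in> {0..1} \<Longrightarrow> (F has_real_derivative f x) (at x within {0..1})"
  shows "ac F f"
proof (rule ac_interior_derivative)
  show "continuous_on {0..1} F" using assms(2) by (intro DERIV_continuous_on)
  show "(F has_real_derivative f x) (at x)" if "x \<in> {0<..<1}" for x
    using assms(2)[of x] that at_within_Icc_at[of 0 x 1] by auto
  show "integrable leb01 f" by (rule integrable_leb01_continuous) fact
qed

lemma ac_has_derivative:
  assumes "ac F f" "continuous_on {0..1} f" "x \<in> {0..1}"
  shows "(F has_real_derivative f x) (at x within {0..1})"
proof -
  have *: "((\<lambda>u. F 0 + integral {0..u} f) has_real_derivative f x) (at x within {0..1})"
    using integral_has_real_derivative[OF assms(2,3)] by (auto intro!: derivative_eq_intros)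
  show ?thesis
  proof (rule has_field_derivative_transform_within[OF * zero_less_one assms(3)])
    show "F 0 + integral {0..u} f = F u" if "u \<in> {0..1}" for u
      using acD(2)[OF assms(1) that] integral_unique[OF prim_eq_integral[OF acD(1)[OF assms(1)] that]] by simp
  qed
qed

lemma dx_eqI: "(F has_real_derivative D) (at x within {0..1}) \<Longrightarrow> x \<in> {0..1} \<Longrightarrow> dx F x = D"
  unfolding dx_def has_real_derivative_iff_has_vector_derivative
  by (rule vector_derivative_within_closed_interval) auto

lemma dx_ac: "ac F f \<Longrightarrow> continuous_on {0..1} f \<Longrightarrow> x \<in> {0..1} \<Longrightarrow> dx F x = f x"
  by (rule dx_eqI[OF ac_has_derivative])

section \<open>Weighted polynomial approximation\<close>

lemma square_sum_le: "((x::real) + y)\<^sup>2 \<le> 2 * x\<^sup>2 + 2 * y\<^sup>2"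
  using zero_le_power2[of "x - y"] by (simp add: power2_sum power2_diff)

lemma continuous_on_real_polynomial_function: "real_polynomial_function p \<Longrightarrow> continuous_on S p"
  using continuous_on_polymonial_function real_polynomial_function_eq by blast

lemma integrable_weighted_square:
  fixes f g w :: "real \<Rightarrow> real"
  assumes [measurable]: "f \<in> borel_measurable leb01" "g \<in> borel_measurable leb01" "w \<in> borel_measurable leb01"
    and w: "\<And>x. x \<in> {0<..<1} \<Longrightarrow> 0 \<le> w x"
    and fg: "integrable leb01 (\<lambda>x. (f x)\<^sup>2 * w x)" "integrable leb01 (\<lambda>x. (g x)\<^sup>2 * w x)"
  shows "integrable leb01 (\<lambda>x. (f x - g x)\<^sup>2 * w x)"
proof (rule Bochner_Integration.integrable_bound)
  show "integrable leb01 (\<lambda>x. 2 * ((f x)\<^sup>2 * w x) + 2 * ((g x)\<^sup>2 * w x))"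
    using fg by (intro Bochner_Integration.integrable_add integrable_mult_right)
  show "AE x in leb01. norm ((f x - g x)\<^sup>2 * w x) \<le> norm (2 * ((f x)\<^sup>2 * w x) + 2 * ((g x)\<^sup>2 * w x))"
  proof (rule AE_I2)
    fix x assume "x \<in> space leb01"
    hence "0 \<le> w x" using w by simp
    hence "(f x - g x)\<^sup>2 * w x \<le> (2 * (f x)\<^sup>2 + 2 * (g x)\<^sup>2) * w x"
      using square_sum_le[of "f x" "- g x"] by (intro mult_right_mono) auto
    thus "norm ((f x - g x)\<^sup>2 * w x) \<le> norm (2 * ((f x)\<^sup>2 * w x) + 2 * ((g x)\<^sup>2 * w x))"
      using \<open>0 \<le> w x\<close> by (simp add: algebra_simps)
  qed
qed measurable

lemma integral_weighted_square_triangle: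
  fixes f g h w :: "real \<Rightarrow> real"
  assumes w: "\<And>x. x \<in> {0<..<1} \<Longrightarrow> 0 \<le> w x"
    and fg: "integrable leb01 (\<lambda>x. (f x - g x)\<^sup>2 * w x)" "integrable leb01 (\<lambda>x. (g x - h x)\<^sup>2 * w x)"
      "integrable leb01 (\<lambda>x. (f x - h x)\<^sup>2 * w x)"
  shows "(\<integral>x. (f x - h x)\<^sup>2 * w x \<partial>leb01)
      \<le> 2 * (\<integral>x. (f x - g x)\<^sup>2 * w x \<partial>leb01) + 2 * (\<integral>x. (g x - h x)\<^sup>2 * w x \<partial>leb01)"
proof -
  have "(\<integral>x. (f x - h x)\<^sup>2 * w x \<partial>leb01)
     \<le> (\<integral>x. 2 * ((f x - g x)\<^sup>2 * w x) + 2 * ((g x - h x)\<^sup>2 * w x) \<partial>leb01)"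
  proof (rule integral_mono[OF fg(3)])
    show "integrable leb01 (\<lambda>x. 2 * ((f x - g x)\<^sup>2 * w x) + 2 * ((g x - h x)\<^sup>2 * w x))"
      using fg by (intro Bochner_Integration.integrable_add integrable_mult_right)
    fix x assume "x \<in> space leb01"
    hence "0 \<le> w x" using w by simp
    hence "(f x - h x)\<^sup>2 * w x \<le> (2 * (f x - g x)\<^sup>2 + 2 * (g x - h x)\<^sup>2) * w x"
      using square_sum_le[of "f x - g x" "g x - h x"] by (intro mult_right_mono) auto
    thus "(f x - h x)\<^sup>2 * w x \<le> 2 * ((f x - g x)\<^sup>2 * w x) + 2 * ((g x - h x)\<^sup>2 * w x)"
      by (simp add: algebra_simps)
  qed
  thus ?thesis using fg by simp
qed

text \<open>A measurable function is an almost everywhere limit of continuous ones; clipping these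
  at \<open>N\<close> supplies a dominating function, and Stone-Weierstrass replaces the continuous
  function by a polynomial.\<close>

lemma bounded_polynomial_approx:
  fixes f w :: "real \<Rightarrow> real"
  assumes f: "f \<in> borel_measurable leb01" and w: "integrable leb01 w" "\<And>x. x \<in> {0<..<1} \<Longrightarrow> 0 \<le> w x"
    and N: "\<And>x. x \<in> {0<..<1} \<Longrightarrow> \<bar>f x\<bar> \<le> N" and e: "0 < e"
  obtains p where "real_polynomial_function p" "integrable leb01 (\<lambda>x. (f x - p x)\<^sup>2 * w x)"
    "(\<integral>x. (f x - p x)\<^sup>2 * w x \<partial>leb01) < e"
proof -
  have [measurable]: "f \<in> borel_measurable leb01" "w \<in> borel_measurable leb01" using f w by auto
  have N0: "0 \<le> N" using N[of "1/2"] by auto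
  have sq_w: "integrable leb01 (\<lambda>x. (g x)\<^sup>2 * w x)"
    if "g \<in> borel_measurable leb01" "\<And>x. x \<in> {0<..<1} \<Longrightarrow> \<bar>g x\<bar> \<le> B" for g B
  proof (rule Bochner_Integration.integrable_bound[where f = "\<lambda>x. B\<^sup>2 * w x"])
    show "AE x in leb01. norm ((g x)\<^sup>2 * w x) \<le> norm (B\<^sup>2 * w x)"
    proof (rule AE_I2)
      fix x assume "x \<in> space leb01"
      hence "\<bar>g x\<bar> \<le> B" using that(2) by simp
      hence "(g x)\<^sup>2 \<le> B\<^sup>2" by (rule abs_le_square_iff[THEN iffD1, OF order_trans, OF _ abs_ge_self])
      thus "norm ((g x)\<^sup>2 * w x) \<le> norm (B\<^sup>2 * w x)" by (simp add: abs_mult mult_right_mono)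
    qed
  qed (use that(1) w in auto)
  have "(\<lambda>x. if x \<in> {0<..<1} then f x else 0) measurable_on UNIV"
    using f by (intro lebesgue_measurable_imp_measurable_on_real borel_measurable_if_I) auto
  then obtain Z g where Z: "negligible Z" and g: "\<And>n. continuous_on UNIV (g n :: real \<Rightarrow> real)"
    and lim: "\<And>x. x \<notin> Z \<Longrightarrow> (\<lambda>n. g n x) \<longlonglongrightarrow> (if x \<in> {0<..<1} then f x else 0)"
    unfolding measurable_on_def by auto
  define h where "h = (\<lambda>n x. max (- N) (min (g n x) N))"
  have h: "continuous_on UNIV (h n)" for n
    unfolding h_def by (intro continuous_intros g)
  have [measurable]: "h n \<in> borel_measurable leb01" for n
    by (rule borel_measurable_leb01_continuous) (rule continuous_on_subset[OF h], auto)
  have hN: "\<bar>h n x\<bar> \<le> N" for n x unfolding h_def using N0 by auto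
  have "(\<lambda>n. \<integral>x. (f x - h n x)\<^sup>2 * w x \<partial>leb01) \<longlonglongrightarrow> (\<integral>x. 0 \<partial>leb01)"
  proof (rule integral_dominated_convergence[where w = "\<lambda>x. (2 * N)\<^sup>2 * w x"])
    have "AE x in lebesgue. x \<notin> Z"
      using Z by (simp add: AE_not_in negligible_iff_null_sets)
    hence "AE x in leb01. x \<notin> Z" by (subst AE_restrict_space_iff) auto
    thus "AE x in leb01. (\<lambda>n. (f x - h n x)\<^sup>2 * w x) \<longlonglongrightarrow> 0"
      using AE_leb01_Ioo
    proof eventually_elim
      fix x :: real assume x: "x \<notin> Z" "x \<in> {0<..<1}"
      have "(\<lambda>n. g n x) \<longlonglongrightarrow> f x" using lim[OF x(1)] x(2) by simp
      hence "(\<lambda>n. h n x) \<longlonglongrightarrow> max (- N) (min (f x) N)"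
        unfolding h_def by (intro tendsto_intros)
      moreover have "max (- N) (min (f x) N) = f x" using N[OF x(2)] by auto
      ultimately have "(\<lambda>n. (f x - h n x)\<^sup>2 * w x) \<longlonglongrightarrow> (f x - f x)\<^sup>2 * w x"
        by (intro tendsto_intros) simp
      thus "(\<lambda>n. (f x - h n x)\<^sup>2 * w x) \<longlonglongrightarrow> 0" by simp
    qed
    fix n
    show "AE x in leb01. norm ((f x - h n x)\<^sup>2 * w x) \<le> (2 * N)\<^sup>2 * w x"
      using AE_leb01_Ioo
    proof eventually_elim
      fix x :: real assume x: "x \<in> {0<..<1}"
      have "\<bar>f x - h n x\<bar> \<le> 2 * N" using N[OF x] hN[of n x] by auto
      hence "(f x - h n x)\<^sup>2 \<le> (2 * N)\<^sup>2"
        by (rule abs_le_square_iff[THEN iffD1, OF order_trans, OF _ abs_ge_self])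
      thus "norm ((f x - h n x)\<^sup>2 * w x) \<le> (2 * N)\<^sup>2 * w x"
        using w(2)[OF x] by (simp add: abs_mult mult_right_mono)
    qed
  qed (use w in auto)
  hence "eventually (\<lambda>n. (\<integral>x. (f x - h n x)\<^sup>2 * w x \<partial>leb01) < e / 4) sequentially"
    using e by (intro order_tendstoD(2)) auto
  then obtain n where n: "(\<integral>x. (f x - h n x)\<^sup>2 * w x \<partial>leb01) < e / 4"
    by (auto simp: eventually_sequentially)
  define W where "W = (\<integral>x. w x \<partial>leb01)"
  have W: "0 \<le> W" unfolding W_def using w(2) by (intro integral_nonneg_AE AE_I2) simp
  \<comment> \<open>A uniform error \<open>\<eta>\<close> costs at most
    \<open>\<eta>^2 * W \<le> e / 4\<close>; the \<open>+ 1\<close> covers total weight 0. Both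
    errors are doubled by the triangle inequality for squares.\<close>
  define \<eta> where "\<eta> = sqrt (e / (4 * (W + 1)))"
  have \<eta>: "0 < \<eta>" "\<eta>\<^sup>2 = e / (4 * (W + 1))" using e W by (auto simp: \<eta>_def)
  obtain p where p: "real_polynomial_function p" "\<And>x. x \<in> {0..1} \<Longrightarrow> \<bar>h n x - p x\<bar> < \<eta>"
    using Stone_Weierstrass_real_polynomial_function[of "{0..1}" "h n" \<eta>] \<eta>(1) continuous_on_subset[OF h]
    by blast
  have [measurable]: "p \<in> borel_measurable leb01"
    by (rule borel_measurable_leb01_continuous[OF continuous_on_real_polynomial_function[OF p(1)]])
  have i1: "integrable leb01 (\<lambda>x. (f x - h n x)\<^sup>2 * w x)"
  proof (rule sq_w[where B = "2 * N"])
    fix x :: real assume x: "x \<in> {0<..<1}"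
    show "\<bar>f x - h n x\<bar> \<le> 2 * N" using N[OF x] hN[of n x] by linarith
  qed measurable
  have i2: "integrable leb01 (\<lambda>x. (h n x - p x)\<^sup>2 * w x)"
    by (rule sq_w[where B = \<eta>]) (use p(2) in \<open>auto intro: less_imp_le\<close>)
  have i3: "integrable leb01 (\<lambda>x. (f x - p x)\<^sup>2 * w x)"
    using integrable_weighted_square[OF _ _ _ w(2) i1, of "\<lambda>x. p x - h n x"] i2
    by (simp add: power2_commute)
  have "(\<integral>x. (h n x - p x)\<^sup>2 * w x \<partial>leb01) \<le> (\<integral>x. \<eta>\<^sup>2 * w x \<partial>leb01)"
  proof (rule integral_mono[OF i2])
    fix x assume "x \<in> space leb01"
    hence x: "x \<in> {0<..<1}" by simp
    have "(h n x - p x)\<^sup>2 \<le> \<eta>\<^sup>2"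
      using p(2)[of x] x \<eta>(1) by (intro abs_le_square_iff[THEN iffD1]) auto
    thus "(h n x - p x)\<^sup>2 * w x \<le> \<eta>\<^sup>2 * w x" using w(2)[OF x] by (rule mult_right_mono)
  qed (use w in simp)
  also have "\<dots> = \<eta>\<^sup>2 * W" by (simp add: W_def)
  also have "\<dots> \<le> e / 4" unfolding \<eta>(2) using e W by (simp add: field_simps)
  finally have "(\<integral>x. (f x - p x)\<^sup>2 * w x \<partial>leb01) < e"
    using integral_weighted_square_triangle[OF w(2) i1 i2 i3] n by linarith
  with p(1) i3 show thesis by (rule that)
qed

text \<open>Boundedness of \<open>f\<close> is removed by truncation. The weights met later are
  \<open>m x * |D x|\<close>, which proves that a function vanishes, and \<open>x ^ 4\<close> and
  \<open>1 / a x\<close>, which prove that the domain is dense.\<close>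

lemma polynomial_approx:
  fixes f w :: "real \<Rightarrow> real"
  assumes f: "f \<in> borel_measurable leb01" and w: "integrable leb01 w" "\<And>x. x \<in> {0<..<1} \<Longrightarrow> 0 \<le> w x"
    and fw: "integrable leb01 (\<lambda>x. (f x)\<^sup>2 * w x)" and e: "0 < e"
  obtains p where "real_polynomial_function p" "integrable leb01 (\<lambda>x. (f x - p x)\<^sup>2 * w x)"
    "(\<integral>x. (f x - p x)\<^sup>2 * w x \<partial>leb01) < e"
proof -
  have [measurable]: "f \<in> borel_measurable leb01" "w \<in> borel_measurable leb01" using f w by auto
  define h where "h = (\<lambda>n::nat. \<lambda>x. max (- real n) (min (f x) (real n)))"
  have [measurable]: "h n \<in> borel_measurable leb01" for n unfolding h_def by measurable
  have hb: "\<bar>f x - h n x\<bar> \<le> \<bar>f x\<bar>" for n x unfolding h_def by auto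
  have hb2: "\<bar>(f x - h n x)\<^sup>2 * w x\<bar> \<le> (f x)\<^sup>2 * w x" if "x \<in> {0<..<1}" for n x
    using w(2)[OF that] hb[of x n] by (simp add: abs_mult mult_right_mono abs_le_square_iff)
  have i1: "integrable leb01 (\<lambda>x. (f x - h n x)\<^sup>2 * w x)" for n
    by (rule Bochner_Integration.integrable_bound[OF fw]) (auto intro!: AE_I2 order_trans[OF hb2])
  have "(\<lambda>n. \<integral>x. (f x - h n x)\<^sup>2 * w x \<partial>leb01) \<longlonglongrightarrow> (\<integral>x. 0 \<partial>leb01)"
  proof (rule integral_dominated_convergence[OF _ _ fw])
    show "AE x in leb01. (\<lambda>n. (f x - h n x)\<^sup>2 * w x) \<longlonglongrightarrow> 0"
    proof (rule AE_I2)
      fix x :: real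
      obtain N :: nat where "\<bar>f x\<bar> \<le> real N" using real_arch_simple by blast
      hence "eventually (\<lambda>n. (f x - h n x)\<^sup>2 * w x = 0) sequentially"
        by (auto simp: eventually_sequentially h_def min_def max_def intro!: exI[of _ N])
      thus "(\<lambda>n. (f x - h n x)\<^sup>2 * w x) \<longlonglongrightarrow> 0" by (rule tendsto_eventually)
    qed
    show "AE x in leb01. norm ((f x - h n x)\<^sup>2 * w x) \<le> (f x)\<^sup>2 * w x" for n
      using AE_leb01_Ioo by eventually_elim (use hb2 in simp)
  qed auto
  hence "eventually (\<lambda>n. (\<integral>x. (f x - h n x)\<^sup>2 * w x \<partial>leb01) < e / 4) sequentially"
    using e by (intro order_tendstoD(2)) auto
  then obtain n where n: "(\<integral>x. (f x - h n x)\<^sup>2 * w x \<partial>leb01) < e / 4"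
    by (auto simp: eventually_sequentially)
  have hn: "\<bar>h n x\<bar> \<le> real n" for x unfolding h_def by auto
  have "0 < e / 4" using e by simp
  then obtain p where p: "real_polynomial_function p" "integrable leb01 (\<lambda>x. (h n x - p x)\<^sup>2 * w x)"
    "(\<integral>x. (h n x - p x)\<^sup>2 * w x \<partial>leb01) < e / 4"
    using bounded_polynomial_approx[of "h n" w "real n" "e / 4"] w hn by (auto simp del: greaterThanLessThan_iff)
  have [measurable]: "p \<in> borel_measurable leb01"
    by (rule borel_measurable_leb01_continuous[OF continuous_on_real_polynomial_function[OF p(1)]])
  have i3: "integrable leb01 (\<lambda>x. (f x - p x)\<^sup>2 * w x)"
    using integrable_weighted_square[OF _ _ _ w(2) i1[of n], of "\<lambda>x. p x - h n x"] p(2)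
    by (simp add: power2_commute)
  have "(\<integral>x. (f x - p x)\<^sup>2 * w x \<partial>leb01) < e"
    using integral_weighted_square_triangle[OF w(2) i1[of n] p(2) i3] n p(3) by linarith
  with p(1) i3 show thesis by (rule that)
qed

text \<open>Take \<open>p\<close> close to \<open>sgn D\<close> in \<open>L\<^sup>2\<close> with weight \<open>m * \<bar>D\<bar>\<close>.\<close>

lemma AE_eq_0_polynomial_moments:
  fixes D m :: "real \<Rightarrow> real"
  assumes [measurable]: "D \<in> borel_measurable leb01"
    and m: "m \<in> borel_measurable leb01" "\<And>x. x \<in> {0<..<1} \<Longrightarrow> 0 \<le> m x"
    and mD: "integrable leb01 (\<lambda>x. m x * D x)"
    and *: "\<And>p. real_polynomial_function p \<Longrightarrow> (\<integral>x. D x * (m x * p x) \<partial>leb01) = 0"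
  shows "AE x in leb01. m x > 0 \<longrightarrow> D x = 0"
proof -
  have [measurable]: "m \<in> borel_measurable leb01" by fact
  define w where "w = (\<lambda>x. m x * \<bar>D x\<bar>)"
  have w: "integrable leb01 w"
    unfolding w_def using mD
    by (rule Bochner_Integration.integrable_bound) (auto simp: abs_mult)
  have w0: "0 \<le> w x" if "x \<in> {0<..<1}" for x using m(2)[OF that] by (simp add: w_def)
  have [measurable]: "w \<in> borel_measurable leb01" using w by auto
  define W where "W = (\<integral>x. w x \<partial>leb01)"
  have W0: "0 \<le> W" unfolding W_def using w0 by (intro integral_nonneg_AE AE_I2) simp
  have bound: "W \<le> \<eta> / 2 * (W + 1)" if \<eta>: "0 < \<eta>" for \<eta>
  proof -
    have i0: "integrable leb01 (\<lambda>x. (sgn (D x))\<^sup>2 * w x)"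
      by (rule Bochner_Integration.integrable_bound[OF w]) (auto simp: abs_mult sgn_if)
    have "0 < \<eta>\<^sup>2" using \<eta> by simp
    then obtain p where p: "real_polynomial_function p" "integrable leb01 (\<lambda>x. (sgn (D x) - p x)\<^sup>2 * w x)"
      "(\<integral>x. (sgn (D x) - p x)\<^sup>2 * w x \<partial>leb01) < \<eta>\<^sup>2"
      using polynomial_approx[of "\<lambda>x. sgn (D x)" w "\<eta>\<^sup>2"] w w0 i0 by (auto simp del: greaterThanLessThan_iff)
    have [measurable]: "p \<in> borel_measurable leb01"
      by (rule borel_measurable_leb01_continuous[OF continuous_on_real_polynomial_function[OF p(1)]])
    have ip: "integrable leb01 (\<lambda>x. D x * (m x * p x))"
      using integrable_mult_continuous[OF continuous_on_real_polynomial_function[OF p(1)] mD]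
      by (simp add: mult_ac)
    have "W = (\<integral>x. w x - D x * (m x * p x) \<partial>leb01)"
      using w ip *[OF p(1)] by (simp add: W_def)
    also have "\<dots> \<le> (\<integral>x. \<eta> / 2 * w x + 1 / (2 * \<eta>) * ((sgn (D x) - p x)\<^sup>2 * w x) \<partial>leb01)"
    proof (rule integral_mono)
      show "integrable leb01 (\<lambda>x. w x - D x * (m x * p x))" using w ip by simp
      show "integrable leb01 (\<lambda>x. \<eta> / 2 * w x + 1 / (2 * \<eta>) * ((sgn (D x) - p x)\<^sup>2 * w x))"
        by (intro Bochner_Integration.integrable_add integrable_mult_right w p(2))
      fix x assume "x \<in> space leb01"
      hence x: "x \<in> {0<..<1}" by simp
      define s where "s = sgn (D x) - p x"
      have "w x - D x * (m x * p x) = s * (m x * D x)"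
        by (simp add: w_def s_def algebra_simps abs_sgn)
      also have "\<dots> \<le> \<bar>s\<bar> * w x"
        using m(2)[OF x] abs_ge_self[of "s * (m x * D x)"] by (simp add: w_def abs_mult)
      also have "\<dots> \<le> (\<eta> / 2 + 1 / (2 * \<eta>) * s\<^sup>2) * w x"
      proof (rule mult_right_mono[OF _ w0[OF x]])
        \<comment> \<open>Young's inequality: the first summand is later multiplied by the total
          mass \<open>W\<close>, the second by an error below \<open>\<eta>^2\<close>, so both are
          of order \<open>\<eta>\<close>.\<close>
        have "0 \<le> (\<bar>s\<bar> - \<eta>)\<^sup>2 / (2 * \<eta>)" using \<eta> by simp
        thus "\<bar>s\<bar> \<le> \<eta> / 2 + 1 / (2 * \<eta>) * s\<^sup>2"
          using \<eta> by (simp add: power2_diff field_simps power2_eq_square)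
      qed
      finally show "w x - D x * (m x * p x) \<le> \<eta> / 2 * w x + 1 / (2 * \<eta>) * ((sgn (D x) - p x)\<^sup>2 * w x)"
        by (simp add: s_def algebra_simps)
    qed
    also have "\<dots> = \<eta> / 2 * W + 1 / (2 * \<eta>) * (\<integral>x. (sgn (D x) - p x)\<^sup>2 * w x \<partial>leb01)"
      using w p(2) by (simp add: W_def)
    also have "\<dots> \<le> \<eta> / 2 * W + 1 / (2 * \<eta>) * \<eta>\<^sup>2"
      using p(3) \<eta> by (intro add_left_mono mult_left_mono) auto
    also have "\<dots> = \<eta> / 2 * (W + 1)"
      using \<eta> by (simp add: field_simps power2_eq_square)
    finally show ?thesis .
  qed
  have "W = 0"
  proof (rule ccontr)
    assume "W \<noteq> 0"
    hence "0 < W" using W0 by simp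
    \<comment> \<open>The choice \<open>\<eta> = W / (W + 1)\<close> turns the bound into
      \<open>W \<le> W / 2\<close>.\<close>
    hence "W \<le> (W / (W + 1)) / 2 * (W + 1)" by (intro bound) simp
    also have "\<dots> = W / 2" using \<open>0 < W\<close> by (simp add: field_simps)
    finally show False using \<open>0 < W\<close> by simp
  qed
  hence "AE x in leb01. w x = 0"
    using w w0 unfolding W_def by (subst (asm) integral_nonneg_eq_0_iff_AE) (auto intro!: AE_I2)
  thus ?thesis by eventually_elim (auto simp: w_def)
qed

section \<open>Weak derivatives\<close>

lemma has_real_derivative_max_0_square:
  "((\<lambda>y. (max 0 y)\<^sup>2) has_real_derivative 2 * max 0 y) (at (y::real))"
proof -
  consider "y > 0" | "y < 0" | "y = 0" by linarith
  thus ?thesis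
  proof cases
    case 1
    have "((\<lambda>y. y\<^sup>2) has_real_derivative 2 * max 0 y) (at y)"
      using 1 by (auto intro!: derivative_eq_intros)
    thus ?thesis
      by (rule has_field_derivative_transform_within_open[where S = "{0<..}"]) (use 1 in auto)
  next
    case 2
    have "((\<lambda>y. 0) has_real_derivative 2 * max 0 y) (at y)"
      using 2 by (auto intro!: derivative_eq_intros)
    thus ?thesis
      by (rule has_field_derivative_transform_within_open[where S = "{..<0}"]) (use 2 in auto)
  next
    case 3
    have "(\<lambda>h. ((max 0 (0 + h))\<^sup>2 - (max 0 0)\<^sup>2) / h) \<midarrow>0\<rightarrow> (0::real)"
    proof (rule tendsto_rabs_zero_cancel, rule Lim_null_comparison)
      show "eventually (\<lambda>h::real. norm \<bar>((max 0 (0 + h))\<^sup>2 - (max 0 0)\<^sup>2) / h\<bar> \<le> \<bar>h\<bar>) (at 0)"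
        by (rule always_eventually) (auto simp: max_def power2_eq_square)
      show "(\<lambda>h::real. \<bar>h\<bar>) \<midarrow>0\<rightarrow> 0" by (rule tendsto_rabs_zero) (rule tendsto_ident_at)
    qed
    thus ?thesis using 3 by (simp add: DERIV_def)
  qed
qed

text \<open>The square of the positive part of a parabola is positive exactly inside the interval
  and still \<open>C^1\<close> at its end points, which is the smoothness asked for in
  \<open>test_function\<close>.\<close>

definition bump :: "real \<Rightarrow> real \<Rightarrow> real \<Rightarrow> real" where
  "bump c d x = (max 0 ((x - c) * (d - x)))\<^sup>2"

lemma has_real_derivative_bump:
  "(bump c d has_real_derivative 2 * max 0 ((x - c) * (d - x)) * (c + d - 2 * x)) (at x)"
proof -
  have "((\<lambda>x. (x - c) * (d - x)) has_real_derivative (c + d - 2 * x)) (at x)"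
    by (auto intro!: derivative_eq_intros)
  from DERIV_chain2[OF has_real_derivative_max_0_square this] show ?thesis
    unfolding bump_def .
qed

lemma continuous_on_bump [continuous_intros]: "continuous_on S (bump c d)"
  unfolding bump_def by (intro continuous_intros)

lemma bump_nonneg [simp]: "0 \<le> bump c d x"
  by (simp add: bump_def)

lemma bump_pos: "c < x \<Longrightarrow> x < d \<Longrightarrow> 0 < bump c d x"
  by (simp add: bump_def)

lemma bump_eq_0: "c \<le> d \<Longrightarrow> x \<notin> {c<..<d} \<Longrightarrow> bump c d x = 0"
  by (cases "x \<le> c") (auto simp: bump_def mult_nonpos_nonneg mult_nonneg_nonpos intro!: max_absorb1)

lemma test_functionI:
  assumes "\<And>x. (\<phi> has_real_derivative \<phi>' x) (at x)" "continuous_on UNIV \<phi>'"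
    and "0 < c" "d < 1" "\<And>x. x \<notin> {c..d} \<Longrightarrow> \<phi> x = 0"
  shows "test_function \<phi>" "deriv \<phi> = \<phi>'"
proof -
  show "test_function \<phi>"
    unfolding test_function_def C1_differentiable_on_def
    using assms by (auto simp: has_real_derivative_iff_has_vector_derivative intro!: exI[of _ \<phi>'])
  show "deriv \<phi> = \<phi>'" using assms(1) by (intro ext DERIV_imp_deriv)
qed

lemma test_functionD:
  assumes "test_function \<phi>"
  shows "\<And>x. (\<phi> has_real_derivative deriv \<phi> x) (at x)" "continuous_on UNIV (deriv \<phi>)"
    and "\<phi> 0 = 0" "\<phi> 1 = 0" "ac \<phi> (deriv \<phi>)"
    and "\<exists>c d. 0 < c \<and> d < 1 \<and> (\<forall>x. x \<notin> {c..d} \<longrightarrow> \<phi> x = 0 \<and> deriv \<phi> x = 0)"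
proof -
  obtain D where D: "\<And>x. (\<phi> has_vector_derivative D x) (at x)" "continuous_on UNIV D"
    using assms unfolding test_function_def C1_differentiable_on_def by auto
  hence D1: "(\<phi> has_real_derivative D x) (at x)" for x
    by (simp add: has_real_derivative_iff_has_vector_derivative)
  have D2: "deriv \<phi> = D" by (intro ext DERIV_imp_deriv D1)
  show 1: "(\<phi> has_real_derivative deriv \<phi> x) (at x)" for x using D1 D2 by simp
  show 2: "continuous_on UNIV (deriv \<phi>)" using D D2 by simp
  obtain c d where cd: "0 < c" "d < 1" "\<forall>x. x \<notin> {c..d} \<longrightarrow> \<phi> x = 0"
    using assms unfolding test_function_def by auto
  show "\<phi> 0 = 0" "\<phi> 1 = 0" using cd by auto
  show "ac \<phi> (deriv \<phi>)"
    by (intro ac_derivative continuous_on_subset[OF 2] has_field_derivative_at_within[OF 1]) auto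
  have "deriv \<phi> x = 0" if "x \<notin> {c..d}" for x
  proof -
    have "((\<lambda>_. 0) has_real_derivative 0) (at x)" by simp
    hence "(\<phi> has_real_derivative 0) (at x)"
      by (rule has_field_derivative_transform_within_open[where S = "- {c..d}"]) (use that cd in auto)
    thus ?thesis by (rule DERIV_imp_deriv)
  qed
  thus "\<exists>c d. 0 < c \<and> d < 1 \<and> (\<forall>x. x \<notin> {c..d} \<longrightarrow> \<phi> x = 0 \<and> deriv \<phi> x = 0)"
    using cd by blast
qed

lemma test_function_bump_polynomial:
  assumes "0 < c" "c \<le> d" "d < 1" "real_polynomial_function p"
  shows "test_function (\<lambda>x. bump c d x * p x)"
proof -
  obtain p' where p': "real_polynomial_function p'" "\<And>x. (p has_real_derivative p' x) (at x)"
    using has_real_derivative_polynomial_function[OF assms(4)] by blast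
  show ?thesis
  proof (rule test_functionI)
    show "((\<lambda>x. bump c d x * p x) has_real_derivative
        (2 * max 0 ((x - c) * (d - x)) * (c + d - 2 * x)) * p x + p' x * bump c d x) (at x)" for x
      by (rule DERIV_mult[OF has_real_derivative_bump p'(2)])
    show "continuous_on UNIV (\<lambda>x. (2 * max 0 ((x - c) * (d - x)) * (c + d - 2 * x)) * p x + p' x * bump c d x)"
      by (intro continuous_intros continuous_on_real_polynomial_function p' assms)
    show "bump c d x * p x = 0" if "x \<notin> {c..d}" for x
      using bump_eq_0[OF assms(2), of x] that by auto
  qed (use assms in auto)
qed

lemma loc_integrable_measurable:
  assumes "loc_integrable f"
  shows "f \<in> borel_measurable leb01"
proof (rule borel_measurable_LIMSEQ_real)
  define J where "J = (\<lambda>n::nat. {1 / real (n + 2)..1 - 1 / real (n + 2)})"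
  show "(\<lambda>x. indicator (J n) x * f x) \<in> borel_measurable leb01" for n
  proof (rule measurable_restrict_space1)
    have "set_integrable lebesgue (J n) f"
      unfolding J_def using assms unfolding loc_integrable_def by (intro assms[unfolded loc_integrable_def, rule_format]) auto
    thus "(\<lambda>x. indicator (J n) x * f x) \<in> borel_measurable lebesgue"
      unfolding set_integrable_def by auto
  qed
  fix x assume "x \<in> space leb01"
  hence x: "0 < x" "x < 1" by auto
  obtain N :: nat where N: "1 / x < real N" "1 / (1 - x) < real N"
    using reals_Archimedean2[of "max (1 / x) (1 / (1 - x))"] by auto
  have "eventually (\<lambda>n. indicator (J n) x * f x = f x) sequentially"
  proof (rule eventually_sequentiallyI[of N])
    fix n assume n: "N \<le> n"
    have "1 / x < real (n + 2)" "1 / (1 - x) < real (n + 2)" using N n by auto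
    hence "1 / real (n + 2) < x" "1 / real (n + 2) < 1 - x" using x by (auto simp: field_simps)
    thus "indicator (J n) x * f x = f x" by (auto simp: J_def)
  qed
  thus "(\<lambda>n. indicator (J n) x * f x) \<longlonglongrightarrow> f x" by (rule tendsto_eventually)
qed

lemma loc_integrable_indicator:
  assumes "loc_integrable f" "0 < c" "d < 1"
  shows "integrable leb01 (\<lambda>x. indicator {c..d} x * f x)"
proof -
  have "integrable lebesgue (\<lambda>x. indicator {c..d} x * f x)"
    using assms unfolding loc_integrable_def set_integrable_def by auto
  hence "integrable lebesgue (\<lambda>x. indicator {0<..<1} x *\<^sub>R (indicator {c..d} x * f x))"
    by (rule integrable_mult_indicator[rotated]) auto
  thus ?thesis by (subst integrable_restrict_space) auto
qed

lemma integrable_imp_loc_integrable: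
  assumes "integrable leb01 f"
  shows "loc_integrable f"
  unfolding loc_integrable_def set_integrable_def
proof (intro allI impI)
  fix c d :: real assume cd: "0 < c" "d < 1"
  have "integrable lebesgue (\<lambda>x. indicator {0<..<1} x *\<^sub>R f x)"
    using assms by (subst (asm) integrable_restrict_space) auto
  hence "integrable lebesgue (\<lambda>x. indicator {c..d} x *\<^sub>R (indicator {0<..<1} x *\<^sub>R f x))"
    by (rule integrable_mult_indicator[rotated]) auto
  also have "(\<lambda>x. indicator {c..d} x *\<^sub>R (indicator {0<..<1} x *\<^sub>R f x)) = (\<lambda>x. indicator {c..d} x *\<^sub>R f x)"
    using cd by (auto simp: indicator_def)
  finally show "integrable lebesgue (\<lambda>x. indicator {c..d} x *\<^sub>R f x)" .
qed

lemma loc_integrable_cong_AE: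
  assumes "loc_integrable f" "AE x in leb01. f x = g x"
  shows "loc_integrable g"
  unfolding loc_integrable_def set_integrable_def
proof (intro allI impI)
  fix c d :: real assume cd: "0 < c" "d < 1"
  have i: "integrable lebesgue (\<lambda>x. indicator {c..d} x *\<^sub>R f x)"
    using assms(1) cd unfolding loc_integrable_def set_integrable_def by blast
  have "AE x in lebesgue. x \<in> {0<..<1} \<longrightarrow> f x = g x"
    using assms(2) by (subst (asm) AE_restrict_space_iff) auto
  hence ae: "AE x in lebesgue. indicator {c..d} x *\<^sub>R f x = indicator {c..d} x *\<^sub>R g x"
    by eventually_elim (use cd in \<open>auto simp: indicator_def\<close>)
  moreover have "(\<lambda>x. indicator {c..d} x *\<^sub>R g x) \<in> borel_measurable lebesgue"
    using borel_measurable_AE[OF _ ae] i by auto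
  ultimately show "integrable lebesgue (\<lambda>x. indicator {c..d} x *\<^sub>R g x)"
    using i integrable_cong_AE[of "\<lambda>x. indicator {c..d} x *\<^sub>R f x" lebesgue "\<lambda>x. indicator {c..d} x *\<^sub>R g x"] by auto
qed

lemma loc_integrable_diff:
  "loc_integrable f \<Longrightarrow> loc_integrable g \<Longrightarrow> loc_integrable (\<lambda>x. f x - g x)"
  unfolding loc_integrable_def by (auto intro: set_integral_diff)

lemma loc_integrable_mult_test:
  assumes f: "loc_integrable f" and \<psi>: "continuous_on UNIV \<psi>" "0 < c" "d < 1" "\<And>x. x \<notin> {c..d} \<Longrightarrow> \<psi> x = 0"
  shows "integrable leb01 (\<lambda>x. f x * \<psi> x)"
proof -
  have "integrable leb01 (\<lambda>x. \<psi> x * (indicator {c..d} x * f x))"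
    by (intro integrable_mult_continuous loc_integrable_indicator f assms continuous_on_subset[OF \<psi>(1)]) auto
  also have "(\<lambda>x. \<psi> x * (indicator {c..d} x * f x)) = (\<lambda>x. f x * \<psi> x)"
  proof
    show "\<psi> x * (indicator {c..d} x * f x) = f x * \<psi> x" for x
      using \<psi>(4)[of x] by (cases "x \<in> {c..d}") (simp_all del: atLeastAtMost_iff)
  qed
  finally show ?thesis .
qed

lemma integrable_mult_test:
  assumes "loc_integrable f" "test_function \<phi>"
  shows "integrable leb01 (\<lambda>x. f x * \<phi> x)" "integrable leb01 (\<lambda>x. f x * deriv \<phi> x)"
proof -
  obtain c d where "0 < c" "d < 1" "\<forall>x. x \<notin> {c..d} \<longrightarrow> \<phi> x = 0 \<and> deriv \<phi> x = 0"
    using test_functionD(6)[OF assms(2)] by blast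
  moreover have "continuous_on UNIV \<phi>"
    by (rule DERIV_continuous_on[OF has_field_derivative_at_within[OF test_functionD(1)[OF assms(2)]]])
  ultimately show "integrable leb01 (\<lambda>x. f x * \<phi> x)" "integrable leb01 (\<lambda>x. f x * deriv \<phi> x)"
    using test_functionD(2)[OF assms(2)] by (auto intro!: loc_integrable_mult_test[OF assms(1)])
qed

text \<open>Fundamental lemma of the calculus of variations. A bump times a polynomial is a test
  function, so all polynomial moments of \<open>D\<close> against the bump vanish and
  \<open>D\<close> vanishes where the bump is positive; countably many bumps exhaust
  \<open>(0,1)\<close>.\<close>

lemma AE_eq_0_test_function:
  assumes D: "loc_integrable D" and *: "\<And>\<phi>. test_function \<phi> \<Longrightarrow> (\<integral>x. D x * \<phi> x \<partial>leb01) = 0"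
  shows "AE x in leb01. D x = 0"
proof -
  have "AE x in leb01. bump (1 / real (n + 3)) (1 - 1 / real (n + 3)) x > 0 \<longrightarrow> D x = 0" for n :: nat
  proof (rule AE_eq_0_polynomial_moments)
    let ?c = "1 / real (n + 3)"
    have cd: "0 < ?c" "?c \<le> 1 - ?c" "1 - ?c < 1" by (auto simp: field_simps)
    show "D \<in> borel_measurable leb01" by (rule loc_integrable_measurable[OF D])
    show "bump ?c (1 - ?c) \<in> borel_measurable leb01"
      by (intro borel_measurable_leb01_continuous continuous_intros)
    show "integrable leb01 (\<lambda>x. bump ?c (1 - ?c) x * D x)"
    proof (subst mult.commute, rule loc_integrable_mult_test[OF D continuous_on_bump cd(1,3)])
      show "bump ?c (1 - ?c) x = 0" if "x \<notin> {?c..1 - ?c}" for x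
        using bump_eq_0[OF cd(2), of x] that by auto
    qed
    show "(\<integral>x. D x * (bump ?c (1 - ?c) x * p x) \<partial>leb01) = 0" if "real_polynomial_function p" for p
      by (intro * test_function_bump_polynomial cd that)
  qed simp
  hence "AE x in leb01. \<forall>n. bump (1 / real (n + 3)) (1 - 1 / real (n + 3)) x > 0 \<longrightarrow> D x = 0"
    by (subst AE_all_countable) blast
  thus ?thesis
    using AE_leb01_Ioo
  proof eventually_elim
    fix x :: real assume n: "\<forall>n. bump (1 / real (n + 3)) (1 - 1 / real (n + 3)) x > 0 \<longrightarrow> D x = 0"
      and "x \<in> {0<..<1}"
    hence x: "0 < x" "x < 1" by auto
    obtain N :: nat where N: "1 / x < real N" "1 / (1 - x) < real N"
      using reals_Archimedean2[of "max (1 / x) (1 / (1 - x))"] by auto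
    have "1 / x < real (N + 3)" "1 / (1 - x) < real (N + 3)" using N by auto
    hence "1 / real (N + 3) < x" "1 / real (N + 3) < 1 - x" using x by (auto simp: field_simps)
    thus "D x = 0" using n bump_pos[of "1 / real (N + 3)" x "1 - 1 / real (N + 3)"] by auto
  qed
qed

section \<open>Uniqueness of weak derivatives and the lemma of du Bois-Reymond\<close>

lemma has_weak_derivD:
  "has_weak_deriv f g \<Longrightarrow> test_function \<phi>
    \<Longrightarrow> (\<integral>x. f x * deriv \<phi> x \<partial>leb01) = - (\<integral>x. g x * \<phi> x \<partial>leb01)"
  unfolding has_weak_deriv_def by blast

lemma has_weak_deriv_unique:
  assumes "has_weak_deriv f g" "has_weak_deriv f g'"
  shows "AE x in leb01. g x = g' x"
proof -
  have g: "loc_integrable g" "loc_integrable g'" using assms by (auto simp: has_weak_deriv_def)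
  have "AE x in leb01. g x - g' x = 0"
  proof (rule AE_eq_0_test_function[OF loc_integrable_diff[OF g]])
    fix \<phi> assume \<phi>: "test_function \<phi>"
    have "(\<integral>x. g x * \<phi> x \<partial>leb01) = (\<integral>x. g' x * \<phi> x \<partial>leb01)"
      using has_weak_derivD[OF assms(1) \<phi>] has_weak_derivD[OF assms(2) \<phi>] by linarith
    thus "(\<integral>x. (g x - g' x) * \<phi> x \<partial>leb01) = 0"
      using integrable_mult_test(1)[OF g(1) \<phi>] integrable_mult_test(1)[OF g(2) \<phi>]
      by (simp add: left_diff_distrib)
  qed
  thus ?thesis by simp
qed

lemma has_weak_deriv_cong_AE:
  assumes "has_weak_deriv f g" "AE x in leb01. f x = f' x" "AE x in leb01. g x = g' x"
  shows "has_weak_deriv f' g'"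
proof -
  have l: "loc_integrable f" "loc_integrable g" using assms by (auto simp: has_weak_deriv_def)
  have l': "loc_integrable f'" "loc_integrable g'"
    using loc_integrable_cong_AE[OF l(1) assms(2)] loc_integrable_cong_AE[OF l(2) assms(3)] by auto
  have "(\<integral>x. f' x * deriv \<phi> x \<partial>leb01) = - (\<integral>x. g' x * \<phi> x \<partial>leb01)" if \<phi>: "test_function \<phi>" for \<phi>
  proof -
    have "(\<integral>x. f' x * deriv \<phi> x \<partial>leb01) = (\<integral>x. f x * deriv \<phi> x \<partial>leb01)"
      using integrable_mult_test[OF l(1) \<phi>] integrable_mult_test[OF l'(1) \<phi>] assms(2)
      by (intro integral_cong_AE) auto
    moreover have "(\<integral>x. g' x * \<phi> x \<partial>leb01) = (\<integral>x. g x * \<phi> x \<partial>leb01)"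
      using integrable_mult_test[OF l(2) \<phi>] integrable_mult_test[OF l'(2) \<phi>] assms(3)
      by (intro integral_cong_AE) auto
    ultimately show ?thesis using has_weak_derivD[OF assms(1) \<phi>] by linarith
  qed
  thus ?thesis using l' unfolding has_weak_deriv_def by blast
qed

text \<open>The product with a test function vanishes at 0 and 1, so the density given by the
  product rule has integral zero.\<close>

lemma has_weak_deriv_ac:
  assumes "ac F f"
  shows "has_weak_deriv F f"
  unfolding has_weak_deriv_def
proof (intro conjI allI impI)
  show "loc_integrable F"
    by (intro integrable_imp_loc_integrable integrable_leb01_continuous ac_continuous_on[OF assms])
  show "loc_integrable f" by (intro integrable_imp_loc_integrable acD(1)[OF assms])
  fix \<phi> assume \<phi>: "test_function \<phi>"
  have ac: "ac (\<lambda>x. F x * \<phi> x) (\<lambda>x. f x * \<phi> x + F x * deriv \<phi> x)"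
    by (rule ac_mult[OF assms test_functionD(5)[OF \<phi>]])
  show "(\<integral>x. F x * deriv \<phi> x \<partial>leb01) = - (\<integral>x. f x * \<phi> x \<partial>leb01)"
    using ac_integral[OF ac] test_functionD(3,4)[OF \<phi>]
      integrable_mult_test(1)[OF \<open>loc_integrable f\<close> \<phi>] integrable_mult_test(2)[OF \<open>loc_integrable F\<close> \<phi>]
    by simp
qed

lemma wderiv_has_weak_deriv: "has_weak_deriv f g \<Longrightarrow> has_weak_deriv f (wderiv f)"
  unfolding wderiv_def by (rule someI[of "has_weak_deriv f"])

lemma wderiv_AE: "has_weak_deriv f g \<Longrightarrow> AE x in leb01. wderiv f x = g x"
  using has_weak_deriv_unique wderiv_has_weak_deriv by blast

text \<open>Vanishing mean makes the primitive return to 0 to the right of the support; this is what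
  turns it into a test function.\<close>

lemma test_function_primitive:
  assumes \<psi>: "continuous_on UNIV \<psi>" "0 < c" "d < 1" "c \<le> d" "\<And>x. x \<notin> {c..d} \<Longrightarrow> \<psi> x = 0"
    and 0: "(\<integral>x. \<psi> x \<partial>leb01) = 0"
  shows "test_function (prim \<psi>)" "deriv (prim \<psi>) = \<psi>"
proof -
  have c01: "continuous_on {0..1} \<psi>" by (rule continuous_on_subset[OF \<psi>(1)]) auto
  have acp: "ac (prim \<psi>) \<psi>" by (intro ac_prim integrable_leb01_continuous c01)
  have lt: "prim \<psi> x = 0" if "x < c" for x
  proof -
    have "prim \<psi> x = (\<integral>t. 0 \<partial>leb01)"
      unfolding prim_def by (intro Bochner_Integration.integral_cong) (use that \<psi>(5) in \<open>auto simp: indicator_def\<close>)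
    thus ?thesis by simp
  qed
  have gt: "prim \<psi> x = 0" if "x > d" for x
  proof -
    have "prim \<psi> x = (\<integral>t. \<psi> t \<partial>leb01)"
      unfolding prim_def by (intro Bochner_Integration.integral_cong) (use that \<psi>(5) in \<open>auto simp: indicator_def\<close>)
    thus ?thesis using 0 by simp
  qed
  have d: "(prim \<psi> has_real_derivative \<psi> x) (at x)" for x
  proof -
    consider "x \<in> {0<..<1}" | "x < c" | "x > d" using assms(2-4) by force
    thus ?thesis
    proof cases
      case 1
      thus ?thesis using ac_has_derivative[OF acp c01, of x] at_within_Icc_at[of 0 x 1] by simp
    next
      case 2
      have "((\<lambda>_. 0) has_real_derivative \<psi> x) (at x)" using \<psi>(5)[of x] 2 by simp
      thus ?thesis by (rule has_field_derivative_transform_within_open[where S = "{..<c}"]) (use 2 lt in auto)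
    next
      case 3
      have "((\<lambda>_. 0) has_real_derivative \<psi> x) (at x)" using \<psi>(5)[of x] 3 by simp
      thus ?thesis by (rule has_field_derivative_transform_within_open[where S = "{d<..}"]) (use 3 gt in auto)
    qed
  qed
  have z: "prim \<psi> x = 0" if "x \<notin> {c..d}" for x using lt gt that by force
  show "test_function (prim \<psi>)" "deriv (prim \<psi>) = \<psi>"
    by (rule test_functionI[OF d \<psi>(1-3)]; use z in blast)+
qed

text \<open>Lemma of du Bois-Reymond. A bump times a polynomial becomes the derivative of a test
  function once a multiple of one fixed bump is subtracted to make its mean zero. The constant
  \<open>C\<close> is the mean of \<open>h\<close> against the fixed bump.\<close>

lemma AE_const_test_function:
  assumes h: "integrable leb01 h" and *: "\<And>\<phi>. test_function \<phi> \<Longrightarrow> (\<integral>x. h x * deriv \<phi> x \<partial>leb01) = 0"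
  obtains C where "AE x in leb01. h x = C"
proof -
  let ?b = "bump (1 / 3) (2 / 3)"
  have im: "integrable leb01 (bump c d)" for c d
    by (intro integrable_leb01_continuous continuous_intros)
  have ihm: "integrable leb01 (\<lambda>x. h x * bump c d x)" for c d
    using integrable_mult_continuous[OF continuous_on_bump h] by (simp add: mult.commute)
  have "(\<integral>x. ?b x \<partial>leb01) \<noteq> 0"
  proof
    assume "(\<integral>x. ?b x \<partial>leb01) = 0"
    hence "AE x in leb01. ?b x = 0" by (subst (asm) integral_nonneg_eq_0_iff_AE) (auto simp: im)
    hence "AE x in leb01. x \<notin> {1 / 3<..<2 / 3}"
    proof eventually_elim
      fix x :: real assume "?b x = 0"
      thus "x \<notin> {1 / 3<..<2 / 3}" using bump_pos[of "1 / 3" x "2 / 3"] by auto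
    qed
    hence "AE x in lebesgue. x \<notin> {1 / 3<..<2 / 3 :: real}"
      by (subst (asm) AE_restrict_space_iff) (auto elim: eventually_mono)
    hence "{1 / 3<..<2 / 3 :: real} \<in> null_sets lebesgue"
      by (subst completion.null_sets_iff_AE) auto
    thus False by (auto simp: null_sets_def)
  qed
  then obtain Z where Z: "Z \<noteq> 0" "(\<integral>x. ?b x \<partial>leb01) = Z" by blast
  define C where "C = (\<integral>x. h x * ?b x \<partial>leb01) / Z"
  have hC: "loc_integrable (\<lambda>x. h x - C)"
    using h by (intro integrable_imp_loc_integrable) simp
  have "AE x in leb01. bump (1 / real (n + 3)) (1 - 1 / real (n + 3)) x > 0 \<longrightarrow> h x - C = 0" for n :: nat
  proof (rule AE_eq_0_polynomial_moments)
    let ?c = "1 / real (n + 3)"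
    let ?m = "bump ?c (1 - ?c)"
    \<comment> \<open>The shift by 3 makes \<open>[?c, 1 - ?c]\<close> contain the support
      \<open>[1/3, 2/3]\<close> of the fixed bump, so that this one interval supports all of
      \<open>?\<psi>\<close>.\<close>
    have cd: "0 < ?c" "?c \<le> 1 - ?c" "1 - ?c < 1" "?c \<le> 1 / 3" by (auto simp: field_simps)
    show "(\<lambda>x. h x - C) \<in> borel_measurable leb01" using h by simp
    show "?m \<in> borel_measurable leb01"
      by (intro borel_measurable_leb01_continuous continuous_intros)
    show "integrable leb01 (\<lambda>x. ?m x * (h x - C))"
      by (intro integrable_mult_continuous continuous_intros) (use h in simp)
    fix p :: "real \<Rightarrow> real" assume p: "real_polynomial_function p"
    note cp = continuous_on_real_polynomial_function[OF p]
    have imp: "integrable leb01 (\<lambda>x. ?m x * p x)"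
      by (intro integrable_leb01_continuous continuous_intros cp)
    have ihmp: "integrable leb01 (\<lambda>x. h x * (?m x * p x))"
      using integrable_mult_continuous[OF _ h, of "\<lambda>x. ?m x * p x"]
      by (simp add: mult.commute continuous_intros cp)
    define \<kappa> where "\<kappa> = (\<integral>x. ?m x * p x \<partial>leb01) / Z"
    let ?\<psi> = "\<lambda>x. ?m x * p x - \<kappa> * ?b x"
    have z: "?\<psi> x = 0" if "x \<notin> {?c..1 - ?c}" for x
    proof -
      have "x \<notin> {?c<..<1 - ?c}" "x \<notin> {1 / 3<..<2 / 3}" using that cd(4)
        unfolding atLeastAtMost_iff greaterThanLessThan_iff by linarith+
      thus ?thesis using bump_eq_0[OF cd(2), of x] bump_eq_0[of "1 / 3" "2 / 3" x] by simp
    qed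
    have i0: "(\<integral>x. ?\<psi> x \<partial>leb01) = 0"
      using imp im Z by (simp add: \<kappa>_def)
    have "continuous_on UNIV ?\<psi>" by (intro continuous_intros cp)
    note tp = test_function_primitive[OF this cd(1,3,2) z i0]
    from *[OF tp(1)] tp(2) have "(\<integral>x. h x * ?\<psi> x \<partial>leb01) = 0" by simp
    moreover have "(\<integral>x. h x * ?\<psi> x \<partial>leb01) = (\<integral>x. h x * (?m x * p x) \<partial>leb01) - \<kappa> * (\<integral>x. h x * ?b x \<partial>leb01)"
      using ihmp ihm by (simp add: right_diff_distrib mult.left_commute)
    ultimately show "(\<integral>x. (h x - C) * (?m x * p x) \<partial>leb01) = 0"
      using ihmp imp Z by (simp add: left_diff_distrib \<kappa>_def C_def)
  qed simp
  hence "AE x in leb01. \<forall>n. bump (1 / real (n + 3)) (1 - 1 / real (n + 3)) x > 0 \<longrightarrow> h x - C = 0"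
    by (subst AE_all_countable) blast
  hence "AE x in leb01. h x = C"
    using AE_leb01_Ioo
  proof eventually_elim
    fix x :: real assume n: "\<forall>n. bump (1 / real (n + 3)) (1 - 1 / real (n + 3)) x > 0 \<longrightarrow> h x - C = 0"
      and "x \<in> {0<..<1}"
    hence x: "0 < x" "x < 1" by auto
    obtain N :: nat where N: "1 / x < real N" "1 / (1 - x) < real N"
      using reals_Archimedean2[of "max (1 / x) (1 / (1 - x))"] by auto
    have "1 / x < real (N + 3)" "1 / (1 - x) < real (N + 3)" using N by auto
    hence "1 / real (N + 3) < x" "1 / real (N + 3) < 1 - x" using x by (auto simp: field_simps)
    thus "h x = C" using n bump_pos[of "1 / real (N + 3)" x "1 - 1 / real (N + 3)"] by auto
  qed
  thus thesis by (rule that)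
qed

text \<open>The difference between \<open>f\<close> and the primitive of \<open>g\<close> has weak
  derivative zero and is therefore constant. This is the passage from weak derivatives to absolutely
  continuous representatives.\<close>

lemma has_weak_deriv_imp_prim:
  assumes fg: "has_weak_deriv f g" and f: "integrable leb01 f" and g: "integrable leb01 g"
  obtains C where "AE x in leb01. f x = C + prim g x"
proof -
  have p: "has_weak_deriv (prim g) g" by (intro has_weak_deriv_ac ac_prim g)
  have ip: "integrable leb01 (prim g)" by (intro integrable_leb01_continuous continuous_on_prim g)
  obtain C where "AE x in leb01. f x - prim g x = C"
  proof (rule AE_const_test_function)
    show "integrable leb01 (\<lambda>x. f x - prim g x)" using f ip by simp
    fix \<phi> assume \<phi>: "test_function \<phi>"
    have "(\<integral>x. f x * deriv \<phi> x \<partial>leb01) = (\<integral>x. prim g x * deriv \<phi> x \<partial>leb01)"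
      using has_weak_derivD[OF fg \<phi>] has_weak_derivD[OF p \<phi>] by linarith
    thus "(\<integral>x. (f x - prim g x) * deriv \<phi> x \<partial>leb01) = 0"
      using integrable_mult_test(2)[OF integrable_imp_loc_integrable[OF f] \<phi>]
        integrable_mult_test(2)[OF integrable_imp_loc_integrable[OF ip] \<phi>]
      by (simp add: left_diff_distrib)
  qed
  hence "AE x in leb01. f x = C + prim g x" by eventually_elim simp
  thus thesis by (rule that)
qed

section \<open>The degenerate coefficient and the space of finite bending energy\<close>

text \<open>The primitive of the difference vanishes identically, hence so does its derivative on
  \<open>[0,1]\<close>, which by continuity is the difference itself, at the end points too.
  Boundary values of classes become well defined in this way.\<close>

lemma continuous_AE_eq:
  fixes f g :: "real \<Rightarrow> real"
  assumes f: "continuous_on {0..1} f" and g: "continuous_on {0..1} g" and ae: "AE x in leb01. f x = g x"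
    and x: "x \<in> {0..1}"
  shows "f x = g x"
proof -
  let ?h = "\<lambda>x. f x - g x"
  have h: "continuous_on {0..1} ?h" by (intro continuous_intros f g)
  have i: "integrable leb01 ?h" by (rule integrable_leb01_continuous[OF h])
  have "prim ?h y = prim (\<lambda>_. 0) y" for y
    using i ae by (intro prim_cong_AE) auto
  hence "prim ?h = (\<lambda>_. 0)" by (auto simp: prim_def)
  moreover have "dx (prim ?h) x = ?h x" by (rule dx_ac[OF ac_prim[OF i] h x])
  moreover have "dx (\<lambda>_. 0) x = 0" by (rule dx_eqI[OF _ x]) simp
  ultimately show ?thesis by simp
qed

lemma has_real_derivative_imp_differentiable_within:
  "(f has_real_derivative D) (at x within S) \<Longrightarrow> f differentiable (at x within S)"
  unfolding has_field_derivative_def differentiable_def by blast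

lemma integral_leb01_nonneg:
  fixes f :: "real \<Rightarrow> real"
  shows "(\<And>x. x \<in> {0<..<1} \<Longrightarrow> 0 \<le> f x) \<Longrightarrow> 0 \<le> (\<integral>x. f x \<partial>leb01)"
  by (intro integral_nonneg_AE AE_I2) simp

lemma integral_leb01_mono:
  fixes f g :: "real \<Rightarrow> real"
  assumes "integrable leb01 f" "integrable leb01 g" "\<And>x. x \<in> {0<..<1} \<Longrightarrow> f x \<le> g x"
  shows "(\<integral>x. f x \<partial>leb01) \<le> (\<integral>x. g x \<partial>leb01)"
  using assms by (intro integral_mono) auto

lemma integrable_leb01_bound:
  fixes f g :: "real \<Rightarrow> real"
  assumes "integrable leb01 f" "g \<in> borel_measurable leb01" "\<And>x. x \<in> {0<..<1} \<Longrightarrow> \<bar>g x\<bar> \<le> f x"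
  shows "integrable leb01 g"
  by (rule Bochner_Integration.integrable_bound[OF assms(1,2)])
     (use assms(3) in \<open>auto intro!: AE_I2 intro: order_trans[OF _ abs_ge_self]\<close>)

lemma in_L2D:
  assumes "in_L2 f"
  shows "f \<in> borel_measurable leb01" "integrable leb01 (\<lambda>x. (f x)\<^sup>2)" "integrable leb01 f"
proof -
  show m: "f \<in> borel_measurable leb01" and i: "integrable leb01 (\<lambda>x. (f x)\<^sup>2)"
    using assms by (auto simp: in_L2_def)
  show "integrable leb01 f"
  proof (rule integrable_leb01_bound[OF _ m])
    show "integrable leb01 (\<lambda>x. 1 + (f x)\<^sup>2)" using i by simp
    show "\<bar>f x\<bar> \<le> 1 + (f x)\<^sup>2" for x
    proof -
      have "0 \<le> (\<bar>f x\<bar> - 1)\<^sup>2" "0 \<le> (f x)\<^sup>2" by simp_all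
      thus ?thesis by (simp add: power2_diff)
    qed
  qed
qed

lemma integrable_mult_L2:
  fixes f g :: "real \<Rightarrow> real"
  assumes m: "f \<in> borel_measurable leb01" "g \<in> borel_measurable leb01"
    and f: "integrable leb01 (\<lambda>x. (f x)\<^sup>2)" and g: "integrable leb01 (\<lambda>x. (g x)\<^sup>2)"
  shows "integrable leb01 (\<lambda>x. f x * g x)"
proof (rule integrable_leb01_bound)
  show "integrable leb01 (\<lambda>x. (f x)\<^sup>2 + (g x)\<^sup>2)" using f g by simp
  show "(\<lambda>x. f x * g x) \<in> borel_measurable leb01" using m by simp
  show "\<bar>f x * g x\<bar> \<le> (f x)\<^sup>2 + (g x)\<^sup>2" for x
  proof -
    have "0 \<le> (\<bar>f x\<bar> - \<bar>g x\<bar>)\<^sup>2" by simp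
    hence "2 * \<bar>f x * g x\<bar> \<le> (f x)\<^sup>2 + (g x)\<^sup>2" by (simp add: power2_diff abs_mult)
    thus ?thesis by simp
  qed
qed

lemma Cauchy_Schwarz_leb01:
  fixes f g :: "real \<Rightarrow> real"
  assumes m: "f \<in> borel_measurable leb01" "g \<in> borel_measurable leb01"
    and f: "integrable leb01 (\<lambda>x. (f x)\<^sup>2)" and g: "integrable leb01 (\<lambda>x. (g x)\<^sup>2)"
  shows "(\<integral>x. f x * g x \<partial>leb01)\<^sup>2 \<le> (\<integral>x. (f x)\<^sup>2 \<partial>leb01) * (\<integral>x. (g x)\<^sup>2 \<partial>leb01)"
proof -
  define A where "A = (\<integral>x. (f x)\<^sup>2 \<partial>leb01)"
  define B where "B = (\<integral>x. f x * g x \<partial>leb01)"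
  define C where "C = (\<integral>x. (g x)\<^sup>2 \<partial>leb01)"
  note fg = integrable_mult_L2[OF m f g]
  have q: "0 \<le> s\<^sup>2 * A - 2 * s * t * B + t\<^sup>2 * C" for s t
  proof -
    have "0 \<le> (\<integral>x. (s * f x - t * g x)\<^sup>2 \<partial>leb01)" by (rule integral_leb01_nonneg) simp
    also have "\<dots> = (\<integral>x. s\<^sup>2 * (f x)\<^sup>2 - 2 * s * t * (f x * g x) + t\<^sup>2 * (g x)\<^sup>2 \<partial>leb01)"
      by (intro Bochner_Integration.integral_cong) (auto simp: power2_diff power_mult_distrib)
    also have "\<dots> = s\<^sup>2 * A - 2 * s * t * B + t\<^sup>2 * C"
      using f g fg by (simp add: A_def B_def C_def)
    finally show ?thesis .
  qed
  have A0: "0 \<le> A" and C0: "0 \<le> C" unfolding A_def C_def by (rule integral_leb01_nonneg; simp)+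
  have "B\<^sup>2 \<le> A * C"
  proof (cases "C = 0")
    case True
    have "B = 0"
    proof (rule ccontr)
      assume "B \<noteq> 0"
      \<comment> \<open>For \<open>C = 0\<close> the quadratic form is affine in its second
        argument, and the chosen argument gives it the value \<open>- 1\<close>.\<close>
      have "0 \<le> A - 2 * ((A + 1) / (2 * B)) * B" using q[of 1 "(A + 1) / (2 * B)"] True by simp
      thus False using \<open>B \<noteq> 0\<close> by simp
    qed
    thus ?thesis using True by simp
  next
    case False
    hence "0 < C" using C0 by simp
    have "0 \<le> C\<^sup>2 * A - 2 * C * B * B + B\<^sup>2 * C" by (rule q)
    also have "\<dots> = C * (A * C - B\<^sup>2)" by (simp add: algebra_simps power2_eq_square)
    finally show ?thesis using \<open>0 < C\<close> by (simp add: zero_le_mult_iff)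
  qed
  thus ?thesis by (simp add: A_def B_def C_def)
qed

lemma integral_powr_leb01:
  fixes s :: real
  assumes "- 1 < s"
  shows "integrable leb01 (\<lambda>x. x powr s)" "(\<integral>x. x powr s \<partial>leb01) = 1 / (s + 1)"
proof -
  have h: "((\<lambda>x. x powr s) has_integral 1 / (s + 1)) {0..1}"
    using has_integral_powr_from_0[OF assms, of 1] by simp
  hence h2: "((\<lambda>x. x powr s) has_integral 1 / (s + 1)) {0<..<1}"
    using has_integral_open_interval[of "\<lambda>x. x powr s" _ 0 1] by (simp add: box_real)
  have "(\<lambda>x. x powr s) absolutely_integrable_on {0<..<1}"
    using h2 by (intro nonnegative_absolutely_integrable_1) auto
  thus i: "integrable leb01 (\<lambda>x. x powr s)"
    by (intro absolutely_integrable_imp_integrable) auto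
  show "(\<integral>x. x powr s \<partial>leb01) = 1 / (s + 1)"
    using has_integral_unique[OF has_integral_integral_lebesgue_on[OF i] h2] by simp
qed

section \<open>Consequences of weak degeneracy: power lower bound for \<open>a\<close> and
  integrability of \<open>1 / a\<close>\<close>

locale wd =
  fixes a :: "real \<Rightarrow> real"
  assumes wd: "weakly_degenerate a"
begin

abbreviation "K \<equiv> degen_const a"
abbreviation "I \<equiv> inv_a_L1 a"

lemma K_pos: "0 < K" and K_less_1: "K < 1"
  using wd by (auto simp: weakly_degenerate_def)

lemma a_cont: "continuous_on {0..1} a"
  using wd by (auto simp: weakly_degenerate_def)

lemma a_pos: "0 < x \<Longrightarrow> x \<le> 1 \<Longrightarrow> 0 < a x"
  using wd by (auto simp: weakly_degenerate_def)

lemma a_1_pos: "0 < a 1"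
  by (rule a_pos) auto

lemma a_deriv:
  assumes "0 < x" "x < 1"
  shows "(a has_real_derivative dx a x) (at x)"
proof -
  have "a differentiable (at x within {0..1})"
    using wd assms by (auto simp: weakly_degenerate_def)
  hence "(a has_vector_derivative dx a x) (at x within {0..1})"
    unfolding dx_def by (simp add: vector_derivative_works)
  thus ?thesis
    using assms at_within_Icc_at[of 0 x 1] by (simp add: has_real_derivative_iff_has_vector_derivative)
qed

lemma a_deriv_bound: "0 < x \<Longrightarrow> x \<le> 1 \<Longrightarrow> x * \<bar>dx a x\<bar> \<le> K * a x"
proof -
  assume x: "0 < x" "x \<le> 1"
  have "x * \<bar>dx a x\<bar> / a x \<le> K"
    unfolding degen_const_def using x wd by (intro cSUP_upper) (auto simp: weakly_degenerate_def)
  thus ?thesis using a_pos[OF x] by (simp add: field_simps)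
qed

lemma continuous_on_dx_a: "continuous_on {0<..<1} (dx a)"
  using wd by (auto simp: weakly_degenerate_def intro: continuous_on_subset)

text \<open>The inequality \<open>x a' \<le> K a\<close> makes \<open>a x * x powr (- K)\<close>
  nonincreasing, so its smallest value is taken at 1. With \<open>K < 1\<close> this gives the
  integrability of \<open>1 / a\<close>, and integrating \<open>x powr (1 - K) / a 1\<close> gives
  the constant \<open>1 / (a 1 * (2 - K))\<close>.\<close>

lemma a_ge_powr:
  assumes x: "0 < x" "x \<le> 1"
  shows "a 1 * x powr K \<le> a x"
proof (cases "x = 1")
  case False
  have "a 1 * 1 powr (- K) \<le> a x * x powr (- K)"
  proof (rule DERIV_nonpos_imp_decreasing_open[of x 1 "\<lambda>x. a x * x powr (- K)"])
    show "x \<le> 1" by fact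
    fix t assume t: "x < t" "t < 1"
    have "((\<lambda>x. a x * x powr (- K)) has_real_derivative
        (a t * (- K * t powr (- K - 1)) + dx a t * t powr (- K))) (at t)"
      using x t by (auto intro!: derivative_eq_intros a_deriv)
    moreover have "a t * (- K * t powr (- K - 1)) + dx a t * t powr (- K) \<le> 0"
    proof -
      have "t powr (- K) = t powr (- K - 1) * t"
        using powr_add[of t "- K - 1" 1] x t by simp
      hence "a t * (- K * t powr (- K - 1)) + dx a t * t powr (- K) = t powr (- K - 1) * (t * dx a t - K * a t)"
        by (simp add: algebra_simps)
      moreover have "t * dx a t \<le> t * \<bar>dx a t\<bar>" using x t by (intro mult_left_mono) auto
      moreover have "t * \<bar>dx a t\<bar> \<le> K * a t" using a_deriv_bound[of t] x t by simp
      ultimately show ?thesis by (simp only:) (intro mult_nonneg_nonpos; simp)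
    qed
    ultimately show "\<exists>y. ((\<lambda>x. a x * x powr (- K)) has_real_derivative y) (at t) \<and> y \<le> 0" by blast
  next
    show "continuous_on {x..1} (\<lambda>x. a x * x powr (- K))"
      using x by (intro continuous_intros continuous_on_subset[OF a_cont]) auto
  qed
  thus ?thesis using x by (simp add: powr_minus field_simps)
qed simp

lemma inv_a_le: "0 < x \<Longrightarrow> x < 1 \<Longrightarrow> 1 / a x \<le> 1 / a 1 * x powr (- K)"
  using a_ge_powr[of x] a_pos[of x] a_1_pos by (simp add: powr_minus field_simps)

lemma a_measurable [measurable]: "a \<in> borel_measurable leb01"
  by (intro borel_measurable_leb01_continuous continuous_on_subset[OF a_cont]) auto

lemma dx_a_measurable [measurable]: "dx a \<in> borel_measurable leb01"
  by (intro borel_measurable_leb01_continuous continuous_on_dx_a)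

lemma integrable_inv_a: "integrable leb01 (\<lambda>x. 1 / a x)"
proof (rule integrable_leb01_bound)
  show "integrable leb01 (\<lambda>x. 1 / a 1 * x powr (- K))"
    using integral_powr_leb01(1)[of "- K"] K_less_1 by simp
  show "\<bar>1 / a x\<bar> \<le> 1 / a 1 * x powr (- K)" if "x \<in> {0<..<1}" for x
    using inv_a_le[of x] a_pos[of x] that by simp
qed measurable

lemma I_eq: "I = (\<integral>x. 1 / a x \<partial>leb01)"
  unfolding inv_a_L1_def by (intro Bochner_Integration.integral_cong) (auto simp: a_pos less_imp_le)

lemma I_pos: "0 < I"
proof -
  have "0 \<le> I" unfolding I_eq by (rule integral_leb01_nonneg) (simp add: a_pos less_imp_le)
  moreover have "I \<noteq> 0"
  proof
    assume "I = 0"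
    hence "AE x in leb01. 1 / a x = 0"
      using integrable_inv_a unfolding I_eq
      by (subst (asm) integral_nonneg_eq_0_iff_AE) (auto intro!: AE_I2 simp: a_pos less_imp_le)
    hence "AE x in leb01. False"
      using AE_leb01_Ioo by eventually_elim (use a_pos in \<open>force\<close>)
    hence "(\<integral>x. 1 \<partial>leb01) = (\<integral>x. 0 \<partial>leb01 :: real)" by (intro integral_cong_AE) auto
    thus False by (simp only: integral_const_leb01)
  qed
  ultimately show ?thesis by simp
qed

text \<open>The derivative of \<open>x / a x\<close> in the open interval; it is bounded by
  \<open>(1 + K) / a x\<close>, hence integrable.\<close>

definition ratio' :: "real \<Rightarrow> real" where
  "ratio' x = (1 - x * dx a x / a x) / a x"

lemma x_over_a_le: "0 < x \<Longrightarrow> x \<le> 1 \<Longrightarrow> x / a x \<le> 1 / a 1 * x powr (1 - K)"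
  using a_ge_powr[of x] a_pos[of x] a_1_pos by (simp add: powr_diff field_simps)

text \<open>At \<open>0\<close> the quotient has the value \<open>0 / 0 = 0\<close>, which happens to be its limit.\<close>

lemma ac_x_over_a: "ac (\<lambda>x. x / a x) ratio'"
proof (rule ac_interior_derivative)
  show "continuous_on {0..1} (\<lambda>x. x / a x)"
    unfolding continuous_on_eq_continuous_within
  proof
    fix x :: real assume x: "x \<in> {0..1}"
    show "continuous (at x within {0..1}) (\<lambda>x. x / a x)"
    proof (cases "x = 0")
      case False
      thus ?thesis using x a_cont a_pos[of x]
        by (intro continuous_intros) (auto simp: continuous_on_eq_continuous_within)
    next
      case True
      have "((\<lambda>x. x / a x) \<longlongrightarrow> 0) (at 0 within {0..1})"
      proof (rule Lim_null_comparison)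
        have "eventually (\<lambda>x. x \<in> {0..1} \<and> x \<noteq> 0) (at 0 within {0..1::real})"
          by (auto simp: eventually_at_filter)
        thus "eventually (\<lambda>x. norm (x / a x) \<le> 1 / a 1 * x powr (1 - K)) (at 0 within {0..1})"
        proof eventually_elim
          fix x :: real assume "x \<in> {0..1} \<and> x \<noteq> 0"
          thus "norm (x / a x) \<le> 1 / a 1 * x powr (1 - K)"
            using x_over_a_le[of x] a_pos[of x] by auto
        qed
        have "((\<lambda>x. x powr (1 - K)) \<longlongrightarrow> 0 powr (1 - K)) (at 0 within {0..1})"
          using K_less_1 by (intro tendsto_powr' tendsto_intros) (auto simp: eventually_at_filter)
        from tendsto_mult_left[OF this, of "1 / a 1"]
        show "((\<lambda>x. 1 / a 1 * x powr (1 - K)) \<longlongrightarrow> 0) (at 0 within {0..1})" by simp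
      qed
      thus ?thesis using True by (simp add: continuous_within)
    qed
  qed
  show "((\<lambda>x. x / a x) has_real_derivative ratio' x) (at x)" if "x \<in> {0<..<1}" for x
    using that a_pos[of x] unfolding ratio'_def
    by (auto intro!: derivative_eq_intros a_deriv simp: field_simps)
  show "integrable leb01 ratio'"
  proof (rule integrable_leb01_bound)
    show "integrable leb01 (\<lambda>x. (1 + K) * (1 / a x))" by (intro integrable_mult_right integrable_inv_a)
    show "ratio' \<in> borel_measurable leb01" unfolding ratio'_def by measurable
    fix x :: real assume "x \<in> {0<..<1}"
    hence x: "0 < x" "x \<le> 1" by auto
    have "\<bar>x * dx a x / a x\<bar> \<le> K"
      using a_deriv_bound[OF x] a_pos[OF x] x by (simp add: abs_mult field_simps)
    hence "\<bar>1 - x * dx a x / a x\<bar> \<le> 1 + K" by linarith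
    thus "\<bar>ratio' x\<bar> \<le> (1 + K) * (1 / a x)"
      using a_pos[OF x] by (simp add: ratio'_def divide_right_mono)
  qed
qed

lemma integral_x_over_a: "(\<integral>x. x / a x \<partial>leb01) \<le> 1 / (a 1 * (2 - K))"
proof -
  have "(\<integral>x. x / a x \<partial>leb01) \<le> (\<integral>x. 1 / a 1 * x powr (1 - K) \<partial>leb01)"
  proof (rule integral_leb01_mono)
    show "integrable leb01 (\<lambda>x. x / a x)"
      by (rule integrable_leb01_continuous[OF ac_continuous_on[OF ac_x_over_a]])
    show "integrable leb01 (\<lambda>x. 1 / a 1 * x powr (1 - K))"
      using integral_powr_leb01(1)[of "1 - K"] K_less_1 by simp
    show "x / a x \<le> 1 / a 1 * x powr (1 - K)" if "x \<in> {0<..<1}" for x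
      using x_over_a_le[of x] that by simp
  qed
  also have "\<dots> = 1 / (a 1 * (2 - K))"
    using integral_powr_leb01(2)[of "1 - K"] K_less_1 by simp
  finally show ?thesis .
qed

text \<open>Concrete form of membership in the energy space, with the first derivative and the
  second density as explicit arguments. As \<open>dxx\<close> is a chosen weak derivative,
  determined only up to null sets, estimates are proved for arbitrary such triples and transferred
  by \<open>K2rep_K2\<close> and \<open>K2rep_imp_K2\<close>.\<close>

definition K2rep :: "(real \<Rightarrow> real) \<Rightarrow> (real \<Rightarrow> real) \<Rightarrow> (real \<Rightarrow> real) \<Rightarrow> bool" where
  "K2rep u u' g \<longleftrightarrow> ac u u' \<and> ac u' g \<and> u 0 = 0 \<and> u' 0 = 0 \<and> integrable leb01 (\<lambda>x. a x * (g x)\<^sup>2)"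

lemma K2repD:
  assumes "K2rep u u' g"
  shows "ac u u'" "ac u' g" "u 0 = 0" "u' 0 = 0" "integrable leb01 (\<lambda>x. a x * (g x)\<^sup>2)"
    "continuous_on {0..1} u'" "continuous_on {0..1} u" "integrable leb01 g" "g \<in> borel_measurable leb01"
    "\<And>x. x \<in> {0..1} \<Longrightarrow> dx u x = u' x"
proof -
  show 1: "ac u u'" "ac u' g" "u 0 = 0" "u' 0 = 0" "integrable leb01 (\<lambda>x. a x * (g x)\<^sup>2)"
    using assms by (auto simp: K2rep_def)
  show 2: "continuous_on {0..1} u'" "continuous_on {0..1} u"
    using ac_continuous_on 1 by auto
  show "integrable leb01 g" "g \<in> borel_measurable leb01" using acD(1)[OF 1(2)] by auto
  show "dx u x = u' x" if "x \<in> {0..1}" for x by (rule dx_ac[OF 1(1) 2(1) that])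
qed

text \<open>Follows from \<open>2 |g| \<le> 1 / a + a g^2\<close>: finite bending energy and
  integrable \<open>1 / a\<close> make \<open>u'\<close> absolutely continuous up to the degenerate
  point.\<close>

lemma integrable_of_weighted_L2:
  assumes [measurable]: "g \<in> borel_measurable leb01" and g: "integrable leb01 (\<lambda>x. a x * (g x)\<^sup>2)"
  shows "integrable leb01 g"
proof (rule integrable_leb01_bound)
  show "integrable leb01 (\<lambda>x. 1 / a x + a x * (g x)\<^sup>2)" using integrable_inv_a g by simp
  fix x :: real assume "x \<in> {0<..<1}"
  hence a: "0 < a x" using a_pos by auto
  have "0 \<le> (a x * \<bar>g x\<bar> - 1)\<^sup>2 / a x" using a by simp
  hence "2 * \<bar>g x\<bar> \<le> 1 / a x + a x * (g x)\<^sup>2"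
    using a by (simp add: power2_diff power_mult_distrib field_simps power2_eq_square)
  thus "\<bar>g x\<bar> \<le> 1 / a x + a x * (g x)\<^sup>2" by simp
qed measurable

lemma K2rep_K2:
  assumes u: "in_K2 a u"
  shows "K2rep u (dx u) (dxx u)"
proof -
  have ac: "abs_continuous01 (dx u)" and z: "u 0 = 0" "dx u 0 = 0"
    and d: "\<And>x. x \<in> {0..1} \<Longrightarrow> u differentiable (at x within {0..1})"
    using u by (auto simp: in_K2_def)
  obtain g where g: "has_weak_deriv (dx u) g" "in_L2 (\<lambda>x. sqrt (a x) * g x)"
    using u by (auto simp: in_K2_def)
  have c: "continuous_on {0..1} (dx u)" by (rule abs_continuous01_imp_continuous_on[OF ac])
  have "(u has_real_derivative dx u x) (at x within {0..1})" if "x \<in> {0..1}" for x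
    using d[OF that] unfolding dx_def by (simp add: vector_derivative_works has_real_derivative_iff_has_vector_derivative)
  hence 1: "ac u (dx u)" by (rule ac_derivative[OF c])
  have wd2: "has_weak_deriv (dx u) (dxx u)" unfolding dxx_def by (rule wderiv_has_weak_deriv[OF g(1)])
  hence [measurable]: "dxx u \<in> borel_measurable leb01"
    by (intro loc_integrable_measurable) (auto simp: has_weak_deriv_def)
  have [measurable]: "g \<in> borel_measurable leb01"
    using g(1) by (intro loc_integrable_measurable) (auto simp: has_weak_deriv_def)
  have "AE x in leb01. (sqrt (a x) * g x)\<^sup>2 = a x * (dxx u x)\<^sup>2"
    using wderiv_AE[OF g(1)] AE_leb01_Ioo unfolding dxx_def
    by eventually_elim (auto simp: power_mult_distrib a_pos less_imp_le)
  hence 2: "integrable leb01 (\<lambda>x. a x * (dxx u x)\<^sup>2)"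
    using in_L2D(2)[OF g(2)] by (subst (asm) integrable_cong_AE) auto
  hence 3: "integrable leb01 (dxx u)" by (rule integrable_of_weighted_L2[rotated]) measurable
  obtain C where C: "AE x in leb01. dx u x = C + prim (dxx u) x"
    using has_weak_deriv_imp_prim[OF wd2 integrable_leb01_continuous[OF c] 3] by blast
  have eq: "dx u x = C + prim (dxx u) x" if "x \<in> {0..1}" for x
    by (rule continuous_AE_eq[OF c _ C that]) (intro continuous_intros continuous_on_prim 3)
  hence "C = dx u 0" by simp
  hence "ac (dx u) (dxx u)" using eq by (intro acI 3) simp
  thus ?thesis using 1 2 z by (simp add: K2rep_def)
qed

lemma K2rep_imp_K2:
  assumes r: "K2rep u u' g"
  shows "in_K2 a u" "AE x in leb01. dxx u x = g x"
proof -
  note R = K2repD[OF r]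
  have ac: "ac (dx u) g"
    by (rule ac_cong[OF R(2)]) (use R(10) in auto)
  have hw: "has_weak_deriv (dx u) g" by (rule has_weak_deriv_ac[OF ac])
  have [measurable]: "g \<in> borel_measurable leb01" by (rule R)
  have "in_L2 (\<lambda>x. sqrt (a x) * g x)"
    unfolding in_L2_def
  proof
    show "integrable leb01 (\<lambda>x. (sqrt (a x) * g x)\<^sup>2)"
      using R(5) by (rule Bochner_Integration.integrable_cong[THEN iffD1, rotated 2])
        (auto simp: power_mult_distrib a_pos less_imp_le)
  qed measurable
  moreover have "in_H1 u"
    unfolding in_H1_def
  proof (intro conjI exI)
    show "in_L2 u" unfolding in_L2_def
      using R(7) by (auto intro!: integrable_leb01_continuous continuous_intros borel_measurable_leb01_continuous intro: continuous_on_subset)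
    show "has_weak_deriv u u'" by (rule has_weak_deriv_ac[OF R(1)])
    show "in_L2 u'" unfolding in_L2_def
      using R(6) by (auto intro!: integrable_leb01_continuous continuous_intros borel_measurable_leb01_continuous intro: continuous_on_subset)
  qed
  moreover have "u differentiable (at x within {0..1})" if "x \<in> {0..1}" for x
    using ac_has_derivative[OF R(1,6) that] has_real_derivative_imp_differentiable_within by blast
  ultimately show "in_K2 a u"
    unfolding in_K2_def using ac_abs_continuous01[OF ac] hw R(3,4) R(10)[of 0] by auto
  show "AE x in leb01. dxx u x = g x" unfolding dxx_def by (rule wderiv_AE[OF hw])
qed

lemma K2rep_cong:
  assumes "K2rep u u' g" "\<And>x. x \<in> {0..1} \<Longrightarrow> u x = w x" "\<And>x. x \<in> {0..1} \<Longrightarrow> u' x = w' x" "AE x in leb01. g x = h x"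
  shows "K2rep w w' h"
proof -
  note R = K2repD[OF assms(1)]
  have 2: "ac w' h" by (rule ac_cong[OF R(2) assms(3,4)])
  have "ac w w'" by (rule ac_cong[OF R(1) assms(2)]) (use assms(3) AE_leb01_Ioo in \<open>auto elim: eventually_mono\<close>)
  moreover have "integrable leb01 (\<lambda>x. a x * (h x)\<^sup>2)"
  proof -
    have [measurable]: "g \<in> borel_measurable leb01" "h \<in> borel_measurable leb01"
      using R(9) acD(1)[OF 2] by auto
    have "AE x in leb01. a x * (g x)\<^sup>2 = a x * (h x)\<^sup>2" using assms(4) by eventually_elim simp
    from integrable_cong_AE[OF _ _ this] show ?thesis using R(5) by auto
  qed
  ultimately show ?thesis using 2 R(3,4) assms(2)[of 0] assms(3)[of 0] by (simp add: K2rep_def)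
qed

lemma K2rep_lincomb:
  assumes "K2rep u u' g" "K2rep w w' h"
  shows "K2rep (\<lambda>x. c * u x + d * w x) (\<lambda>x. c * u' x + d * w' x) (\<lambda>x. c * g x + d * h x)"
proof -
  note R = K2repD[OF assms(1)] and S = K2repD[OF assms(2)]
  have [measurable]: "g \<in> borel_measurable leb01" "h \<in> borel_measurable leb01" by (rule R S)+
  have "integrable leb01 (\<lambda>x. a x * (c * g x + d * h x)\<^sup>2)"
  proof (rule integrable_leb01_bound)
    show "integrable leb01 (\<lambda>x. 2 * c\<^sup>2 * (a x * (g x)\<^sup>2) + 2 * d\<^sup>2 * (a x * (h x)\<^sup>2))"
      by (intro Bochner_Integration.integrable_add integrable_mult_right R S)
    fix x :: real assume "x \<in> {0<..<1}"
    hence a: "0 < a x" using a_pos by auto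
    have "a x * (c * g x + d * h x)\<^sup>2 \<le> a x * (2 * (c * g x)\<^sup>2 + 2 * (d * h x)\<^sup>2)"
      using a square_sum_le by (intro mult_left_mono) auto
    thus "\<bar>a x * (c * g x + d * h x)\<^sup>2\<bar> \<le> 2 * c\<^sup>2 * (a x * (g x)\<^sup>2) + 2 * d\<^sup>2 * (a x * (h x)\<^sup>2)"
      using a by (simp add: algebra_simps power_mult_distrib)
  qed measurable
  thus ?thesis using R(3,4) S(3,4)
    by (auto simp: K2rep_def intro!: ac_add ac_cmult R S)
qed

text \<open>A class in \<open>H^2\<close> has a \<open>C^1\<close> representative with absolutely
  continuous derivative. Here it is the bending moment \<open>W\<close>; the quantities in the
  boundary conditions are \<open>W 1\<close> and \<open>W' 1\<close>, and later integrations by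
  parts act on \<open>W\<close> instead of on the chosen weak derivatives.\<close>

lemma dom_B_rep:
  assumes "u \<in> dom_B a"
  obtains W W' w where "ac W W'" "ac W' w" "in_L2 w" "AE x in leb01. a x * dxx u x = W x"
    "cont_rep (bending a u) 1 = W 1" "dx (cont_rep (bending a u)) 1 = W' 1"
    "AE x in leb01. op_B a u x = w x"
proof -
  define b where "b = bending a u"
  have "in_H2 b" using assms by (auto simp: dom_B_def b_def)
  then obtain g w where b: "in_L2 b" "has_weak_deriv b g" and g: "in_L2 g" "has_weak_deriv g w" and w: "in_L2 w"
    by (auto simp: in_H2_def in_H1_def)
  obtain C where C: "AE x in leb01. b x = C + prim g x"
    using has_weak_deriv_imp_prim[OF b(2) in_L2D(3)[OF b(1)] in_L2D(3)[OF g(1)]] by blast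
  obtain C' where C': "AE x in leb01. g x = C' + prim w x"
    using has_weak_deriv_imp_prim[OF g(2) in_L2D(3)[OF g(1)] in_L2D(3)[OF w]] by blast
  define W' where "W' = (\<lambda>x. C' + prim w x)"
  have acW': "ac W' w"
    unfolding W'_def using ac_add[OF ac_const ac_prim[OF in_L2D(3)[OF w]], of C'] by simp
  note W'c = ac_continuous_on[OF acW']
  define W where "W = (\<lambda>x. C + prim W' x)"
  have acW: "ac W W'"
    unfolding W_def using ac_add[OF ac_const ac_prim[OF integrable_leb01_continuous[OF W'c]], of C] by simp
  have gW': "AE x in leb01. g x = W' x" using C' by (simp add: W'_def)
  have "prim g = prim W'"
    by (rule ext, rule prim_cong_AE[OF in_L2D(1)[OF g(1)] gW'])
  hence bW: "AE x in leb01. b x = W x" using C by (simp add: W_def)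
  have cr: "continuous_on {0..1} (cont_rep b) \<and> (AE x in leb01. cont_rep b x = b x)"
    unfolding cont_rep_def
  proof (rule someI[of "\<lambda>w. continuous_on {0..1} w \<and> (AE x in leb01. w x = b x)" W])
    show "continuous_on {0..1} W \<and> (AE x in leb01. W x = b x)"
      using ac_continuous_on[OF acW] bW by (auto elim: eventually_mono)
  qed
  have "AE x in leb01. cont_rep b x = W x"
    using conjunct2[OF cr] bW by eventually_elim simp
  hence crW: "cont_rep b x = W x" if "x \<in> {0..1}" for x
    by (rule continuous_AE_eq[OF conjunct1[OF cr] ac_continuous_on[OF acW] _ that])
  have "ac (cont_rep b) W'"
    by (rule ac_cong[OF acW]) (use crW in auto)
  hence "dx (cont_rep b) 1 = W' 1" by (rule dx_ac[OF _ W'c]) simp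
  moreover have "AE x in leb01. op_B a u x = w x"
    unfolding op_B_def b_def[symmetric]
  proof (rule wderiv_AE, rule has_weak_deriv_cong_AE[OF has_weak_deriv_ac[OF acW']])
    show "AE x in leb01. W' x = wderiv b x"
      using wderiv_AE[OF b(2)] gW' by eventually_elim simp
  qed simp
  ultimately show thesis
    using that[OF acW acW' w] bW crW[of 1] unfolding b_def bending_def by auto
qed

end

section \<open>Multiplier identities and Poincare-type estimates\<close>

lemma ac_ident: "ac (\<lambda>x. x) (\<lambda>_. 1)"
  by (rule ac_derivative) auto

section \<open>Integration by parts against the multipliers \<open>x u'\<close>, \<open>u\<close>,
  the static solution and the velocity\<close>

context wd
begin

text \<open>The function differentiated is \<open>W' x u' - W u' - W^2 x / (2 a)\<close>. Its last
  term cancels \<open>W' x u''\<close>, because \<open>u'' = W / a\<close>, and leaves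
  \<open>a u''^2\<close> with the factor \<open>3/2 - x a' / (2 a)\<close>, which is at least
  \<open>(3 - K) / 2\<close>. All boundary terms at 0 vanish.\<close>

lemma multiplier_x_deriv:
  assumes u: "K2rep u u' g" and W: "ac W W'" "ac W' w" and Wg: "AE x in leb01. a x * g x = W x"
  shows "W' 1 * u' 1 - W 1 * u' 1 - (W 1)\<^sup>2 / (2 * a 1) + (3 - K) / 2 * (\<integral>x. a x * (g x)\<^sup>2 \<partial>leb01)
     \<le> (\<integral>x. w x * (x * u' x) \<partial>leb01)"
proof -
  note U = K2repD[OF u]
  define h where "h = (\<lambda>x. w x * (x * u' x) - a x * (g x)\<^sup>2 * (3 / 2 - x * dx a x / a x / 2))"
  have "ac (\<lambda>x. (W' x * x) * u' x - W x * u' x - 1 / 2 * (W x * W x * (x / a x))) h"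
  proof (rule ac_cong[OF ac_diff[OF ac_diff[OF ac_mult[OF ac_mult[OF W(2) ac_ident] U(2)] ac_mult[OF W(1) U(2)]]
          ac_cmult[OF ac_mult[OF ac_mult[OF W(1) W(1)] ac_x_over_a], of "1 / 2"]]])
    show "AE x in leb01. (w x * x + W' x * 1) * u' x + W' x * x * g x - (W' x * u' x + W x * g x) -
              1 / 2 * ((W' x * W x + W x * W' x) * (x / a x) + W x * W x * ratio' x) = h x"
      using Wg AE_leb01_Ioo
    proof eventually_elim
      fix x :: real assume W: "a x * g x = W x" and "x \<in> {0<..<1}"
      hence "0 < a x" using a_pos by auto
      thus "(w x * x + W' x * 1) * u' x + W' x * x * g x - (W' x * u' x + W x * g x) -
              1 / 2 * ((W' x * W x + W x * W' x) * (x / a x) + W x * W x * ratio' x) = h x"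
        unfolding h_def ratio'_def W[symmetric] by (simp add: field_simps power2_eq_square)
    qed
  qed simp
  note ach = this
  have i1: "integrable leb01 (\<lambda>x. w x * (x * u' x))"
    using integrable_mult_continuous[OF _ acD(1)[OF W(2)], of "\<lambda>x. x * u' x"] U(6)
    by (simp add: mult.commute continuous_intros)
  \<comment> \<open>Integrability of the weighted energy density is read off from the product rule:
    it is the difference of two functions already known to be integrable.\<close>
  have i2: "integrable leb01 (\<lambda>x. a x * (g x)\<^sup>2 * (3 / 2 - x * dx a x / a x / 2))"
    using Bochner_Integration.integrable_diff[OF i1 acD(1)[OF ach]] by (simp add: h_def)
  have "(\<integral>x. h x \<partial>leb01) = W' 1 * u' 1 - W 1 * u' 1 - (W 1)\<^sup>2 / (2 * a 1)"
    using ac_integral[OF ach] U(4) by (simp add: power2_eq_square)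
  moreover have "(\<integral>x. h x \<partial>leb01) = (\<integral>x. w x * (x * u' x) \<partial>leb01)
      - (\<integral>x. a x * (g x)\<^sup>2 * (3 / 2 - x * dx a x / a x / 2) \<partial>leb01)"
    unfolding h_def by (rule Bochner_Integration.integral_diff[OF i1 i2])
  moreover have "(\<integral>x. (3 - K) / 2 * (a x * (g x)\<^sup>2) \<partial>leb01)
      \<le> (\<integral>x. a x * (g x)\<^sup>2 * (3 / 2 - x * dx a x / a x / 2) \<partial>leb01)"
  proof (rule integral_leb01_mono[OF _ i2])
    show "integrable leb01 (\<lambda>x. (3 - K) / 2 * (a x * (g x)\<^sup>2))"
      by (intro integrable_mult_right U)
    fix x :: real assume "x \<in> {0<..<1}"
    hence x: "0 < x" "x \<le> 1" by auto
    have "x * dx a x \<le> x * \<bar>dx a x\<bar>" using x by (intro mult_left_mono) auto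
    also have "\<dots> \<le> K * a x" by (rule a_deriv_bound[OF x])
    finally have "x * dx a x / a x \<le> K" using a_pos[OF x] by (simp add: field_simps)
    hence "a x * (g x)\<^sup>2 * ((3 - K) / 2) \<le> a x * (g x)\<^sup>2 * (3 / 2 - x * dx a x / a x / 2)"
      using a_pos[OF x] by (intro mult_left_mono) (auto simp: field_simps)
    thus "(3 - K) / 2 * (a x * (g x)\<^sup>2) \<le> a x * (g x)\<^sup>2 * (3 / 2 - x * dx a x / a x / 2)"
      by (simp only: mult.commute)
  qed
  ultimately show ?thesis by simp
qed

lemma multiplier_u:
  assumes u: "K2rep u u' g" and W: "ac W W'" "ac W' w" and Wg: "AE x in leb01. a x * g x = W x"
  shows "(\<integral>x. w x * u x \<partial>leb01) = W' 1 * u 1 - W 1 * u' 1 + (\<integral>x. a x * (g x)\<^sup>2 \<partial>leb01)"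
proof -
  note U = K2repD[OF u]
  have i1: "integrable leb01 (\<lambda>x. w x * u x)"
    using integrable_mult_continuous[OF U(7) acD(1)[OF W(2)]] by (simp add: mult.commute)
  have "ac (\<lambda>x. W' x * u x - W x * u' x) (\<lambda>x. w x * u x - a x * (g x)\<^sup>2)"
  proof (rule ac_cong[OF ac_diff[OF ac_mult[OF W(2) U(1)] ac_mult[OF W(1) U(2)]]])
    show "AE x in leb01. w x * u x + W' x * u' x - (W' x * u' x + W x * g x) = w x * u x - a x * (g x)\<^sup>2"
      using Wg by eventually_elim (simp add: power2_eq_square flip: mult.assoc)
  qed simp
  from ac_integral[OF this] show ?thesis using U(3-5) i1 by simp
qed

text \<open>Green's formula used twice. Moving both derivatives of \<open>w = W''\<close> onto
  \<open>z\<close> leaves the integral of \<open>a u'' z''\<close>; as \<open>a z''\<close> is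
  affine, moving them back onto it gives boundary terms only, without interior remainder.\<close>

lemma multiplier_static:
  assumes u: "K2rep u u' g" and W: "ac W W'" "ac W' w" and Wg: "AE x in leb01. a x * g x = W x"
    and z: "K2rep z z' h" and h: "AE x in leb01. a x * h x = k - l * (1 - x)"
  shows "(\<integral>x. w x * z x \<partial>leb01) = W' 1 * z 1 - W 1 * z' 1 + u' 1 * k - l * u 1"
proof -
  note U = K2repD[OF u] and Z = K2repD[OF z]
  have acl: "ac (\<lambda>x. k - l * (1 - x)) (\<lambda>_. l)"
    by (rule ac_derivative) (auto intro!: derivative_eq_intros)
  have "ac (\<lambda>x. W' x * z x - W x * z' x + (u' x * (k - l * (1 - x)) - l * u x)) (\<lambda>x. w x * z x)"
  proof (rule ac_cong[OF ac_add[OF ac_diff[OF ac_mult[OF W(2) Z(1)] ac_mult[OF W(1) Z(2)]]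
          ac_diff[OF ac_mult[OF U(2) acl] ac_cmult[OF U(1)]]]])
    show "AE x in leb01. w x * z x + W' x * z' x - (W' x * z' x + W x * h x)
        + (g x * (k - l * (1 - x)) + u' x * l - l * u' x) = w x * z x"
      using Wg h
    proof eventually_elim
      case (elim x)
      show ?case unfolding elim(1)[symmetric] elim(2)[symmetric] by (simp add: algebra_simps)
    qed
  qed simp
  from ac_integral[OF this] show ?thesis using U(3,4) Z(3,4) by simp
qed

lemma multiplier_velocity:
  assumes v: "K2rep v v' h"
  shows "(\<integral>x. v x * (x * v' x) \<partial>leb01) = ((v 1)\<^sup>2 - (\<integral>x. (v x)\<^sup>2 \<partial>leb01)) / 2"
proof -
  note V = K2repD[OF v]
  have i1: "integrable leb01 (\<lambda>x. v x * (x * v' x))" "integrable leb01 (\<lambda>x. (v x)\<^sup>2)"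
    using V(6,7) by (auto intro!: integrable_leb01_continuous continuous_intros)
  have "ac (\<lambda>x. x * (v x * v x)) (\<lambda>x. (v x)\<^sup>2 + 2 * (v x * (x * v' x)))"
    by (rule ac_cong[OF ac_mult[OF ac_ident ac_mult[OF V(1) V(1)]]]) (auto simp: algebra_simps power2_eq_square)
  from ac_integral[OF this] show ?thesis using i1 by (simp add: power2_eq_square)
qed

text \<open>The interior power reduces to the power at the end 1. The boundary conditions turn it,
  together with the two elastic terms, into \<open>- v(1)^2 - v'(1)^2\<close>.\<close>

lemma energy_identity:
  assumes v: "K2rep v v' h" and W: "ac W W'" "ac W' w" and Wg: "AE x in leb01. a x * g x = W x"
  shows "(\<integral>x. a x * (g x * h x) \<partial>leb01) - (\<integral>x. w x * v x \<partial>leb01) = W 1 * v' 1 - W' 1 * v 1"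
    and "integrable leb01 (\<lambda>x. a x * (g x * h x))"
proof -
  note V = K2repD[OF v]
  have i1: "integrable leb01 (\<lambda>x. w x * v x)"
    using integrable_mult_continuous[OF V(7) acD(1)[OF W(2)]] by (simp add: mult.commute)
  have ac: "ac (\<lambda>x. W x * v' x - W' x * v x) (\<lambda>x. a x * (g x * h x) - w x * v x)"
  proof (rule ac_cong[OF ac_diff[OF ac_mult[OF W(1) V(2)] ac_mult[OF W(2) V(1)]]])
    show "AE x in leb01. W' x * v' x + W x * h x - (w x * v x + W' x * v' x) = a x * (g x * h x) - w x * v x"
      using Wg by eventually_elim (simp flip: mult.assoc)
  qed simp
  show i2: "integrable leb01 (\<lambda>x. a x * (g x * h x))"
    using Bochner_Integration.integrable_add[OF acD(1)[OF ac] i1] by simp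
  show "(\<integral>x. a x * (g x * h x) \<partial>leb01) - (\<integral>x. w x * v x \<partial>leb01) = W 1 * v' 1 - W' 1 * v 1"
    using ac_integral[OF ac] V(3,4) i1 i2 by simp
qed

section \<open>Weighted Poincare-type inequalities in the energy space\<close>

lemma weighted_Cauchy_Schwarz:
  assumes A: "A \<in> sets borel" and g: "g \<in> borel_measurable leb01" "integrable leb01 (\<lambda>x. a x * (g x)\<^sup>2)"
  shows "(\<integral>x. indicator A x * g x \<partial>leb01)\<^sup>2
     \<le> (\<integral>x. indicator A x * (1 / a x) \<partial>leb01) * (\<integral>x. a x * (g x)\<^sup>2 \<partial>leb01)"
proof -
  have [measurable]: "A \<in> sets borel" "g \<in> borel_measurable leb01" by fact+
  \<comment> \<open>Splitting \<open>g\<close> into \<open>1 / sqrt a\<close> times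
    \<open>sqrt a * g\<close>, with the indicator attached to the first factor only, leaves the full
    bending energy on the right while localising the integral of \<open>1 / a\<close>.\<close>
  let ?f = "\<lambda>x. indicator A x / sqrt (a x)" and ?g = "\<lambda>x. sqrt (a x) * g x"
  have e: "(?f x)\<^sup>2 = indicator A x * (1 / a x)" "(?g x)\<^sup>2 = a x * (g x)\<^sup>2" "?f x * ?g x = indicator A x * g x"
    if "x \<in> {0<..<1}" for x
    using a_pos[of x] that by (auto simp: power_divide power_mult_distrib indicator_def)
  have "integrable leb01 (\<lambda>x. (?f x)\<^sup>2)"
    using integrable_indicator_mult[OF integrable_inv_a A]
    by (rule Bochner_Integration.integrable_cong[THEN iffD1, rotated 2]) (use e(1) in auto)
  moreover have "integrable leb01 (\<lambda>x. (?g x)\<^sup>2)"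
    using g(2) by (rule Bochner_Integration.integrable_cong[THEN iffD1, rotated 2]) (use e(2) in auto)
  ultimately have "(\<integral>x. ?f x * ?g x \<partial>leb01)\<^sup>2 \<le> (\<integral>x. (?f x)\<^sup>2 \<partial>leb01) * (\<integral>x. (?g x)\<^sup>2 \<partial>leb01)"
    by (intro Cauchy_Schwarz_leb01) measurable
  also have "(\<integral>x. ?f x * ?g x \<partial>leb01) = (\<integral>x. indicator A x * g x \<partial>leb01)"
    by (rule Bochner_Integration.integral_cong[OF refl]) (use e(3) in auto)
  also have "(\<integral>x. (?f x)\<^sup>2 \<partial>leb01) = (\<integral>x. indicator A x * (1 / a x) \<partial>leb01)"
    by (rule Bochner_Integration.integral_cong[OF refl]) (use e(1) in auto)
  also have "(\<integral>x. (?g x)\<^sup>2 \<partial>leb01) = (\<integral>x. a x * (g x)\<^sup>2 \<partial>leb01)"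
    by (rule Bochner_Integration.integral_cong[OF refl]) (use e(2) in auto)
  finally show ?thesis .
qed

lemma bending_energy_nonneg: "0 \<le> (\<integral>x. a x * (g x)\<^sup>2 \<partial>leb01)"
  by (rule integral_leb01_nonneg) (auto simp: a_pos less_imp_le)

lemma K2_deriv_bound:
  assumes u: "K2rep u u' g" and y: "y \<in> {0..1}"
  shows "(u' y)\<^sup>2 \<le> I * (\<integral>x. a x * (g x)\<^sup>2 \<partial>leb01)"
proof -
  note U = K2repD[OF u]
  have "u' y = (\<integral>x. indicator {..<y} x * g x \<partial>leb01)"
    using acD(2)[OF U(2) y] U(4) by (simp add: prim_def)
  hence "(u' y)\<^sup>2 \<le> (\<integral>x. indicator {..<y} x * (1 / a x) \<partial>leb01) * (\<integral>x. a x * (g x)\<^sup>2 \<partial>leb01)"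
    using weighted_Cauchy_Schwarz[OF _ U(9,5), of "{..<y}"] by simp
  also have "(\<integral>x. indicator {..<y} x * (1 / a x) \<partial>leb01) \<le> I"
    unfolding I_eq using integrable_indicator_mult[OF integrable_inv_a, of "{..<y}"] integrable_inv_a
    by (intro integral_leb01_mono) (auto simp: indicator_def a_pos less_imp_le)
  finally show ?thesis using bending_energy_nonneg[of g] by (simp add: mult_right_mono)
qed

lemma K2_bound_deriv_norm:
  assumes u: "K2rep u u' g" and y: "y \<in> {0..1}"
  shows "(u y)\<^sup>2 \<le> y * (\<integral>x. (u' x)\<^sup>2 \<partial>leb01)"
proof -
  note U = K2repD[OF u]
  have m: "u' \<in> borel_measurable leb01" using acD(1)[OF U(1)] by auto
  have "u y = (\<integral>x. indicator {..<y} x * u' x \<partial>leb01)"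
    using acD(2)[OF U(1) y] U(3) by (simp add: prim_def)
  moreover have "(\<integral>x. indicator {..<y} x * u' x \<partial>leb01)\<^sup>2
      \<le> (\<integral>x. (indicator {..<y} x)\<^sup>2 \<partial>leb01) * (\<integral>x. (u' x)\<^sup>2 \<partial>leb01)"
  proof (rule Cauchy_Schwarz_leb01[OF _ m])
    show "integrable leb01 (\<lambda>x. (indicator {..<y} x :: real)\<^sup>2)"
    proof -
      have "(\<lambda>x. (indicator {..<y} x :: real)\<^sup>2) = (\<lambda>x. indicator {..<y} x * 1)"
        by (auto simp: indicator_def)
      thus ?thesis using integrable_indicator_mult[of "\<lambda>_. 1" "{..<y}"] by simp
    qed
    show "integrable leb01 (\<lambda>x. (u' x)\<^sup>2)"
      using U(6) by (intro integrable_leb01_continuous continuous_intros)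
  qed measurable
  moreover have "(\<integral>x. (indicator {..<y} x :: real)\<^sup>2 \<partial>leb01) = prim (\<lambda>_. 1) y"
    unfolding prim_def by (rule Bochner_Integration.integral_cong) (auto simp: indicator_def)
  moreover have "prim (\<lambda>_. 1) y = y" using acD(2)[OF ac_ident y] by simp
  ultimately show ?thesis by simp
qed

lemma K2_norm_le_deriv_norm:
  assumes u: "K2rep u u' g"
  shows "(\<integral>x. (u x)\<^sup>2 \<partial>leb01) \<le> 1 / 2 * (\<integral>x. (u' x)\<^sup>2 \<partial>leb01)"
proof -
  note U = K2repD[OF u]
  have "ac (\<lambda>x. x\<^sup>2 / 2) (\<lambda>x. x)"
    by (rule ac_derivative) (auto intro!: derivative_eq_intros)
  from ac_integral[OF this] have i: "(\<integral>x. x \<partial>leb01) = 1 / 2" by simp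
  have "(\<integral>x. (u x)\<^sup>2 \<partial>leb01) \<le> (\<integral>x. x * (\<integral>x. (u' x)\<^sup>2 \<partial>leb01) \<partial>leb01)"
    using U(7) K2_bound_deriv_norm[OF u]
    by (intro integral_leb01_mono integrable_leb01_continuous continuous_intros) auto
  thus ?thesis using i by simp
qed

text \<open>The estimate starts from the end 1: the squared increment of \<open>u'\<close> between
  \<open>y\<close> and 1 is at most \<open>T y * e\<close>, with \<open>T\<close> the tail integral
  of \<open>1 / a\<close>. Partial integration turns the integral of \<open>T\<close> into that of
  \<open>x / a\<close>, which is at most \<open>1 / (a 1 * (2 - K))\<close>. With the weight
  \<open>x^2\<close> both summands shrink by the factor \<open>1 / 3\<close>.\<close>

lemma K2_weighted_deriv_norms:
  assumes u: "K2rep u u' g"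
  shows "(\<integral>x. (u' x)\<^sup>2 \<partial>leb01) \<le> 2 * (u' 1)\<^sup>2 + 2 / (a 1 * (2 - K)) * (\<integral>x. a x * (g x)\<^sup>2 \<partial>leb01)"
    and "(\<integral>x. x\<^sup>2 * (u' x)\<^sup>2 \<partial>leb01)
      \<le> 1 / 3 * (2 * (u' 1)\<^sup>2 + 2 / (a 1 * (2 - K)) * (\<integral>x. a x * (g x)\<^sup>2 \<partial>leb01))"
proof -
  note U = K2repD[OF u]
  define e where "e = (\<integral>x. a x * (g x)\<^sup>2 \<partial>leb01)"
  have e0: "0 \<le> e" unfolding e_def by (rule bending_energy_nonneg)
  define T where "T = (\<lambda>y. I - prim (\<lambda>x. 1 / a x) y)"
  have acT: "ac T (\<lambda>x. 0 - 1 / a x)"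
    unfolding T_def by (intro ac_diff ac_const ac_prim integrable_inv_a)
  note Tc = ac_continuous_on[OF acT]
  have T1: "T 1 = 0" by (simp add: T_def prim_ge_1 I_eq)
  have pw: "(u' y)\<^sup>2 \<le> 2 * (u' 1)\<^sup>2 + 2 * (T y * e)" if y: "y \<in> {0..1}" for y
  proof -
    have "u' 1 - u' y = prim g 1 - prim g y"
      using acD(2)[OF U(2) y] acD(2)[OF U(2), of 1] by simp
    also have "\<dots> = (\<integral>t. indicator {y..<1} t * g t \<partial>leb01)"
      using y by (intro prim_diff U) simp
    finally have "(u' 1 - u' y)\<^sup>2 \<le> (\<integral>x. indicator {y..<1} x * (1 / a x) \<partial>leb01) * e"
      unfolding e_def using weighted_Cauchy_Schwarz[OF _ U(9,5), of "{y..<1}"] by simp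
    also have "(\<integral>x. indicator {y..<1} x * (1 / a x) \<partial>leb01) = T y"
      using prim_diff[OF integrable_inv_a, of y 1] y by (simp add: T_def prim_ge_1 I_eq)
    finally show ?thesis using square_sum_le[of "u' 1" "u' y - u' 1"] by (simp add: power2_commute)
  qed
  have "ac (\<lambda>x. x * T x) (\<lambda>x. T x - x / a x)"
    by (rule ac_cong[OF ac_mult[OF ac_ident acT]]) auto
  from ac_integral[OF this] have "(\<integral>x. T x - x / a x \<partial>leb01) = 0" using T1 by simp
  moreover have iT: "integrable leb01 T" by (rule integrable_leb01_continuous[OF Tc])
  moreover have ixa: "integrable leb01 (\<lambda>x. x / a x)"
    by (rule integrable_leb01_continuous[OF ac_continuous_on[OF ac_x_over_a]])
  ultimately have T_int: "(\<integral>x. T x \<partial>leb01) \<le> 1 / (a 1 * (2 - K))"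
    using integral_x_over_a by simp
  have ac3: "ac (\<lambda>x. x ^ 3) (\<lambda>x. 3 * x\<^sup>2)"
    by (rule ac_derivative) (auto intro!: derivative_eq_intros continuous_intros)
  have ac3T: "ac (\<lambda>x. x ^ 3 * T x) (\<lambda>x. 3 * (x\<^sup>2 * T x) - x\<^sup>2 * (x / a x))"
    by (rule ac_cong[OF ac_mult[OF ac3 acT]]) (auto simp: power2_eq_square power3_eq_cube)
  have ix2T: "integrable leb01 (\<lambda>x. x\<^sup>2 * T x)"
    by (intro integrable_leb01_continuous continuous_intros Tc)
  have ix2a: "integrable leb01 (\<lambda>x. x\<^sup>2 * (x / a x))"
    by (intro integrable_leb01_continuous continuous_on_mult ac_continuous_on[OF ac_x_over_a] continuous_intros)
  have "3 * (\<integral>x. x\<^sup>2 * T x \<partial>leb01) = (\<integral>x. x\<^sup>2 * (x / a x) \<partial>leb01)"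
    using ac_integral[OF ac3T] T1 ix2T ix2a by simp
  also have "\<dots> \<le> (\<integral>x. x / a x \<partial>leb01)"
  proof (rule integral_leb01_mono[OF ix2a ixa])
    fix x :: real assume x: "x \<in> {0<..<1}"
    have "x\<^sup>2 * (x / a x) \<le> 1 * (x / a x)"
      using x a_pos[of x] by (intro mult_right_mono) (auto simp: power_le_one)
    thus "x\<^sup>2 * (x / a x) \<le> x / a x" by simp
  qed
  finally have x2T_int: "(\<integral>x. x\<^sup>2 * T x \<partial>leb01) \<le> 1 / 3 * (1 / (a 1 * (2 - K)))"
    using integral_x_over_a by linarith
  have "(\<integral>x. (u' x)\<^sup>2 \<partial>leb01) \<le> (\<integral>x. 2 * (u' 1)\<^sup>2 + 2 * (T x * e) \<partial>leb01)"
    using iT pw by (intro integral_leb01_mono integrable_leb01_continuous continuous_intros U Tc) auto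
  also have "\<dots> = 2 * (u' 1)\<^sup>2 + 2 * ((\<integral>x. T x \<partial>leb01) * e)" using iT by (simp add: measure_leb01)
  also have "\<dots> \<le> 2 * (u' 1)\<^sup>2 + 2 * (1 / (a 1 * (2 - K)) * e)"
    using T_int e0 by (intro add_left_mono mult_left_mono mult_right_mono) auto
  finally show "(\<integral>x. (u' x)\<^sup>2 \<partial>leb01) \<le> 2 * (u' 1)\<^sup>2 + 2 / (a 1 * (2 - K)) * (\<integral>x. a x * (g x)\<^sup>2 \<partial>leb01)"
    by (simp add: e_def)
  have ix2: "(\<integral>x. x\<^sup>2 \<partial>leb01) = 1 / 3" and ix2': "integrable leb01 (\<lambda>x::real. x\<^sup>2)"
    using ac_integral[OF ac3] by (auto intro!: integrable_leb01_continuous continuous_intros)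
  have "(\<integral>x. x\<^sup>2 * (u' x)\<^sup>2 \<partial>leb01) \<le> (\<integral>x. x\<^sup>2 * (2 * (u' 1)\<^sup>2) + 2 * (x\<^sup>2 * T x * e) \<partial>leb01)"
  proof (intro integral_leb01_mono integrable_leb01_continuous continuous_intros U Tc)
    fix x :: real assume "x \<in> {0<..<1}"
    hence "(u' x)\<^sup>2 \<le> 2 * (u' 1)\<^sup>2 + 2 * (T x * e)" by (intro pw) auto
    hence "x\<^sup>2 * (u' x)\<^sup>2 \<le> x\<^sup>2 * (2 * (u' 1)\<^sup>2 + 2 * (T x * e))" by (intro mult_left_mono) auto
    thus "x\<^sup>2 * (u' x)\<^sup>2 \<le> x\<^sup>2 * (2 * (u' 1)\<^sup>2) + 2 * (x\<^sup>2 * T x * e)" by (simp add: algebra_simps)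
  qed
  also have "\<dots> = 1 / 3 * (2 * (u' 1)\<^sup>2) + 2 * ((\<integral>x. x\<^sup>2 * T x \<partial>leb01) * e)"
    using ix2T ix2 ix2' by simp
  also have "\<dots> \<le> 1 / 3 * (2 * (u' 1)\<^sup>2) + 2 * (1 / 3 * (1 / (a 1 * (2 - K))) * e)"
    using x2T_int e0 by (intro add_left_mono mult_left_mono mult_right_mono) auto
  finally show "(\<integral>x. x\<^sup>2 * (u' x)\<^sup>2 \<partial>leb01)
      \<le> 1 / 3 * (2 * (u' 1)\<^sup>2 + 2 / (a 1 * (2 - K)) * (\<integral>x. a x * (g x)\<^sup>2 \<partial>leb01))"
    by (simp add: e_def algebra_simps)
qed

lemma K2_bound:
  assumes u: "K2rep u u' g" and y: "y \<in> {0..1}"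
  shows "(u y)\<^sup>2 \<le> I * (\<integral>x. a x * (g x)\<^sup>2 \<partial>leb01)"
proof -
  note U = K2repD[OF u]
  have "(\<integral>x. (u' x)\<^sup>2 \<partial>leb01) \<le> (\<integral>x. I * (\<integral>x. a x * (g x)\<^sup>2 \<partial>leb01) \<partial>leb01)"
    using U(6) K2_deriv_bound[OF u] by (intro integral_leb01_mono integrable_leb01_continuous continuous_intros) auto
  hence *: "(\<integral>x. (u' x)\<^sup>2 \<partial>leb01) \<le> I * (\<integral>x. a x * (g x)\<^sup>2 \<partial>leb01)"
    by (simp only: integral_const_leb01)
  have "(u y)\<^sup>2 \<le> y * (\<integral>x. (u' x)\<^sup>2 \<partial>leb01)" by (rule K2_bound_deriv_norm[OF u y])
  also have "\<dots> \<le> 1 * (\<integral>x. (u' x)\<^sup>2 \<partial>leb01)"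
    using y by (intro mult_right_mono integral_leb01_nonneg) auto
  finally show ?thesis using * by simp
qed

text \<open>Any continuous bending moment \<open>l\<close> is realised by an element of the space.
  Affine \<open>l\<close> gives the static solutions, polynomial \<open>l\<close> the approximating
  elements of the domain.\<close>

lemma K2rep_continuous_over_a:
  assumes l: "continuous_on {0..1} l"
  shows "K2rep (prim (prim (\<lambda>x. l x / a x))) (prim (\<lambda>x. l x / a x)) (\<lambda>x. l x / a x)"
    and "AE x in leb01. a x * (l x / a x) = l x"
proof -
  have i: "integrable leb01 (\<lambda>x. l x / a x)"
    using integrable_mult_continuous[OF l integrable_inv_a] by simp
  have "integrable leb01 (\<lambda>x. (l x)\<^sup>2 * (1 / a x))"
    by (intro integrable_mult_continuous integrable_inv_a continuous_intros l)
  hence "integrable leb01 (\<lambda>x. a x * (l x / a x)\<^sup>2)"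
    by (rule Bochner_Integration.integrable_cong[THEN iffD1, rotated 2])
       (auto simp: power2_eq_square)
  thus "K2rep (prim (prim (\<lambda>x. l x / a x))) (prim (\<lambda>x. l x / a x)) (\<lambda>x. l x / a x)"
    unfolding K2rep_def
    by (simp add: ac_prim i integrable_leb01_continuous continuous_on_prim)
  show "AE x in leb01. a x * (l x / a x) = l x"
    using AE_leb01_Ioo by eventually_elim (use a_pos in force)
qed

end

section \<open>The static problem\<close>

locale beam = wd +
  fixes \<beta> \<gamma> :: real
  assumes \<beta>_nonneg: "0 \<le> \<beta>" and \<gamma>_nonneg: "0 \<le> \<gamma>"
begin

abbreviation "C1 \<equiv> C1_const a"
abbreviation "Ag \<equiv> A_const a \<gamma>"
abbreviation "Cb \<equiv> Cb_const a \<beta>"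
abbreviation "Cg \<equiv> Cb_const a \<gamma>"

lemma C1_ge: "2 \<le> C1" "2 / (a 1 * (2 - K)) \<le> C1"
proof -
  show "2 \<le> C1" by (simp add: C1_const_def)
  have "2 * (1 / (a 1 * (2 - K))) \<le> C1"
    unfolding C1_const_def by (intro mult_left_mono max.cobounded2) simp
  thus "2 / (a 1 * (2 - K)) \<le> C1" by simp
qed

lemma Ag_ge_1: "1 \<le> Ag"
  using I_pos \<gamma>_nonneg by (simp add: A_const_def)

lemma Cb_const_pos: "0 \<le> b \<Longrightarrow> 0 < Cb_const a b"
  using I_pos by (auto simp: Cb_const_def)

text \<open>Meaning of \<open>Cb\<close> and \<open>Cg\<close>: a squared boundary value is
  controlled either through the bending energy, with factor \<open>I\<close>, or through its own
  elastic term, with factor \<open>1 / b\<close>; the constant takes the better of the two.\<close>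

lemma Cb_const_bound:
  assumes "0 \<le> b" "0 \<le> s" "0 \<le> e" "s \<le> I * e"
  shows "s \<le> Cb_const a b / 2 * (e + b * s)"
proof (cases "b = 0")
  case True
  thus ?thesis using assms by (simp add: Cb_const_def)
next
  case False
  hence b: "0 < b" using assms by simp
  have "s \<le> I * (e + b * s)"
    using assms I_pos b by (simp add: distrib_left add_increasing2)
  moreover have "s \<le> 1 / b * (e + b * s)"
    using b assms by (simp add: distrib_left)
  ultimately show ?thesis using False by (simp add: Cb_const_def min_def)
qed

text \<open>The same alternative when the bending energy also stands on the left; comparing the two
  summands separately then gives the factor \<open>max 1 (1 / \<gamma>)\<close>.\<close>

lemma Ag_bound:
  assumes "0 \<le> s" "0 \<le> e" "s \<le> I * e"
  shows "e + s \<le> Ag * (e + \<gamma> * s)"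
proof -
  have 1: "e + s \<le> (1 + I) * (e + \<gamma> * s)"
  proof -
    have "e + s \<le> (1 + I) * e" using assms by (simp add: distrib_right)
    also have "\<dots> \<le> (1 + I) * (e + \<gamma> * s)"
      using I_pos \<gamma>_nonneg assms by (intro mult_left_mono) auto
    finally show ?thesis .
  qed
  show ?thesis
  proof (cases "\<gamma> = 0")
    case False
    hence g: "0 < \<gamma>" using \<gamma>_nonneg by simp
    have "e + s \<le> max 1 (1 / \<gamma>) * (e + \<gamma> * s)"
    proof -
      have "e \<le> max 1 (1 / \<gamma>) * e" using mult_right_mono[of 1 "max 1 (1 / \<gamma>)" e] assms by simp
      moreover have "1 / \<gamma> * (\<gamma> * s) \<le> max 1 (1 / \<gamma>) * (\<gamma> * s)"
        using g assms by (intro mult_right_mono) auto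
      ultimately show ?thesis using g by (simp add: distrib_left)
    qed
    with 1 show ?thesis using False by (simp add: A_const_def min_def)
  qed (use 1 in \<open>simp add: A_const_def\<close>)
qed

section \<open>Explicit solution of the static problem and its bounds in terms of the boundary
  data\<close>

definition Z1 where "Z1 = prim (prim (\<lambda>x. 1 / a x))"
definition Z2 where "Z2 = prim (prim (\<lambda>x. (1 - x) / a x))"

lemma K2rep_Z1: "K2rep Z1 (prim (\<lambda>x. 1 / a x)) (\<lambda>x. 1 / a x)"
  unfolding Z1_def by (rule K2rep_continuous_over_a) (intro continuous_intros)

lemma K2rep_Z2: "K2rep Z2 (prim (\<lambda>x. (1 - x) / a x)) (\<lambda>x. (1 - x) / a x)"
  unfolding Z2_def by (rule K2rep_continuous_over_a) (intro continuous_intros)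

definition I1 where "I1 = (\<integral>x. (1 - x) / a x \<partial>leb01)"
definition I2 where "I2 = (\<integral>x. (1 - x)\<^sup>2 / a x \<partial>leb01)"

text \<open>Taylor's formula at 0 with integral remainder, evaluated at 1; it explains the moments
  \<open>I1\<close> and \<open>I2\<close> of \<open>1 / a\<close>.\<close>

lemma K2rep_end:
  assumes "K2rep u u' g"
  shows "u 1 = (\<integral>x. (1 - x) * g x \<partial>leb01)"
proof -
  note U = K2repD[OF assms]
  have ac1: "ac (\<lambda>x. 1 - x) (\<lambda>_. - 1)" by (rule ac_derivative) (auto intro!: derivative_eq_intros)
  have "ac (\<lambda>x. u x + (1 - x) * u' x) (\<lambda>x. (1 - x) * g x)"
    by (rule ac_cong[OF ac_add[OF U(1) ac_mult[OF ac1 U(2)]]]) auto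
  from ac_integral[OF this] show ?thesis using U(3,4) by simp
qed

lemma Z_end: "Z1 1 = I1" "Z2 1 = I2" "prim (\<lambda>x. 1 / a x) 1 = I" "prim (\<lambda>x. (1 - x) / a x) 1 = I1"
  using K2rep_end[OF K2rep_Z1] K2rep_end[OF K2rep_Z2]
  by (simp_all add: I1_def I2_def I_eq prim_ge_1 power2_eq_square)

text \<open>The affine function \<open>kap p q - lam p q * (1 - x)\<close> is the bending moment of the static solution with
  boundary data \<open>p\<close> and \<open>q\<close>; its coefficients come from Cramer's rule.\<close>

definition "static_det = (1 + \<beta> * I2) * (1 + \<gamma> * I) - \<beta> * \<gamma> * I1\<^sup>2"
definition "kap p q = ((1 + \<beta> * I2) * q - \<gamma> * I1 * p) / static_det"
definition "lam p q = (\<beta> * I1 * q - (1 + \<gamma> * I) * p) / static_det"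

text \<open>By Cauchy-Schwarz \<open>I1^2 \<le> I * I2\<close>, which compensates the negative term
  and leaves at least \<open>1 + \<beta> * I2 + \<gamma> * I\<close>.\<close>

lemma static_det_pos: "0 < static_det"
proof -
  have i: "integrable leb01 (\<lambda>x. l x / a x)" if "continuous_on {0..1} l" for l
    using integrable_mult_continuous[OF that integrable_inv_a] by simp
  let ?f = "\<lambda>x. 1 / sqrt (a x)" and ?g = "\<lambda>x. (1 - x) / sqrt (a x)"
  have e: "(?f x)\<^sup>2 = 1 / a x" "(?g x)\<^sup>2 = (1 - x)\<^sup>2 / a x" "?f x * ?g x = (1 - x) / a x" if "x \<in> {0<..<1}" for x
    using a_pos[of x] that by (auto simp: power_divide)
  have "integrable leb01 (\<lambda>x. (?f x)\<^sup>2)"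
    using integrable_inv_a by (rule Bochner_Integration.integrable_cong[THEN iffD1, rotated 2]) (use e(1) in auto)
  moreover have "integrable leb01 (\<lambda>x. (1 - x)\<^sup>2 / a x)" by (intro i continuous_intros)
  hence "integrable leb01 (\<lambda>x. (?g x)\<^sup>2)"
    by (rule Bochner_Integration.integrable_cong[THEN iffD1, rotated 2]) (use e(2) in auto)
  ultimately have "(\<integral>x. ?f x * ?g x \<partial>leb01)\<^sup>2 \<le> (\<integral>x. (?f x)\<^sup>2 \<partial>leb01) * (\<integral>x. (?g x)\<^sup>2 \<partial>leb01)"
    by (intro Cauchy_Schwarz_leb01) measurable
  also have "(\<integral>x. ?f x * ?g x \<partial>leb01) = I1" unfolding I1_def
    by (rule Bochner_Integration.integral_cong[OF refl]) (use e(3) in auto)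
  also have "(\<integral>x. (?f x)\<^sup>2 \<partial>leb01) = I" unfolding I_eq
    by (rule Bochner_Integration.integral_cong[OF refl]) (use e(1) in auto)
  also have "(\<integral>x. (?g x)\<^sup>2 \<partial>leb01) = I2" unfolding I2_def
    by (rule Bochner_Integration.integral_cong[OF refl]) (use e(2) in auto)
  finally have *: "\<beta> * \<gamma> * I1\<^sup>2 \<le> \<beta> * \<gamma> * (I * I2)"
    using \<beta>_nonneg \<gamma>_nonneg by (intro mult_left_mono) auto
  have "0 \<le> I2" unfolding I2_def by (rule integral_leb01_nonneg) (auto simp: a_pos less_imp_le)
  hence "0 \<le> \<beta> * I2" "0 \<le> \<gamma> * I" using \<beta>_nonneg \<gamma>_nonneg I_pos by auto
  thus ?thesis using * unfolding static_det_def by (simp add: algebra_simps)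
qed

definition zs where "zs p q x = kap p q * Z1 x + (- lam p q) * Z2 x"
definition zs' where "zs' p q x = kap p q * prim (\<lambda>x. 1 / a x) x + (- lam p q) * prim (\<lambda>x. (1 - x) / a x) x"
definition zs'' where "zs'' p q x = kap p q * (1 / a x) + (- lam p q) * ((1 - x) / a x)"

lemma K2rep_zs: "K2rep (zs p q) (zs' p q) (zs'' p q)"
  using K2rep_lincomb[OF K2rep_Z1 K2rep_Z2, of "kap p q" "- lam p q"]
  unfolding zs_def[abs_def] zs'_def[abs_def] zs''_def[abs_def] .

lemma zs_moment: "AE x in leb01. a x * zs'' p q x = kap p q - lam p q * (1 - x)"
  using AE_leb01_Ioo
proof eventually_elim
  fix x :: real assume "x \<in> {0<..<1}"
  hence "0 < a x" using a_pos by auto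
  thus "a x * zs'' p q x = kap p q - lam p q * (1 - x)" by (simp add: zs''_def field_simps)
qed

lemma zs_boundary: "\<beta> * zs p q 1 - lam p q = p" "\<gamma> * zs' p q 1 + kap p q = q"
proof -
  have d: "static_det \<noteq> 0" using static_det_pos by simp
  have k: "static_det * kap p q = (1 + \<beta> * I2) * q - \<gamma> * I1 * p"
    and l: "static_det * lam p q = \<beta> * I1 * q - (1 + \<gamma> * I) * p"
    using d by (simp_all add: kap_def lam_def)
  have "static_det * (\<beta> * zs p q 1 - lam p q)
      = \<beta> * I1 * (static_det * kap p q) - (1 + \<beta> * I2) * (static_det * lam p q)"
    by (simp add: zs_def Z_end algebra_simps)
  also have "\<dots> = static_det * p"
    by (simp only: k l) (simp add: static_det_def algebra_simps power2_eq_square)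
  finally show "\<beta> * zs p q 1 - lam p q = p" using d by simp
  have "static_det * (\<gamma> * zs' p q 1 + kap p q)
      = (1 + \<gamma> * I) * (static_det * kap p q) - \<gamma> * I1 * (static_det * lam p q)"
    by (simp add: zs'_def Z_end algebra_simps)
  also have "\<dots> = static_det * q"
    by (simp only: k l) (simp add: static_det_def algebra_simps power2_eq_square)
  finally show "\<gamma> * zs' p q 1 + kap p q = q" using d by simp
qed

text \<open>The witness \<open>D\<close> is the static energy. Testing the static problem with its
  own solution gives \<open>D = p * s + q * r\<close>, where \<open>s\<close> and \<open>r\<close>
  are the end value and end slope of the solution. Their squares are at most
  \<open>C1 * Ag * D\<close> and \<open>Ag * D\<close>, so Young's inequality bounds each product by
  a multiple of the datum squared plus \<open>D / 4\<close>, and half of \<open>D\<close> is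
  absorbed.\<close>

lemma zs_estimates:
  shows "\<exists>D\<ge>0. (zs p q 1)\<^sup>2 \<le> Cb / 2 * D \<and> (zs' p q 1)\<^sup>2 \<le> Cg / 2 * D
      \<and> D \<le> 2 * Ag * (C1 * p\<^sup>2 + q\<^sup>2) \<and> (\<integral>x. (zs p q x)\<^sup>2 \<partial>leb01) \<le> C1 * Ag * D"
proof -
  note Z = K2repD[OF K2rep_zs[of p q]]
  define e where "e = (\<integral>x. a x * (zs'' p q x)\<^sup>2 \<partial>leb01)"
  define s where "s = zs p q 1"
  define r where "r = zs' p q 1"
  define D where "D = e + \<beta> * s\<^sup>2 + \<gamma> * r\<^sup>2"
  have e0: "0 \<le> e" unfolding e_def by (rule bending_energy_nonneg)
  have acl: "ac (\<lambda>x. kap p q - lam p q * (1 - x)) (\<lambda>_. lam p q)"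
    by (rule ac_derivative) (auto intro!: derivative_eq_intros)
  have ac1: "ac (\<lambda>x. (kap p q - lam p q * (1 - x)) * zs' p q x) (\<lambda>x. lam p q * zs' p q x + a x * (zs'' p q x)\<^sup>2)"
  proof (rule ac_cong[OF ac_mult[OF acl Z(2)]])
    show "AE x in leb01. lam p q * zs' p q x + (kap p q - lam p q * (1 - x)) * zs'' p q x
        = lam p q * zs' p q x + a x * (zs'' p q x)\<^sup>2"
      using zs_moment[of p q] by eventually_elim (simp add: power2_eq_square flip: mult.assoc)
  qed simp
  have "kap p q * r = lam p q * s + e"
    using ac_integral[OF ac1] Z(3-5) acD(1)[OF Z(1)] ac_integral[OF Z(1)] by (simp add: r_def s_def e_def)
  moreover have "\<beta> * s - lam p q = p" "\<gamma> * r + kap p q = q"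
    unfolding s_def r_def by (rule zs_boundary)+
  hence "lam p q = \<beta> * s - p" "kap p q = q - \<gamma> * r" by simp_all
  ultimately have D: "D = p * s + q * r"
    by (simp add: D_def algebra_simps power2_eq_square)
  have r2: "r\<^sup>2 \<le> I * e" unfolding r_def e_def by (rule K2_deriv_bound[OF K2rep_zs]) simp
  have s2: "s\<^sup>2 \<le> I * e" unfolding s_def e_def by (rule K2_bound[OF K2rep_zs]) simp
  have D0: "0 \<le> D" unfolding D_def using e0 \<beta>_nonneg \<gamma>_nonneg by simp
  have sD: "s\<^sup>2 \<le> Cb / 2 * D"
  proof -
    have "s\<^sup>2 \<le> Cb / 2 * (e + \<beta> * s\<^sup>2)" by (rule Cb_const_bound[OF \<beta>_nonneg _ e0 s2]) simp
    also have "\<dots> \<le> Cb / 2 * D"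
      unfolding D_def using Cb_const_pos[OF \<beta>_nonneg] \<gamma>_nonneg by (intro mult_left_mono) auto
    finally show ?thesis .
  qed
  have rD: "r\<^sup>2 \<le> Cg / 2 * D"
  proof -
    have "r\<^sup>2 \<le> Cg / 2 * (e + \<gamma> * r\<^sup>2)" by (rule Cb_const_bound[OF \<gamma>_nonneg _ e0 r2]) simp
    also have "\<dots> \<le> Cg / 2 * D"
      unfolding D_def using Cb_const_pos[OF \<gamma>_nonneg] \<beta>_nonneg by (intro mult_left_mono) auto
    finally show ?thesis .
  qed
  have er: "e + r\<^sup>2 \<le> Ag * D"
  proof -
    have "e + r\<^sup>2 \<le> Ag * (e + \<gamma> * r\<^sup>2)" by (rule Ag_bound[OF _ e0 r2]) simp
    also have "\<dots> \<le> Ag * D"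
      unfolding D_def using Ag_ge_1 \<beta>_nonneg by (intro mult_left_mono) auto
    finally show ?thesis .
  qed
  define n where "n = (\<integral>x. (zs' p q x)\<^sup>2 \<partial>leb01)"
  have n: "n \<le> C1 * Ag * D"
  proof -
    have "n \<le> 2 * r\<^sup>2 + 2 / (a 1 * (2 - K)) * e"
      unfolding n_def r_def e_def by (rule K2_weighted_deriv_norms[OF K2rep_zs])
    also have "\<dots> \<le> C1 * r\<^sup>2 + C1 * e"
      using C1_ge e0 by (intro add_mono mult_right_mono) auto
    also have "\<dots> = C1 * (e + r\<^sup>2)" by (simp add: algebra_simps)
    also have "\<dots> \<le> C1 * (Ag * D)" using er C1_ge by (intro mult_left_mono) auto
    finally show ?thesis by simp
  qed
  have n0: "0 \<le> n" unfolding n_def by (rule integral_leb01_nonneg) simp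
  have sn: "s\<^sup>2 \<le> C1 * Ag * D"
    using K2_bound_deriv_norm[OF K2rep_zs, of 1 p q] n unfolding s_def n_def by simp
  have rA: "r\<^sup>2 \<le> Ag * D" using er e0 by simp
  have young: "x * y \<le> c * x\<^sup>2 + D / 4" if "y\<^sup>2 \<le> c * D" "0 < c" for x y c
  proof -
    have "0 \<le> (2 * c * x - y)\<^sup>2" by simp
    hence "4 * c * (x * y) \<le> 4 * c\<^sup>2 * x\<^sup>2 + c * D"
      using that by (simp add: power2_diff power_mult_distrib algebra_simps)
    also have "\<dots> = 4 * c * (c * x\<^sup>2 + D / 4)" by (simp add: algebra_simps power2_eq_square)
    finally show ?thesis using \<open>0 < c\<close> by simp
  qed
  have "p * s \<le> C1 * Ag * p\<^sup>2 + D / 4" using sn C1_ge Ag_ge_1 by (intro young) auto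
  moreover have "q * r \<le> Ag * q\<^sup>2 + D / 4" using rA Ag_ge_1 by (intro young) auto
  moreover have "2 * Ag * (C1 * p\<^sup>2 + q\<^sup>2) = 2 * (C1 * Ag * p\<^sup>2) + 2 * (Ag * q\<^sup>2)"
    by (simp add: algebra_simps)
  ultimately have DD: "D \<le> 2 * Ag * (C1 * p\<^sup>2 + q\<^sup>2)" using D by linarith
  have "(\<integral>x. (zs p q x)\<^sup>2 \<partial>leb01) \<le> C1 * Ag * D"
    using K2_norm_le_deriv_norm[OF K2rep_zs, of p q] n n0 unfolding n_def by linarith
  thus ?thesis using D0 sD rD DD unfolding s_def r_def by blast
qed

lemma zs_norm_le: "(\<integral>x. (zs p q x)\<^sup>2 \<partial>leb01) \<le> 2 * C1 * Ag\<^sup>2 * (C1 * p\<^sup>2 + q\<^sup>2)"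
proof -
  obtain D where D: "D \<le> 2 * Ag * (C1 * p\<^sup>2 + q\<^sup>2)" "(\<integral>x. (zs p q x)\<^sup>2 \<partial>leb01) \<le> C1 * Ag * D"
    using zs_estimates[of p q] by blast
  note D(2)
  also have "C1 * Ag * D \<le> C1 * Ag * (2 * Ag * (C1 * p\<^sup>2 + q\<^sup>2))"
    using D(1) C1_ge Ag_ge_1 by (intro mult_left_mono) auto
  finally show ?thesis by (simp add: power2_eq_square algebra_simps)
qed

text \<open>The factor is the reciprocal of \<open>nu_const\<close>; multiplied by
  \<open>\<delta>\<close> it is \<open>1 - Cd\<close>, the share of the static gain lost to the end
  values of the static solution.\<close>

lemma zs_end_le: "(zs p q 1)\<^sup>2 + (zs' p q 1)\<^sup>2 \<le> max 1 C1 * (Cb + Cg) * Ag * (p\<^sup>2 + q\<^sup>2)"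
proof -
  obtain D where D: "(zs p q 1)\<^sup>2 \<le> Cb / 2 * D" "(zs' p q 1)\<^sup>2 \<le> Cg / 2 * D"
      "D \<le> 2 * Ag * (C1 * p\<^sup>2 + q\<^sup>2)"
    using zs_estimates[of p q] by blast
  have "(zs p q 1)\<^sup>2 + (zs' p q 1)\<^sup>2 \<le> (Cb + Cg) / 2 * D" using D by (simp add: algebra_simps)
  also have "\<dots> \<le> (Cb + Cg) / 2 * (2 * Ag * (C1 * p\<^sup>2 + q\<^sup>2))"
    using D(3) Cb_const_pos[OF \<beta>_nonneg] Cb_const_pos[OF \<gamma>_nonneg] by (intro mult_left_mono) auto
  also have "\<dots> = (Cb + Cg) * Ag * (C1 * p\<^sup>2 + q\<^sup>2)" by simp
  also have "\<dots> \<le> (Cb + Cg) * Ag * (max 1 C1 * (p\<^sup>2 + q\<^sup>2))"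
  proof (intro mult_left_mono)
    have "C1 * p\<^sup>2 \<le> max 1 C1 * p\<^sup>2" "1 * q\<^sup>2 \<le> max 1 C1 * q\<^sup>2" by (intro mult_right_mono; simp)+
    thus "C1 * p\<^sup>2 + q\<^sup>2 \<le> max 1 C1 * (p\<^sup>2 + q\<^sup>2)" by (simp only: distrib_left)
  qed (use Ag_ge_1 Cb_const_pos[OF \<beta>_nonneg] Cb_const_pos[OF \<gamma>_nonneg] in auto)
  finally show ?thesis by (simp add: mult_ac)
qed

end

section \<open>The dissipation inequality\<close>

lemma young_le: "(x::real) * y \<le> d * x\<^sup>2 + y\<^sup>2 / (4 * d)" if "0 < d"
proof -
  have "0 \<le> (2 * d * x - y)\<^sup>2 / (4 * d)" using that by simp
  thus ?thesis using that by (simp add: power2_diff power_mult_distrib field_simps power2_eq_square)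
qed

lemma integral_mult_young:
  fixes f g :: "real \<Rightarrow> real"
  assumes m: "f \<in> borel_measurable leb01" "g \<in> borel_measurable leb01"
    and f: "integrable leb01 (\<lambda>x. (f x)\<^sup>2)" and g: "integrable leb01 (\<lambda>x. (g x)\<^sup>2)" and d: "0 < d"
  shows "\<bar>\<integral>x. f x * g x \<partial>leb01\<bar> \<le> d * (\<integral>x. (f x)\<^sup>2 \<partial>leb01) + (\<integral>x. (g x)\<^sup>2 \<partial>leb01) / (4 * d)"
proof -
  have "\<bar>\<integral>x. f x * g x \<partial>leb01\<bar> \<le> (\<integral>x. \<bar>f x * g x\<bar> \<partial>leb01)" by (rule integral_abs_bound)
  also have "\<dots> \<le> (\<integral>x. d * (f x)\<^sup>2 + (g x)\<^sup>2 / (4 * d) \<partial>leb01)"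
  proof (rule integral_leb01_mono)
    show "integrable leb01 (\<lambda>x. \<bar>f x * g x\<bar>)" using integrable_mult_L2[OF m f g] by simp
    show "integrable leb01 (\<lambda>x. d * (f x)\<^sup>2 + (g x)\<^sup>2 / (4 * d))" using f g by simp
    show "\<bar>f x * g x\<bar> \<le> d * (f x)\<^sup>2 + (g x)\<^sup>2 / (4 * d)" for x
      using young_le[OF d, of "\<bar>f x\<bar>" "\<bar>g x\<bar>"] by (simp add: abs_mult)
  qed
  also have "\<dots> = d * (\<integral>x. (f x)\<^sup>2 \<partial>leb01) + (\<integral>x. (g x)\<^sup>2 \<partial>leb01) / (4 * d)" using f g by simp
  finally show ?thesis .
qed

locale beam_decay = beam +
  fixes \<epsilon>0 \<delta> :: real
  assumes \<epsilon>0: "0 < \<epsilon>0" "\<epsilon>0 \<le> 2 - degen_const a"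
    and \<delta>: "0 < \<delta>" "\<delta> < nu_const a \<beta> \<gamma>"
begin

abbreviation "Cd \<equiv> Cdelta_const a \<beta> \<gamma> \<delta>"
abbreviation "sg \<equiv> sigma_const a"

text \<open>Sum of the coefficients of \<open>u(1)^2\<close> and \<open>u'(1)^2\<close> that remain
  after the interior terms are estimated. One common constant suffices, because each of the two
  coefficients is at most this sum.\<close>

definition "Qs = K / 4 + K * \<beta> / 2 + 2 * \<beta> + \<epsilon>0 * (\<beta> / 2) + 1 + 2 * \<gamma>\<^sup>2 / a 1 + \<epsilon>0 * (\<gamma> / 2)"
text \<open>Weight of the static multiplier: the fraction \<open>Cd\<close> of its gain survives, so
  the net gain is exactly \<open>Qs\<close>.\<close>

definition "Qd = Qs / Cd"
definition "N0 = 2 * C1 * Ag\<^sup>2 * max 1 C1"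
definition "mx = Max {1, 2 / (a 1 * (2 - K)), Cg}"
definition "C0 = 2 * mx + K / 2 * mx + Qd * (1 + C1\<^sup>2 * Ag\<^sup>2 * Cb + C1 * Ag\<^sup>2 * Cg)"
text \<open>Weight of the energy in the functional. The summand \<open>C0\<close> secures
  nonnegativity; the other two absorb the squares of \<open>v(1)\<close> and \<open>v'(1)\<close>
  left by the interior terms and by the static multiplier.\<close>

definition "N1 = C0 + sg + Qd * ((1 + N0) / \<delta>)"

lemma Cd_pos: "0 < Cd"
proof -
  let ?X = "max 1 C1 * (Cb + Cg) * Ag"
  have "0 < ?X"
    using Cb_const_pos[OF \<beta>_nonneg] Cb_const_pos[OF \<gamma>_nonneg] Ag_ge_1 by (intro mult_pos_pos) auto
  hence "\<delta> * ?X < 1" using \<delta>(2) by (simp add: nu_const_def field_simps)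
  thus ?thesis by (simp add: Cdelta_const_def mult_ac)
qed

lemma Qs_nonneg: "0 \<le> Qs"
  unfolding Qs_def using K_pos \<beta>_nonneg \<gamma>_nonneg a_1_pos \<epsilon>0 by simp

lemma Qd_nonneg: "0 \<le> Qd"
  unfolding Qd_def using Qs_nonneg Cd_pos by simp

lemma N0_nonneg: "0 \<le> N0"
  unfolding N0_def using C1_ge Ag_ge_1 by simp

lemma mx_ge: "1 \<le> mx" "2 / (a 1 * (2 - K)) \<le> mx" "Cg \<le> mx"
  unfolding mx_def by (rule Max_ge; simp)+

lemma sg_ge: "K / 4 + 2 \<le> sg" "2 / a 1 \<le> sg"
  by (simp_all add: sigma_const_def)

lemma C0_nonneg: "0 \<le> C0"
  unfolding C0_def using mx_ge Qd_nonneg K_pos C1_ge Ag_ge_1 Cb_const_pos[OF \<beta>_nonneg] Cb_const_pos[OF \<gamma>_nonneg]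
  by (intro add_nonneg_nonneg mult_nonneg_nonneg) auto

lemma C3_eq: "\<delta> * C3_const a \<beta> \<gamma> \<epsilon>0 \<delta> = 2 * \<delta> * Qd"
  by (simp add: C3_const_def Qd_def Qs_def Let_def add_divide_distrib algebra_simps)

text \<open>\<open>theta_const\<close> is \<open>K * mx\<close> and \<open>rho_const\<close> is
  \<open>4 * mx\<close>, that is, twice the first two summands of \<open>C0\<close>, and
  \<open>C5_const\<close> contains the third one twice. Hence \<open>C4\<close> splits into
  \<open>C0\<close>, \<open>N1\<close> and the bound for the term in \<open>u'(1)^2\<close>.\<close>

lemma C4_eq: "C4_const a \<beta> \<gamma> \<epsilon>0 \<delta> = 2 * C0 + sg + (2 - K / 2) * (Cg / 2) + Qd * ((1 + N0) / \<delta>)"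
proof -
  have r: "rho_const a \<gamma> = 4 * mx"
    by (simp add: rho_const_def mx_def insert_commute)
  have t: "theta_const a \<gamma> = K * mx"
    by (simp add: theta_const_def mx_def)
  have "C5_const a \<beta> \<gamma> \<epsilon>0 \<delta>
      = Qd * (2 + 2 * C1\<^sup>2 * Ag\<^sup>2 * Cb + 2 * C1 * Ag\<^sup>2 * Cg + 1 / \<delta> + 2 * (C1 * Ag\<^sup>2 * max 1 C1 / \<delta>))"
    by (simp add: C5_const_def Qd_def Qs_def Let_def)
  also have "\<dots> = 2 * (Qd * (1 + C1\<^sup>2 * Ag\<^sup>2 * Cb + C1 * Ag\<^sup>2 * Cg)) + Qd * ((1 + N0) / \<delta>)"
    by (simp add: N0_def add_divide_distrib algebra_simps)
  finally show ?thesis unfolding C4_const_def r t C0_def by (simp add: algebra_simps)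
qed

text \<open>Pure algebra with \<open>p = u(1)\<close>, \<open>q = u'(1)\<close>,
  \<open>r = v(1)\<close>, \<open>s = v'(1)\<close>, \<open>V\<close> the integral of
  \<open>v^2\<close> and \<open>e\<close> that of \<open>a u''^2\<close>. The products
  \<open>q * s\<close> coming from \<open>X1\<close> and \<open>X2\<close> add up to
  \<open>- (2 - K / 2) * (q * s)\<close> and are cancelled exactly by the added term; the remaining
  mixed products go through Young's inequality.\<close>

lemma interior_estimate:
  fixes p q r s V e X1 X2 :: real
  assumes X1: "(\<beta> * p + r) * q + (\<gamma> * q + s) * q - (\<gamma> * q + s)\<^sup>2 / (2 * a 1) + (3 - K) / 2 * e \<le> X1"
    and X2: "X2 = (\<beta> * p + r) * p + (\<gamma> * q + s) * q + e" and V: "0 \<le> V" and e: "0 \<le> e"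
  shows "- 2 * X1 + (r\<^sup>2 - V) + K / 2 * X2 - K / 2 * V + (2 - K / 2) * (q * s)
      \<le> - \<epsilon>0 * (1 / 2 * (V + e) + \<beta> / 2 * p\<^sup>2 + \<gamma> / 2 * q\<^sup>2) + Qs * (p\<^sup>2 + q\<^sup>2) + sg * (r\<^sup>2 + s\<^sup>2)"
proof -
  have A: "0 < a 1" by (rule a_1_pos)
  have "- 2 * X1 + (r\<^sup>2 - V) + K / 2 * X2 - K / 2 * V + (2 - K / 2) * (q * s)
     \<le> - 2 * ((\<beta> * p + r) * q + (\<gamma> * q + s) * q - (\<gamma> * q + s)\<^sup>2 / (2 * a 1) + (3 - K) / 2 * e)
        + (r\<^sup>2 - V) + K / 2 * X2 - K / 2 * V + (2 - K / 2) * (q * s)"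
    using X1 by simp
  also have "\<dots> = - 2 * (\<beta> * (p * q)) - 2 * (r * q) - (2 - K / 2) * (\<gamma> * q\<^sup>2) + (\<gamma> * q + s)\<^sup>2 / a 1 + r\<^sup>2
      + K / 2 * (\<beta> * p\<^sup>2) + K / 2 * (r * p) - (1 + K / 2) * V - (3 - 3 * K / 2) * e"
  proof -
    define \<tau> where "\<tau> = (\<gamma> * q + s)\<^sup>2 / (2 * a 1)"
    have "(\<gamma> * q + s)\<^sup>2 / a 1 = 2 * \<tau>" by (simp add: \<tau>_def)
    thus ?thesis unfolding X2 \<tau>_def[symmetric] by (simp add: field_simps power2_eq_square)
  qed
  finally have 1: "- 2 * X1 + (r\<^sup>2 - V) + K / 2 * X2 - K / 2 * V + (2 - K / 2) * (q * s) \<le> \<dots>" .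
  have t1: "- 2 * (\<beta> * (p * q)) \<le> \<beta> * p\<^sup>2 + \<beta> * q\<^sup>2"
  proof -
    have "0 \<le> \<beta> * (p + q)\<^sup>2" using \<beta>_nonneg by simp
    thus ?thesis by (simp add: power2_sum algebra_simps)
  qed
  have t2: "- 2 * (r * q) \<le> r\<^sup>2 + q\<^sup>2"
    using zero_le_power2[of "r + q"] unfolding power2_sum by (simp add: algebra_simps)
  have t3: "0 \<le> (2 - K / 2) * (\<gamma> * q\<^sup>2)" using K_less_1 \<gamma>_nonneg by simp
  have t4: "(\<gamma> * q + s)\<^sup>2 / a 1 \<le> 2 * \<gamma>\<^sup>2 / a 1 * q\<^sup>2 + 2 / a 1 * s\<^sup>2"
    using divide_right_mono[OF square_sum_le[of "\<gamma> * q" s], of "a 1"] A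
    by (simp add: power_mult_distrib add_divide_distrib)
  have t5: "K / 2 * (r * p) \<le> K / 4 * r\<^sup>2 + K / 4 * p\<^sup>2"
  proof -
    have "0 \<le> K / 4 * (r - p)\<^sup>2" using K_pos by simp
    thus ?thesis by (simp add: power2_diff algebra_simps)
  qed
  \<comment> \<open>This is where \<open>\<epsilon>0 \<le> 2 - K\<close> enters: both
    \<open>1 + K / 2\<close> and \<open>3 - 3 * K / 2\<close> are at least
    \<open>(2 - K) / 2\<close>.\<close>
  have t6: "\<epsilon>0 / 2 * V \<le> (1 + K / 2) * V" "\<epsilon>0 / 2 * e \<le> (3 - 3 * K / 2) * e"
    using \<epsilon>0 K_pos K_less_1 V e by (intro mult_right_mono; simp)+
  have t7: "(K / 4 + 2) * r\<^sup>2 \<le> sg * r\<^sup>2" "2 / a 1 * s\<^sup>2 \<le> sg * s\<^sup>2"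
    using sg_ge by (intro mult_right_mono; simp)+
  have t8: "(K / 4 + K * \<beta> / 2 + \<beta> + \<epsilon>0 * (\<beta> / 2)) * p\<^sup>2 \<le> Qs * p\<^sup>2"
    using \<epsilon>0 \<beta>_nonneg \<gamma>_nonneg A unfolding Qs_def by (intro mult_right_mono) auto
  have t9: "(\<beta> + 1 + 2 * \<gamma>\<^sup>2 / a 1 + \<epsilon>0 * (\<gamma> / 2)) * q\<^sup>2 \<le> Qs * q\<^sup>2"
    using \<epsilon>0 \<beta>_nonneg \<gamma>_nonneg A K_pos unfolding Qs_def by (intro mult_right_mono) auto
  have "- 2 * (\<beta> * (p * q)) - 2 * (r * q) - (2 - K / 2) * (\<gamma> * q\<^sup>2) + (\<gamma> * q + s)\<^sup>2 / a 1 + r\<^sup>2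
      + K / 2 * (\<beta> * p\<^sup>2) + K / 2 * (r * p) - (1 + K / 2) * V - (3 - 3 * K / 2) * e
    \<le> (\<beta> * p\<^sup>2 + \<beta> * q\<^sup>2) + (r\<^sup>2 + q\<^sup>2) + (2 * \<gamma>\<^sup>2 / a 1 * q\<^sup>2 + 2 / a 1 * s\<^sup>2) + r\<^sup>2
      + K / 2 * (\<beta> * p\<^sup>2) + (K / 4 * r\<^sup>2 + K / 4 * p\<^sup>2) - \<epsilon>0 / 2 * V - \<epsilon>0 / 2 * e"
    using t1 t2 t3 t4 t5 t6 by linarith
  also have "\<dots> = (K / 4 + K * \<beta> / 2 + \<beta> + \<epsilon>0 * (\<beta> / 2)) * p\<^sup>2 + (\<beta> + 1 + 2 * \<gamma>\<^sup>2 / a 1 + \<epsilon>0 * (\<gamma> / 2)) * q\<^sup>2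
      + (K / 4 + 2) * r\<^sup>2 + 2 / a 1 * s\<^sup>2 - \<epsilon>0 * (1 / 2 * (V + e) + \<beta> / 2 * p\<^sup>2 + \<gamma> / 2 * q\<^sup>2)"
    by (simp add: algebra_simps)
  also have "\<dots> \<le> Qs * p\<^sup>2 + Qs * q\<^sup>2 + sg * r\<^sup>2 + sg * s\<^sup>2 - \<epsilon>0 * (1 / 2 * (V + e) + \<beta> / 2 * p\<^sup>2 + \<gamma> / 2 * q\<^sup>2)"
    using t7 t8 t9 by linarith
  finally show ?thesis using 1 by (simp add: distrib_left)
qed

text \<open>The multiplier is linear in \<open>u\<close>, its static part included, since
  \<open>zs\<close> depends linearly on its data. Its time derivative along a solution is therefore
  the same operator applied to \<open>v\<close>.\<close>

definition mult_fun :: "(real \<Rightarrow> real) \<Rightarrow> (real \<Rightarrow> real) \<Rightarrow> real \<Rightarrow> real" where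
  "mult_fun u u' x = 2 * (x * u' x) - K / 2 * u x + Qd * zs (u 1) (u' 1) x"

lemma continuous_on_mult_fun:
  assumes "K2rep u u' g"
  shows "continuous_on {0..1} (mult_fun u u')"
  unfolding mult_fun_def using K2repD(6,7)[OF assms] K2repD(7)[OF K2rep_zs]
  by (intro continuous_intros)

lemma integral_mult_fun:
  assumes u: "K2rep u u' g" and w: "integrable leb01 w"
  shows "(\<integral>x. w x * mult_fun u u' x \<partial>leb01) = 2 * (\<integral>x. w x * (x * u' x) \<partial>leb01)
     - K / 2 * (\<integral>x. w x * u x \<partial>leb01) + Qd * (\<integral>x. w x * zs (u 1) (u' 1) x \<partial>leb01)"
proof -
  have i: "integrable leb01 (\<lambda>x. w x * f x)" if "continuous_on {0..1} f" for f
    using integrable_mult_continuous[OF that w] by (simp add: mult.commute)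
  note U = K2repD(6,7)[OF u]
  have i1: "integrable leb01 (\<lambda>x. w x * (x * u' x))" "integrable leb01 (\<lambda>x. w x * u x)"
    "integrable leb01 (\<lambda>x. w x * zs (u 1) (u' 1) x)"
    using U K2repD(7)[OF K2rep_zs] by (auto intro!: i continuous_intros)
  have "(\<integral>x. w x * mult_fun u u' x \<partial>leb01) = (\<integral>x. 2 * (w x * (x * u' x)) - K / 2 * (w x * u x)
     + Qd * (w x * zs (u 1) (u' 1) x) \<partial>leb01)"
    unfolding mult_fun_def by (simp add: algebra_simps)
  also have "\<dots> = 2 * (\<integral>x. w x * (x * u' x) \<partial>leb01)
     - K / 2 * (\<integral>x. w x * u x \<partial>leb01) + Qd * (\<integral>x. w x * zs (u 1) (u' 1) x \<partial>leb01)"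
    using i1 by simp
  finally show ?thesis .
qed

definition en :: "(real \<Rightarrow> real) \<Rightarrow> (real \<Rightarrow> real) \<Rightarrow> (real \<Rightarrow> real) \<Rightarrow> (real \<Rightarrow> real) \<Rightarrow> real" where
  "en u u' g v = 1 / 2 * ((\<integral>x. (v x)\<^sup>2 \<partial>leb01) + (\<integral>x. a x * (g x)\<^sup>2 \<partial>leb01)) + \<beta> / 2 * (u 1)\<^sup>2 + \<gamma> / 2 * (u' 1)\<^sup>2"

text \<open>The left side is the time derivative of the functional at a state of the domain, written
  without the semigroup: \<open>u\<close> changes at rate \<open>v\<close> and \<open>v\<close> at
  rate \<open>- w\<close>. The bracket after \<open>N1\<close> is the derivative of the
  energy.\<close>

lemma dissipation:
  assumes u: "K2rep u u' g" and v: "K2rep v v' h"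
    and W: "ac W W'" "ac W' w" and Wg: "AE x in leb01. a x * g x = W x"
    and bc: "\<beta> * u 1 - W' 1 + v 1 = 0" "\<gamma> * u' 1 + W 1 + v' 1 = 0"
  shows "- (\<integral>x. w x * mult_fun u u' x \<partial>leb01) + (\<integral>x. v x * mult_fun v v' x \<partial>leb01)
      + (2 - K / 2) * (u' 1 * v' 1)
      + N1 * ((\<integral>x. a x * (g x * h x) \<partial>leb01) - (\<integral>x. w x * v x \<partial>leb01) + \<beta> * u 1 * v 1 + \<gamma> * u' 1 * v' 1)
      \<le> - (\<epsilon>0 - \<delta> * C3_const a \<beta> \<gamma> \<epsilon>0 \<delta>) * en u u' g v"
proof -
  define p where "p = u 1" define q where "q = u' 1"
  define r where "r = v 1" define s where "s = v' 1"
  define V where "V = (\<integral>x. (v x)\<^sup>2 \<partial>leb01)"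
  define e where "e = (\<integral>x. a x * (g x)\<^sup>2 \<partial>leb01)"
  define X1 where "X1 = (\<integral>x. w x * (x * u' x) \<partial>leb01)"
  define X2 where "X2 = (\<integral>x. w x * u x \<partial>leb01)"
  define X3 where "X3 = (\<integral>x. w x * zs p q x \<partial>leb01)"
  define X4 where "X4 = (\<integral>x. v x * zs r s x \<partial>leb01)"
  define S where "S = r\<^sup>2 + s\<^sup>2"
  define G where "G = p\<^sup>2 + q\<^sup>2"
  define E where "E = en u u' g v"
  have V0: "0 \<le> V" unfolding V_def by (rule integral_leb01_nonneg) simp
  have e0: "0 \<le> e" unfolding e_def by (rule bending_energy_nonneg)
  have S0: "0 \<le> S" by (simp add: S_def)
  have E: "E = 1 / 2 * (V + e) + \<beta> / 2 * p\<^sup>2 + \<gamma> / 2 * q\<^sup>2"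
    by (simp add: E_def en_def V_def e_def p_def q_def)
  have "0 \<le> \<beta> * p\<^sup>2" "0 \<le> \<gamma> * q\<^sup>2" using \<beta>_nonneg \<gamma>_nonneg by simp_all
  hence VE: "V \<le> 2 * E" using e0 unfolding E by (simp add: field_simps)
  have W1: "W' 1 = \<beta> * p + r" "W 1 = - (\<gamma> * q + s)" using bc by (auto simp: p_def q_def r_def s_def)
  have x1: "(\<beta> * p + r) * q + (\<gamma> * q + s) * q - (\<gamma> * q + s)\<^sup>2 / (2 * a 1) + (3 - K) / 2 * e \<le> X1"
    using multiplier_x_deriv[OF u W Wg] unfolding W1 q_def[symmetric] X1_def[symmetric] e_def[symmetric] by (simp only: power2_minus mult_minus_left minus_minus diff_minus_eq_add)
  have x2: "X2 = (\<beta> * p + r) * p + (\<gamma> * q + s) * q + e"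
    using multiplier_u[OF u W Wg] unfolding W1 q_def[symmetric] p_def[symmetric] X2_def[symmetric] e_def[symmetric]
    by (simp only: mult_minus_left diff_minus_eq_add)
  \<comment> \<open>Sorting the boundary terms by \<open>p\<close> and \<open>q\<close> makes the
    static boundary conditions appear; they replace the two brackets by \<open>p\<close> and
    \<open>q\<close> themselves, and the sum of squares \<open>G\<close> results.\<close>
  have x3: "X3 = G + r * zs p q 1 + s * zs' p q 1"
  proof -
    have "X3 = (\<beta> * p + r) * zs p q 1 + (\<gamma> * q + s) * zs' p q 1 + q * kap p q - lam p q * p"
      using multiplier_static[OF u W Wg K2rep_zs zs_moment, of p q]
      unfolding W1 q_def[symmetric] p_def[symmetric] X3_def[symmetric]
      by (simp only: mult_minus_left diff_minus_eq_add)
    also have "\<dots> = p * (\<beta> * zs p q 1 - lam p q) + q * (\<gamma> * zs' p q 1 + kap p q) + r * zs p q 1 + s * zs' p q 1"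
      by (simp add: algebra_simps)
    finally show ?thesis unfolding zs_boundary by (simp add: G_def power2_eq_square)
  qed
  \<comment> \<open>Young's inequality with parameter \<open>\<delta>\<close> on the two feedback
    products: \<open>zs_end_le\<close> makes the loss exactly \<open>(1 - Cd) * G\<close>.\<close>
  have zend: "- (r * zs p q 1) - s * zs' p q 1 \<le> S / (4 * \<delta>) + (1 - Cd) * G"
  proof -
    have "- (r * zs p q 1) \<le> \<delta> * (zs p q 1)\<^sup>2 + r\<^sup>2 / (4 * \<delta>)" "- (s * zs' p q 1) \<le> \<delta> * (zs' p q 1)\<^sup>2 + s\<^sup>2 / (4 * \<delta>)"
      using young_le[OF \<delta>(1), of "zs p q 1" "- r"] young_le[OF \<delta>(1), of "zs' p q 1" "- s"] by (simp_all add: mult.commute)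
    moreover have "\<delta> * ((zs p q 1)\<^sup>2 + (zs' p q 1)\<^sup>2) \<le> \<delta> * (max 1 C1 * (Cb + Cg) * Ag * (p\<^sup>2 + q\<^sup>2))"
      using \<delta>(1) zs_end_le[of p q] by (intro mult_left_mono) auto
    moreover have "\<delta> * (max 1 C1 * (Cb + Cg) * Ag * (p\<^sup>2 + q\<^sup>2)) = (1 - Cd) * G"
      by (simp add: G_def Cdelta_const_def)
    moreover have "S / (4 * \<delta>) = r\<^sup>2 / (4 * \<delta>) + s\<^sup>2 / (4 * \<delta>)" by (simp add: S_def add_divide_distrib)
    ultimately show ?thesis by (simp add: distrib_left)
  qed
  \<comment> \<open>The time derivative of the static solution is the static solution with data
    \<open>r\<close>, \<open>s\<close>. Its pairing with \<open>v\<close> costs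
    \<open>\<delta> * V\<close>, which later lowers the rate, and a multiple of the boundary
    dissipation.\<close>
  have x4: "X4 \<le> \<delta> * V + N0 * S / (4 * \<delta>)"
  proof -
    have c: "continuous_on {0..1} v" "continuous_on {0..1} (zs r s)" using K2repD(7) v K2rep_zs by blast+
    have "\<bar>X4\<bar> \<le> \<delta> * V + (\<integral>x. (zs r s x)\<^sup>2 \<partial>leb01) / (4 * \<delta>)"
      unfolding X4_def V_def using c
      by (intro integral_mult_young \<delta> integrable_leb01_continuous continuous_intros
          borel_measurable_leb01_continuous) (auto intro: continuous_on_subset)
    moreover have "(\<integral>x. (zs r s x)\<^sup>2 \<partial>leb01) \<le> N0 * S"
    proof -
      have "(\<integral>x. (zs r s x)\<^sup>2 \<partial>leb01) \<le> 2 * C1 * Ag\<^sup>2 * (C1 * r\<^sup>2 + s\<^sup>2)" by (rule zs_norm_le)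
      also have "\<dots> \<le> 2 * C1 * Ag\<^sup>2 * (max 1 C1 * r\<^sup>2 + max 1 C1 * s\<^sup>2)"
        using C1_ge mult_right_mono[of 1 "max 1 C1" "s\<^sup>2"]
        by (intro mult_left_mono add_mono mult_right_mono) auto
      also have "\<dots> = N0 * S" by (simp add: N0_def S_def algebra_simps)
      finally show ?thesis .
    qed
    hence "(\<integral>x. (zs r s x)\<^sup>2 \<partial>leb01) / (4 * \<delta>) \<le> N0 * S / (4 * \<delta>)"
      using \<delta>(1) by (intro divide_right_mono) auto
    ultimately show ?thesis by linarith
  qed
  have i34: "- X3 + X4 \<le> - Cd * G + \<delta> * V + (1 + N0) * S / (4 * \<delta>)"
    using x3 x4 zend by (simp add: algebra_simps add_divide_distrib)
  have "Qd * (- X3 + X4) \<le> Qd * (- Cd * G + \<delta> * V + (1 + N0) * S / (4 * \<delta>))"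
    by (rule mult_left_mono[OF i34 Qd_nonneg])
  also have "\<dots> = - (Qd * Cd) * G + \<delta> * Qd * V + Qd * ((1 + N0) / (4 * \<delta>)) * S"
    by (simp add: algebra_simps)
  \<comment> \<open>The surviving static gain now equals the boundary terms \<open>Qs * G\<close> of
    the interior estimate, so \<open>G\<close> disappears from the sum.\<close>
  also have "Qd * Cd = Qs" using Cd_pos by (simp add: Qd_def)
  finally have j1: "Qd * (- X3 + X4) \<le> - Qs * G + \<delta> * Qd * V + Qd * ((1 + N0) / (4 * \<delta>)) * S" .
  have j2: "\<delta> * Qd * V \<le> \<delta> * Qd * (2 * E)"
    using VE \<delta>(1) Qd_nonneg by (intro mult_left_mono) auto
  \<comment> \<open>A factor 4 is given away here to match the powers of \<open>1 / \<delta>\<close>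
    in \<open>C5_const\<close>.\<close>
  have j3: "(sg + Qd * ((1 + N0) / (4 * \<delta>))) * S \<le> N1 * S"
  proof (rule mult_right_mono[OF _ S0])
    have "Qd * ((1 + N0) / (4 * \<delta>)) \<le> Qd * ((1 + N0) / \<delta>)"
      using Qd_nonneg N0_nonneg \<delta>(1) by (intro mult_left_mono divide_left_mono) auto
    thus "sg + Qd * ((1 + N0) / (4 * \<delta>)) \<le> N1" unfolding N1_def using C0_nonneg by simp
  qed
  have j4: "- 2 * X1 + (r\<^sup>2 - V) + K / 2 * X2 - K / 2 * V + (2 - K / 2) * (q * s) \<le> - \<epsilon>0 * E + Qs * G + sg * S"
    unfolding E G_def S_def by (rule interior_estimate[OF x1 x2 V0 e0])
  have vx: "(\<integral>x. v x * (x * v' x) \<partial>leb01) = (r\<^sup>2 - V) / 2"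
    using multiplier_velocity[OF v] by (simp add: r_def V_def)
  have vv: "(\<integral>x. v x * v x \<partial>leb01) = V" by (simp add: V_def power2_eq_square)
  have iv: "integrable leb01 v" by (rule integrable_leb01_continuous[OF K2repD(7)[OF v]])
  have m1: "(\<integral>x. w x * mult_fun u u' x \<partial>leb01) = 2 * X1 - K / 2 * X2 + Qd * X3"
    using integral_mult_fun[OF u acD(1)[OF W(2)]] by (simp add: X1_def X2_def X3_def p_def q_def)
  have m2: "(\<integral>x. v x * mult_fun v v' x \<partial>leb01) = (r\<^sup>2 - V) - K / 2 * V + Qd * X4"
    using integral_mult_fun[OF v iv] unfolding vx vv r_def[symmetric] s_def[symmetric] X4_def[symmetric] by simp
  have "(\<integral>x. a x * (g x * h x) \<partial>leb01) - (\<integral>x. w x * v x \<partial>leb01) + \<beta> * u 1 * v 1 + \<gamma> * u' 1 * v' 1 = - S"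
    unfolding energy_identity(1)[OF v W Wg] W1 p_def[symmetric] q_def[symmetric] r_def[symmetric] s_def[symmetric]
    by (simp add: S_def algebra_simps power2_eq_square)
  note eqS = this
  have "- (\<integral>x. w x * mult_fun u u' x \<partial>leb01) + (\<integral>x. v x * mult_fun v v' x \<partial>leb01)
      + (2 - K / 2) * (u' 1 * v' 1)
      + N1 * ((\<integral>x. a x * (g x * h x) \<partial>leb01) - (\<integral>x. w x * v x \<partial>leb01) + \<beta> * u 1 * v 1 + \<gamma> * u' 1 * v' 1)
    = (- 2 * X1 + (r\<^sup>2 - V) + K / 2 * X2 - K / 2 * V + (2 - K / 2) * (q * s)) + Qd * (- X3 + X4) - N1 * S"
    unfolding m1 m2 eqS by (simp add: q_def s_def algebra_simps)
  also have "\<dots> \<le> (- \<epsilon>0 * E + Qs * G + sg * S) + (- Qs * G + \<delta> * Qd * (2 * E) + Qd * ((1 + N0) / (4 * \<delta>)) * S) - N1 * S"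
    using j1 j2 j4 by linarith
  also have "\<dots> = - (\<epsilon>0 - 2 * \<delta> * Qd) * E + (sg + Qd * ((1 + N0) / (4 * \<delta>))) * S - N1 * S"
    by (simp add: algebra_simps)
  also have "\<dots> \<le> - (\<epsilon>0 - 2 * \<delta> * Qd) * E" using j3 by linarith
  finally show ?thesis unfolding C3_eq E_def .
qed

lemma en_nonneg: "0 \<le> en u u' g v"
  unfolding en_def using \<beta>_nonneg \<gamma>_nonneg bending_energy_nonneg[of g] integral_leb01_nonneg[of "\<lambda>x. (v x)\<^sup>2"]
  by (intro add_nonneg_nonneg mult_nonneg_nonneg) auto

lemma boundary_le_en:
  assumes u: "K2rep u u' g"
  shows "(u 1)\<^sup>2 \<le> Cb * en u u' g v" "(u' 1)\<^sup>2 \<le> Cg * en u u' g v"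
    "(u' 1)\<^sup>2 \<le> Cg / 2 * ((\<integral>x. a x * (g x)\<^sup>2 \<partial>leb01) + \<gamma> * (u' 1)\<^sup>2)"
proof -
  define e where "e = (\<integral>x. a x * (g x)\<^sup>2 \<partial>leb01)"
  have e0: "0 \<le> e" unfolding e_def by (rule bending_energy_nonneg)
  have V0: "0 \<le> (\<integral>x. (v x)\<^sup>2 \<partial>leb01)" by (rule integral_leb01_nonneg) simp
  have b0: "0 \<le> \<beta> * (u 1)\<^sup>2" "0 \<le> \<gamma> * (u' 1)\<^sup>2" using \<beta>_nonneg \<gamma>_nonneg by simp_all
  have 1: "(u 1)\<^sup>2 \<le> Cb / 2 * (e + \<beta> * (u 1)\<^sup>2)"
    by (rule Cb_const_bound[OF \<beta>_nonneg _ e0]) (use K2_bound[OF u, of 1] e_def in auto)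
  show 2: "(u' 1)\<^sup>2 \<le> Cg / 2 * ((\<integral>x. a x * (g x)\<^sup>2 \<partial>leb01) + \<gamma> * (u' 1)\<^sup>2)"
    unfolding e_def[symmetric]
    by (rule Cb_const_bound[OF \<gamma>_nonneg _ e0]) (use K2_deriv_bound[OF u, of 1] e_def in auto)
  have "Cb / 2 * (e + \<beta> * (u 1)\<^sup>2) \<le> Cb / 2 * (2 * en u u' g v)"
    using Cb_const_pos[OF \<beta>_nonneg] V0 b0 by (intro mult_left_mono) (auto simp: en_def e_def field_simps)
  thus "(u 1)\<^sup>2 \<le> Cb * en u u' g v" using 1 by simp
  have "Cg / 2 * (e + \<gamma> * (u' 1)\<^sup>2) \<le> Cg / 2 * (2 * en u u' g v)"
    using Cb_const_pos[OF \<gamma>_nonneg] V0 b0 by (intro mult_left_mono) (auto simp: en_def e_def field_simps)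
  thus "(u' 1)\<^sup>2 \<le> Cg * en u u' g v" using 2 unfolding e_def[symmetric] by simp
qed

text \<open>Young's inequality for each of the three parts of the multiplier; \<open>mx\<close>
  bounds the norms of \<open>x u'\<close> and \<open>u\<close> by the energy, and
  \<open>zs_norm_le\<close> handles the static part. The velocity is only an \<open>L^2\<close>
  function here, so the bound holds on the whole state space.\<close>

lemma functional_bound:
  assumes u: "K2rep u u' g" and v: "in_L2 v"
  shows "\<bar>\<integral>x. v x * mult_fun u u' x \<partial>leb01\<bar> \<le> C0 * en u u' g v"
proof -
  note U = K2repD[OF u]
  define q where "q = u' 1"
  define V where "V = (\<integral>x. (v x)\<^sup>2 \<partial>leb01)"
  define e where "e = (\<integral>x. a x * (g x)\<^sup>2 \<partial>leb01)"
  define E where "E = en u u' g v"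
  have V0: "0 \<le> V" unfolding V_def by (rule integral_leb01_nonneg) simp
  have e0: "0 \<le> e" unfolding e_def by (rule bending_energy_nonneg)
  have b0: "0 \<le> \<beta> * (u 1)\<^sup>2" "0 \<le> \<gamma> * q\<^sup>2" using \<beta>_nonneg \<gamma>_nonneg by simp_all
  have E: "E = 1 / 2 * (V + e) + \<beta> / 2 * (u 1)\<^sup>2 + \<gamma> / 2 * q\<^sup>2"
    by (simp add: E_def en_def V_def e_def q_def)
  have VeE: "V + (e + \<gamma> * q\<^sup>2) \<le> 2 * E" using b0 unfolding E by (simp add: field_simps)
  have E0: "0 \<le> E" unfolding E_def by (rule en_nonneg)
  have q2: "q\<^sup>2 \<le> mx / 2 * (e + \<gamma> * q\<^sup>2)"
  proof -
    have "q\<^sup>2 \<le> Cg / 2 * (e + \<gamma> * q\<^sup>2)" using boundary_le_en(3)[OF u] by (simp add: q_def e_def)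
    also have "\<dots> \<le> mx / 2 * (e + \<gamma> * q\<^sup>2)" using mx_ge e0 b0 by (intro mult_right_mono) auto
    finally show ?thesis .
  qed
  have me: "2 / (a 1 * (2 - K)) * e \<le> mx * (e + \<gamma> * q\<^sup>2)"
    using mx_ge e0 b0 by (intro mult_mono) auto
  have n1: "2 * q\<^sup>2 + 2 / (a 1 * (2 - K)) * e \<le> 2 * (mx * (e + \<gamma> * q\<^sup>2))" using q2 me by simp
  have y: "\<bar>\<integral>x. v x * f x \<partial>leb01\<bar> \<le> d * V + (\<integral>x. (f x)\<^sup>2 \<partial>leb01) / (4 * d)" if "continuous_on {0..1} f" "0 < d" for f d
    unfolding V_def
  proof (rule integral_mult_young[OF in_L2D(1)[OF v] _ in_L2D(2)[OF v] _ that(2)])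
    show "f \<in> borel_measurable leb01"
      by (rule borel_measurable_leb01_continuous[OF continuous_on_subset[OF that(1)]]) auto
    show "integrable leb01 (\<lambda>x. (f x)\<^sup>2)"
      by (intro integrable_leb01_continuous continuous_intros that)
  qed
  have k1: "2 * \<bar>\<integral>x. v x * (x * u' x) \<partial>leb01\<bar> \<le> 2 * mx * E"
  proof -
    have "2 * \<bar>\<integral>x. v x * (x * u' x) \<partial>leb01\<bar> \<le> V + (\<integral>x. (x * u' x)\<^sup>2 \<partial>leb01)"
      using y[of "\<lambda>x. x * u' x" "1 / 2"] U(6) by (simp add: continuous_intros)
    also have "(\<integral>x. (x * u' x)\<^sup>2 \<partial>leb01) \<le> 1 / 3 * (2 * q\<^sup>2 + 2 / (a 1 * (2 - K)) * e)"
      using K2_weighted_deriv_norms(2)[OF u] by (simp add: power_mult_distrib q_def e_def)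
    \<comment> \<open>The factor \<open>1 / 3\<close> from the weight \<open>x^2\<close> compensates
      the factor 2 in \<open>n1\<close>.\<close>
    also have "\<dots> \<le> mx * (e + \<gamma> * q\<^sup>2)" 
    proof -
      have "0 \<le> mx * (e + \<gamma> * q\<^sup>2)" using mx_ge(1) e0 b0 by (intro mult_nonneg_nonneg) auto
      moreover have "1 / 3 * t \<le> c" if "0 \<le> c" "t \<le> 2 * c" for t c :: real using that by linarith
      ultimately show ?thesis using n1 by blast
    qed
    also have "V + mx * (e + \<gamma> * q\<^sup>2) \<le> mx * V + mx * (e + \<gamma> * q\<^sup>2)"
      using mult_right_mono[OF mx_ge(1) V0] by simp
    also have "\<dots> = mx * (V + (e + \<gamma> * q\<^sup>2))" by (simp add: distrib_left)
    also have "\<dots> \<le> mx * (2 * E)" using VeE mx_ge by (intro mult_left_mono) auto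
    finally show ?thesis by simp
  qed
  have k2: "\<bar>\<integral>x. v x * u x \<partial>leb01\<bar> \<le> mx * E"
  proof -
    have "\<bar>\<integral>x. v x * u x \<partial>leb01\<bar> \<le> 1 / 2 * V + (\<integral>x. (u x)\<^sup>2 \<partial>leb01) / 2"
      using y[of u "1 / 2"] U(7) by simp
    also have "(\<integral>x. (u x)\<^sup>2 \<partial>leb01) \<le> 1 / 2 * (\<integral>x. (u' x)\<^sup>2 \<partial>leb01)" by (rule K2_norm_le_deriv_norm[OF u])
    also have "(\<integral>x. (u' x)\<^sup>2 \<partial>leb01) \<le> 2 * (mx * (e + \<gamma> * q\<^sup>2))"
      using K2_weighted_deriv_norms(1)[OF u] n1 by (simp add: q_def e_def)
    also have "1 / 2 * V + 1 / 2 * (2 * (mx * (e + \<gamma> * q\<^sup>2))) / 2 \<le> 1 / 2 * (mx * V) + 1 / 2 * (mx * (e + \<gamma> * q\<^sup>2))"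
      using mult_right_mono[OF mx_ge(1) V0] by simp
    also have "\<dots> = mx / 2 * (V + (e + \<gamma> * q\<^sup>2))" by (simp add: distrib_left)
    also have "\<dots> \<le> mx / 2 * (2 * E)" using VeE mx_ge by (intro mult_left_mono) auto
    finally show ?thesis by simp
  qed
  have k3: "\<bar>\<integral>x. v x * zs (u 1) q x \<partial>leb01\<bar> \<le> (1 + C1\<^sup>2 * Ag\<^sup>2 * Cb + C1 * Ag\<^sup>2 * Cg) * E"
  proof -
    have "\<bar>\<integral>x. v x * zs (u 1) q x \<partial>leb01\<bar> \<le> 1 / 2 * V + (\<integral>x. (zs (u 1) q x)\<^sup>2 \<partial>leb01) / 2"
      using y[of "zs (u 1) q" "1 / 2"] K2repD(7)[OF K2rep_zs] by simp
    also have "(\<integral>x. (zs (u 1) q x)\<^sup>2 \<partial>leb01) \<le> 2 * C1 * Ag\<^sup>2 * (C1 * (u 1)\<^sup>2 + q\<^sup>2)" by (rule zs_norm_le)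
    also have "\<dots> \<le> 2 * C1 * Ag\<^sup>2 * (C1 * (Cb * E) + Cg * E)"
      using boundary_le_en(1,2)[OF u] C1_ge Ag_ge_1 unfolding E_def q_def
      by (intro mult_left_mono add_mono) auto
    also have "1 / 2 * V + 2 * C1 * Ag\<^sup>2 * (C1 * (Cb * E) + Cg * E) / 2
        \<le> E + 2 * C1 * Ag\<^sup>2 * (C1 * (Cb * E) + Cg * E) / 2"
      using VeE e0 b0 by simp
    also have "\<dots> = (1 + C1\<^sup>2 * Ag\<^sup>2 * Cb + C1 * Ag\<^sup>2 * Cg) * E" by (simp add: algebra_simps power2_eq_square)
    finally show ?thesis by simp
  qed
  have "\<bar>\<integral>x. v x * mult_fun u u' x \<partial>leb01\<bar> \<le> 2 * \<bar>\<integral>x. v x * (x * u' x) \<partial>leb01\<bar>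
     + K / 2 * \<bar>\<integral>x. v x * u x \<partial>leb01\<bar> + Qd * \<bar>\<integral>x. v x * zs (u 1) q x \<partial>leb01\<bar>"
  proof -
    have "\<bar>2 * x - K / 2 * y + Qd * z\<bar> \<le> 2 * \<bar>x\<bar> + K / 2 * \<bar>y\<bar> + Qd * \<bar>z\<bar>" for x y z
    proof -
      have "\<bar>K / 2 * y\<bar> = K / 2 * \<bar>y\<bar>" "\<bar>Qd * z\<bar> = Qd * \<bar>z\<bar>" using K_pos Qd_nonneg by (simp_all add: abs_mult)
      thus ?thesis by linarith
    qed
    thus ?thesis unfolding integral_mult_fun[OF u in_L2D(3)[OF v]] q_def .
  qed
  also have "\<dots> \<le> 2 * mx * E + K / 2 * (mx * E) + Qd * ((1 + C1\<^sup>2 * Ag\<^sup>2 * Cb + C1 * Ag\<^sup>2 * Cg) * E)"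
    using k1 k2 k3 K_pos Qd_nonneg by (intro add_mono mult_left_mono) auto
  also have "\<dots> = C0 * E" by (simp add: C0_def algebra_simps)
  finally show ?thesis unfolding E_def .
qed

end

section \<open>Quadratic forms on the state space\<close>

lemma fst_lincomb [simp]: "fst (lincomb c P d Q) = (\<lambda>x. c * fst P x + d * fst Q x)"
  and snd_lincomb [simp]: "snd (lincomb c P d Q) = (\<lambda>x. c * snd P x + d * snd Q x)"
  by (simp_all add: lincomb_def)

lemma state_eq_refl [simp]: "state_eq P P"
  by (simp add: state_eq_def)

lemma state_eq_sym: "state_eq P Q \<Longrightarrow> state_eq Q P"
  by (auto simp: state_eq_def elim: eventually_mono)

lemma state_eq_trans: "state_eq P Q \<Longrightarrow> state_eq Q R \<Longrightarrow> state_eq P R"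
  unfolding state_eq_def by (auto elim: eventually_elim2)

lemma state_eq_lincomb:
  assumes "state_eq P P'" "state_eq Q Q'"
  shows "state_eq (lincomb c P d Q) (lincomb c P' d Q')"
proof -
  have "AE x in leb01. snd P x = snd P' x" "AE x in leb01. snd Q x = snd Q' x"
    using assms by (auto simp: state_eq_def)
  hence "AE x in leb01. c * snd P x + d * snd Q x = c * snd P' x + d * snd Q' x"
    by eventually_elim simp
  thus ?thesis using assms by (auto simp: state_eq_def)
qed

lemma in_L2_lincomb:
  assumes "in_L2 f" "in_L2 g"
  shows "in_L2 (\<lambda>x. c * f x + d * g x)"
proof -
  note F = in_L2D[OF assms(1)] and G = in_L2D[OF assms(2)]
  have [measurable]: "f \<in> borel_measurable leb01" "g \<in> borel_measurable leb01" by (rule F G)+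
  have "integrable leb01 (\<lambda>x. c\<^sup>2 * (f x)\<^sup>2 + 2 * c * d * (f x * g x) + d\<^sup>2 * (g x)\<^sup>2)"
    by (intro Bochner_Integration.integrable_add integrable_mult_right F G integrable_mult_L2)
  thus ?thesis by (simp add: in_L2_def power2_sum power_mult_distrib mult_ac add_ac)
qed

lemma in_L2_cong_AE:
  assumes "in_L2 f" "AE x in leb01. f x = g x"
  shows "in_L2 g"
proof -
  note F = in_L2D[OF assms(1)]
  have m: "g \<in> borel_measurable leb01" by (rule borel_measurable_leb01_cong_AE[OF F(1) assms(2)])
  have "AE x in leb01. (f x)\<^sup>2 = (g x)\<^sup>2" using assms(2) by eventually_elim simp
  from integrable_cong_AE[OF _ _ this] show ?thesis using F m by (auto simp: in_L2_def)
qed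

context wd
begin

lemma space_K0D:
  assumes "P \<in> space_K0 a"
  shows "K2rep (fst P) (dx (fst P)) (dxx (fst P))" "in_L2 (snd P)"
  using assms K2rep_K2 by (auto simp: space_K0_def)

lemma space_K0I: "K2rep (fst P) u' g \<Longrightarrow> in_L2 (snd P) \<Longrightarrow> P \<in> space_K0 a"
  using K2rep_imp_K2(1) by (cases P) (auto simp: space_K0_def)

lemma lincomb_space_K0:
  assumes "P \<in> space_K0 a" "Q \<in> space_K0 a"
  shows "lincomb c P d Q \<in> space_K0 a"
  using K2rep_lincomb[OF space_K0D(1)[OF assms(1)] space_K0D(1)[OF assms(2)], of c d]
    in_L2_lincomb[OF space_K0D(2)[OF assms(1)] space_K0D(2)[OF assms(2)], of c d]
  by (auto intro!: space_K0I)

lemma lincomb_dx: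
  assumes "P \<in> space_K0 a" "Q \<in> space_K0 a"
  shows "x \<in> {0..1} \<Longrightarrow> dx (\<lambda>x. c * fst P x + d * fst Q x) x = c * dx (fst P) x + d * dx (fst Q) x"
    and "AE x in leb01. dxx (\<lambda>x. c * fst P x + d * fst Q x) x = c * dxx (fst P) x + d * dxx (fst Q) x"
proof -
  note K = K2rep_lincomb[OF space_K0D(1)[OF assms(1)] space_K0D(1)[OF assms(2)], of c d]
  show "x \<in> {0..1} \<Longrightarrow> dx (\<lambda>x. c * fst P x + d * fst Q x) x = c * dx (fst P) x + d * dx (fst Q) x"
    by (rule K2repD(10)[OF K])
  show "AE x in leb01. dxx (\<lambda>x. c * fst P x + d * fst Q x) x = c * dxx (fst P) x + d * dxx (fst Q) x"
    by (rule K2rep_imp_K2(2)[OF K])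
qed

lemma state_eq_space_K0:
  assumes P: "P \<in> space_K0 a" and eq: "state_eq P Q"
  shows "Q \<in> space_K0 a" "x \<in> {0..1} \<Longrightarrow> dx (fst Q) x = dx (fst P) x"
    "AE x in leb01. dxx (fst Q) x = dxx (fst P) x"
proof -
  have K: "K2rep (fst Q) (dx (fst P)) (dxx (fst P))"
    by (rule K2rep_cong[OF space_K0D(1)[OF P]]) (use eq in \<open>auto simp: state_eq_def\<close>)
  show "Q \<in> space_K0 a"
    by (rule space_K0I[OF K in_L2_cong_AE[OF space_K0D(2)[OF P]]]) (use eq in \<open>auto simp: state_eq_def\<close>)
  show "x \<in> {0..1} \<Longrightarrow> dx (fst Q) x = dx (fst P) x" by (rule K2repD(10)[OF K])
  show "AE x in leb01. dxx (fst Q) x = dxx (fst P) x" by (rule K2rep_imp_K2(2)[OF K])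
qed

lemma integrable_weighted_mult:
  assumes "K2rep u u' g" "K2rep w w' h"
  shows "integrable leb01 (\<lambda>x. a x * (g x * h x))"
proof -
  note U = K2repD[OF assms(1)] and W = K2repD[OF assms(2)]
  have [measurable]: "g \<in> borel_measurable leb01" "h \<in> borel_measurable leb01" by (rule U W)+
  have "integrable leb01 (\<lambda>x. (sqrt (a x) * g x) * (sqrt (a x) * h x))"
  proof (rule integrable_mult_L2)
    show "integrable leb01 (\<lambda>x. (sqrt (a x) * g x)\<^sup>2)"
      using U(5) by (rule Bochner_Integration.integrable_cong[THEN iffD1, rotated 2])
        (auto simp: power_mult_distrib a_pos less_imp_le)
    show "integrable leb01 (\<lambda>x. (sqrt (a x) * h x)\<^sup>2)"
      using W(5) by (rule Bochner_Integration.integrable_cong[THEN iffD1, rotated 2])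
        (auto simp: power_mult_distrib a_pos less_imp_le)
  qed measurable
  thus ?thesis
  proof (rule Bochner_Integration.integrable_cong[THEN iffD1, rotated 2])
    fix x assume "x \<in> space leb01"
    hence "a x = sqrt (a x) * sqrt (a x)" using a_pos[of x] by simp
    hence "a x * (g x * h x) = sqrt (a x) * sqrt (a x) * (g x * h x)" by presburger
    thus "sqrt (a x) * g x * (sqrt (a x) * h x) = a x * (g x * h x)" by (simp only: mult_ac)
  qed simp
qed

end

section \<open>The energy inner product and bounded bilinear forms on representatives of
  states\<close>

context beam
begin

abbreviation "S \<equiv> space_K0 a"
abbreviation "nrm \<equiv> norm_K0 a \<beta> \<gamma>"

definition ip :: "state \<Rightarrow> state \<Rightarrow> real" where
  "ip P Q = (\<integral>x. a x * (dxx (fst P) x * dxx (fst Q) x) \<partial>leb01) + (\<integral>x. snd P x * snd Q x \<partial>leb01)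
     + \<beta> * fst P 1 * fst Q 1 + \<gamma> * dx (fst P) 1 * dx (fst Q) 1"

lemma nrm_eq: "nrm P = sqrt (ip P P)"
  by (simp add: norm_K0_def ip_def power2_eq_square mult.assoc)

lemma ip_nonneg: "0 \<le> ip P P"
  unfolding ip_def using \<beta>_nonneg \<gamma>_nonneg
  by (intro add_nonneg_nonneg integral_leb01_nonneg) (auto simp: a_pos less_imp_le mult.assoc)

lemma nrm_nonneg [simp]: "0 \<le> nrm P"
  by (simp add: nrm_eq ip_nonneg)

lemma nrm_square: "(nrm P)\<^sup>2 = ip P P"
  by (simp add: nrm_eq ip_nonneg)

lemma ip_commute: "ip P Q = ip Q P"
  by (simp add: ip_def mult_ac)

lemma ip_lincomb:
  assumes "P \<in> S" "Q \<in> S" "T \<in> S"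
  shows "ip (lincomb c P d Q) T = c * ip P T + d * ip Q T"
proof -
  note D = space_K0D[OF assms(1)] space_K0D[OF assms(2)] space_K0D[OF assms(3)]
    space_K0D(1)[OF lincomb_space_K0[OF assms(1,2)], of c d]
  have [measurable]: "dxx (fst P) \<in> borel_measurable leb01" "dxx (fst Q) \<in> borel_measurable leb01"
    "dxx (fst T) \<in> borel_measurable leb01"
    "dxx (\<lambda>x. c * fst P x + d * fst Q x) \<in> borel_measurable leb01"
    using D K2repD(9) by auto
  have "(\<integral>x. a x * (dxx (\<lambda>x. c * fst P x + d * fst Q x) x * dxx (fst T) x) \<partial>leb01)
      = (\<integral>x. c * (a x * (dxx (fst P) x * dxx (fst T) x)) + d * (a x * (dxx (fst Q) x * dxx (fst T) x)) \<partial>leb01)"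
  proof (rule integral_cong_AE)
    show "AE x in leb01. a x * (dxx (\<lambda>x. c * fst P x + d * fst Q x) x * dxx (fst T) x)
        = c * (a x * (dxx (fst P) x * dxx (fst T) x)) + d * (a x * (dxx (fst Q) x * dxx (fst T) x))"
      using lincomb_dx(2)[OF assms(1,2), of c d] by eventually_elim (simp add: algebra_simps)
  qed measurable
  also have "\<dots> = c * (\<integral>x. a x * (dxx (fst P) x * dxx (fst T) x) \<partial>leb01)
      + d * (\<integral>x. a x * (dxx (fst Q) x * dxx (fst T) x) \<partial>leb01)"
    using integrable_weighted_mult[OF D(1) D(5)] integrable_weighted_mult[OF D(3) D(5)] by simp
  finally have 1: "(\<integral>x. a x * (dxx (\<lambda>x. c * fst P x + d * fst Q x) x * dxx (fst T) x) \<partial>leb01) = \<dots>" .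
  have "integrable leb01 (\<lambda>x. snd P x * snd T x)" "integrable leb01 (\<lambda>x. snd Q x * snd T x)"
    using D in_L2D by (auto intro!: integrable_mult_L2)
  hence 2: "(\<integral>x. (c * snd P x + d * snd Q x) * snd T x \<partial>leb01)
      = c * (\<integral>x. snd P x * snd T x \<partial>leb01) + d * (\<integral>x. snd Q x * snd T x \<partial>leb01)"
    by (simp add: distrib_right mult.assoc)
  have 3: "dx (\<lambda>x. c * fst P x + d * fst Q x) 1 = c * dx (fst P) 1 + d * dx (fst Q) 1"
    by (rule lincomb_dx(1)[OF assms(1,2)]) simp
  show ?thesis
    unfolding ip_def fst_lincomb snd_lincomb 1 2 3 by (simp add: algebra_simps)
qed

lemma ip_cong:
  assumes "P \<in> S" "state_eq P Q" "T \<in> S"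
  shows "ip Q T = ip P T"
proof -
  note E = state_eq_space_K0[OF assms(1,2)]
  note D = space_K0D[OF assms(1)] space_K0D[OF E(1)] space_K0D[OF assms(3)]
  have [measurable]: "dxx (fst P) \<in> borel_measurable leb01" "dxx (fst Q) \<in> borel_measurable leb01"
    "dxx (fst T) \<in> borel_measurable leb01" "snd P \<in> borel_measurable leb01" "snd Q \<in> borel_measurable leb01"
    "snd T \<in> borel_measurable leb01"
    using D K2repD(9) in_L2D(1) by auto
  have "(\<integral>x. a x * (dxx (fst Q) x * dxx (fst T) x) \<partial>leb01) = (\<integral>x. a x * (dxx (fst P) x * dxx (fst T) x) \<partial>leb01)"
    using E(3) by (intro integral_cong_AE) auto
  moreover have "(\<integral>x. snd Q x * snd T x \<partial>leb01) = (\<integral>x. snd P x * snd T x \<partial>leb01)"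
    using assms(2) by (intro integral_cong_AE) (auto simp: state_eq_def)
  ultimately show ?thesis
    using E(2)[of 1] assms(2) by (simp add: ip_def state_eq_def)
qed

text \<open>States are representatives and not classes, so compatibility with
  \<open>state_eq\<close> is part of the notion and all laws are relative to the state space. The
  quadratic form of the bound is the one that energy estimates give directly;
  \<open>form_bound\<close> converts it into a product bound.\<close>

definition form :: "(state \<Rightarrow> state \<Rightarrow> real) \<Rightarrow> bool" where
  "form b \<longleftrightarrow>
     (\<forall>P\<in>S. \<forall>Q\<in>S. \<forall>T\<in>S. \<forall>c d. b (lincomb c P d Q) T = c * b P T + d * b Q T
        \<and> b T (lincomb c P d Q) = c * b T P + d * b T Q) \<and>
     (\<forall>P\<in>S. \<forall>Q\<in>S. \<forall>T\<in>S. state_eq P Q \<longrightarrow> b Q T = b P T \<and> b T Q = b T P) \<and>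
     (\<exists>C\<ge>0. \<forall>P\<in>S. \<forall>Q\<in>S. \<bar>b P Q\<bar> \<le> C * (ip P P + ip Q Q))"

lemma formI:
  assumes "\<And>P Q T c d. P \<in> S \<Longrightarrow> Q \<in> S \<Longrightarrow> T \<in> S \<Longrightarrow> b (lincomb c P d Q) T = c * b P T + d * b Q T"
    and "\<And>P Q T c d. P \<in> S \<Longrightarrow> Q \<in> S \<Longrightarrow> T \<in> S \<Longrightarrow> b T (lincomb c P d Q) = c * b T P + d * b T Q"
    and "\<And>P Q T. P \<in> S \<Longrightarrow> Q \<in> S \<Longrightarrow> T \<in> S \<Longrightarrow> state_eq P Q \<Longrightarrow> b Q T = b P T"
    and "\<And>P Q T. P \<in> S \<Longrightarrow> Q \<in> S \<Longrightarrow> T \<in> S \<Longrightarrow> state_eq P Q \<Longrightarrow> b T Q = b T P"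
    and "\<exists>C\<ge>0. \<forall>P\<in>S. \<forall>Q\<in>S. \<bar>b P Q\<bar> \<le> C * (ip P P + ip Q Q)"
  shows "form b"
  unfolding form_def using assms(1-4) assms(5) by blast

lemma formD:
  assumes "form b" "P \<in> S" "Q \<in> S" "T \<in> S"
  shows "b (lincomb c P d Q) T = c * b P T + d * b Q T"
    "b T (lincomb c P d Q) = c * b T P + d * b T Q"
    "state_eq P Q \<Longrightarrow> b Q T = b P T" "state_eq P Q \<Longrightarrow> b T Q = b T P"
  using assms unfolding form_def by blast+

lemma form_boundE:
  assumes "form b"
  obtains C where "0 \<le> C" "\<forall>P\<in>S. \<forall>Q\<in>S. \<bar>b P Q\<bar> \<le> C * (ip P P + ip Q Q)"
proof -
  have "\<exists>C\<ge>0. \<forall>P\<in>S. \<forall>Q\<in>S. \<bar>b P Q\<bar> \<le> C * (ip P P + ip Q Q)"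
    using assms unfolding form_def by (elim conjE)
  thus ?thesis using that by blast
qed

lemma form_ip: "form ip"
  unfolding form_def
proof (intro conjI ballI allI impI exI[of _ "1 / 2"])
  fix P Q T :: state and c d assume S: "P \<in> S" "Q \<in> S" "T \<in> S"
  show "ip (lincomb c P d Q) T = c * ip P T + d * ip Q T" by (rule ip_lincomb[OF S])
  thus "ip T (lincomb c P d Q) = c * ip T P + d * ip T Q" by (simp only: ip_commute[of T])
next
  fix P Q T :: state assume S: "P \<in> S" "Q \<in> S" "T \<in> S" "state_eq P Q"
  show "ip Q T = ip P T" by (rule ip_cong[OF S(1,4,3)])
  thus "ip T Q = ip T P" by (simp only: ip_commute[of T])
next
  fix P Q :: state assume S: "P \<in> S" "Q \<in> S"
  have "ip (lincomb 1 P c Q) (lincomb 1 P c Q) = ip P P + 2 * c * ip P Q + c\<^sup>2 * ip Q Q" for c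
  proof -
    have "ip (lincomb 1 P c Q) (lincomb 1 P c Q) = ip P (lincomb 1 P c Q) + c * ip Q (lincomb 1 P c Q)"
      using ip_lincomb[OF S lincomb_space_K0[OF S]] by simp
    also have "\<dots> = ip (lincomb 1 P c Q) P + c * ip (lincomb 1 P c Q) Q"
      by (simp only: ip_commute)
    also have "\<dots> = ip P P + c * ip Q P + c * (ip P Q + c * ip Q Q)"
      using ip_lincomb[OF S S(1)] ip_lincomb[OF S S(2)] by simp
    finally show ?thesis by (simp add: ip_commute[of Q P] algebra_simps power2_eq_square)
  qed
  from this[of 1] this[of "- 1"] show "\<bar>ip P Q\<bar> \<le> 1 / 2 * (ip P P + ip Q Q)"
    using ip_nonneg[of "lincomb 1 P 1 Q"] ip_nonneg[of "lincomb 1 P (- 1) Q"] by simp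
qed auto

lemma form_add:
  assumes "form b" "form b'"
  shows "form (\<lambda>P Q. b P Q + b' P Q)"
proof -
  obtain C C' where C: "0 \<le> C" "\<And>P Q. P \<in> S \<Longrightarrow> Q \<in> S \<Longrightarrow> \<bar>b P Q\<bar> \<le> C * (ip P P + ip Q Q)"
    and C': "0 \<le> C'" "\<And>P Q. P \<in> S \<Longrightarrow> Q \<in> S \<Longrightarrow> \<bar>b' P Q\<bar> \<le> C' * (ip P P + ip Q Q)"
    using form_boundE[OF assms(1)] form_boundE[OF assms(2)] by (metis (no_types, lifting))
  have "\<bar>b P Q + b' P Q\<bar> \<le> (C + C') * (ip P P + ip Q Q)" if "P \<in> S" "Q \<in> S" for P Q
    using C(2)[OF that] C'(2)[OF that] by (simp add: distrib_right)
  hence ex: "\<exists>C\<ge>0. \<forall>P\<in>S. \<forall>Q\<in>S. \<bar>b P Q + b' P Q\<bar> \<le> C * (ip P P + ip Q Q)"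
    using C(1) C'(1) by (intro exI[of _ "C + C'"]) auto
  show ?thesis
  proof (rule formI[OF _ _ _ _ ex])
    fix P Q T :: state and c d assume S: "P \<in> S" "Q \<in> S" "T \<in> S"
    note F = formD[OF assms(1) S] and F' = formD[OF assms(2) S]
    show "b (lincomb c P d Q) T + b' (lincomb c P d Q) T = c * (b P T + b' P T) + d * (b Q T + b' Q T)"
      "b T (lincomb c P d Q) + b' T (lincomb c P d Q) = c * (b T P + b' T P) + d * (b T Q + b' T Q)"
      unfolding F(1,2) F'(1,2) by (simp_all add: algebra_simps)
    assume "state_eq P Q"
    thus "b Q T + b' Q T = b P T + b' P T" "b T Q + b' T Q = b T P + b' T P"
      using F(3,4) F'(3,4) by simp_all
  qed
qed

lemma form_cmult:
  assumes "form b"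
  shows "form (\<lambda>P Q. k * b P Q)"
proof -
  obtain C where C: "0 \<le> C" "\<And>P Q. P \<in> S \<Longrightarrow> Q \<in> S \<Longrightarrow> \<bar>b P Q\<bar> \<le> C * (ip P P + ip Q Q)"
    using form_boundE[OF assms] by metis
  have "\<bar>k * b P Q\<bar> \<le> (\<bar>k\<bar> * C) * (ip P P + ip Q Q)" if "P \<in> S" "Q \<in> S" for P Q
    using mult_left_mono[OF C(2)[OF that], of "\<bar>k\<bar>"] by (simp add: abs_mult mult.assoc)
  hence ex: "\<exists>C\<ge>0. \<forall>P\<in>S. \<forall>Q\<in>S. \<bar>k * b P Q\<bar> \<le> C * (ip P P + ip Q Q)"
    using C(1) by (intro exI[of _ "\<bar>k\<bar> * C"]) auto
  show ?thesis
  proof (rule formI[OF _ _ _ _ ex])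
    fix P Q T :: state and c d assume S: "P \<in> S" "Q \<in> S" "T \<in> S"
    note F = formD[OF assms S]
    show "k * b (lincomb c P d Q) T = c * (k * b P T) + d * (k * b Q T)"
      "k * b T (lincomb c P d Q) = c * (k * b T P) + d * (k * b T Q)"
      unfolding F(1,2) by (simp_all add: algebra_simps)
    assume "state_eq P Q"
    thus "k * b Q T = k * b P T" "k * b T Q = k * b T P" using F(3,4) by simp_all
  qed
qed

text \<open>Scaling \<open>P\<close> by \<open>s\<close> and \<open>Q\<close> by \<open>1 / s\<close> turns the quadratic bound into a product bound.\<close>

lemma form_bound:
  assumes b: "form b"
    and C: "0 \<le> C" "\<forall>P\<in>S. \<forall>Q\<in>S. \<bar>b P Q\<bar> \<le> C * (ip P P + ip Q Q)"
    and P: "P \<in> S" and Q: "Q \<in> S"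
  shows "\<bar>b P Q\<bar> \<le> 2 * C * (nrm P * nrm Q)"
proof -
  have scale: "b (lincomb s P 0 P) (lincomb r Q 0 Q) = s * r * b P Q" for s r
    using formD(1)[OF b P P lincomb_space_K0[OF Q Q], of s 0 r 0] formD(2)[OF b Q Q P, of r 0] by simp
  have ips: "ip (lincomb s P 0 P) (lincomb s P 0 P) = s\<^sup>2 * ip P P" if "P \<in> S" for s P
    using formD(1)[OF form_ip that that lincomb_space_K0[OF that that], of s 0 s 0] formD(2)[OF form_ip that that that, of s 0]
    by (simp add: power2_eq_square)
  define x where "x = nrm P" define y where "y = nrm Q"
  have xy: "0 \<le> x" "0 \<le> y" by (simp_all add: x_def y_def)
  have *: "\<bar>b P Q\<bar> \<le> C * (s\<^sup>2 * x\<^sup>2 + (1 / s)\<^sup>2 * y\<^sup>2)" if "0 < s" for s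
    using C(2)[rule_format, OF lincomb_space_K0[OF P P, of s 0] lincomb_space_K0[OF Q Q, of "1 / s" 0]] that
    unfolding scale ips[OF P] ips[OF Q] x_def y_def nrm_square by simp
  have "\<bar>b P Q\<bar> \<le> 2 * C * (x * y) + e" if e: "0 < e" for e
  proof -
    \<comment> \<open>The shift by \<open>\<eta>\<close> keeps the optimal scaling factor finite and
      positive when one of the norms vanishes; its size is chosen so that the extra error is at most
      \<open>e\<close>.\<close>
    define \<eta> where "\<eta> = e / ((C + 1) * (x + y + 1))"
    have \<eta>: "0 < \<eta>" unfolding \<eta>_def using e C(1) xy by simp
    define s where "s = sqrt ((y + \<eta>) / (x + \<eta>))"
    have s: "0 < s" "s\<^sup>2 = (y + \<eta>) / (x + \<eta>)" "(1 / s)\<^sup>2 = (x + \<eta>) / (y + \<eta>)"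
      using xy \<eta> by (auto simp: s_def power_divide)
    have "s\<^sup>2 * x\<^sup>2 \<le> (y + \<eta>) * x"
    proof -
      have "x\<^sup>2 \<le> x * (x + \<eta>)" using xy \<eta> by (simp add: power2_eq_square distrib_left)
      thus ?thesis unfolding s(2) using xy \<eta> mult_left_mono[of "x\<^sup>2" "x * (x + \<eta>)" "y + \<eta>"] by (simp add: field_simps)
    qed
    moreover have "(1 / s)\<^sup>2 * y\<^sup>2 \<le> (x + \<eta>) * y"
    proof -
      have "y\<^sup>2 \<le> y * (y + \<eta>)" using xy \<eta> by (simp add: power2_eq_square distrib_left)
      thus ?thesis unfolding s(3) using xy \<eta> mult_left_mono[of "y\<^sup>2" "y * (y + \<eta>)" "x + \<eta>"] by (simp add: field_simps)
    qed
    ultimately have "\<bar>b P Q\<bar> \<le> C * ((y + \<eta>) * x + (x + \<eta>) * y)"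
      using *[OF s(1)] mult_left_mono[OF _ C(1)] by (meson add_mono order_trans)
    also have "\<dots> = 2 * C * (x * y) + \<eta> * (C * (x + y))" by (simp add: algebra_simps)
    also have "\<eta> * (C * (x + y)) \<le> \<eta> * ((C + 1) * (x + y + 1))"
      using \<eta> C(1) xy by (intro mult_left_mono mult_mono) auto
    also have "\<dots> = e" unfolding \<eta>_def using C(1) xy by simp
    finally show ?thesis by simp
  qed
  thus ?thesis unfolding x_def y_def by (rule field_le_epsilon)
qed

lemma nrm_lincomb_le:
  assumes P: "P \<in> S" and Q: "Q \<in> S"
  shows "nrm (lincomb 1 P c Q) \<le> nrm P + \<bar>c\<bar> * nrm Q"
proof -
  have CS: "\<bar>ip P Q\<bar> \<le> nrm P * nrm Q"
  proof -
    have "\<forall>P\<in>S. \<forall>Q\<in>S. \<bar>ip P Q\<bar> \<le> 1 / 2 * (ip P P + ip Q Q)"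
    proof (intro ballI)
      fix P Q assume "P \<in> S" "Q \<in> S"
      have "0 \<le> ip P P + 2 * c * ip P Q + ip Q Q" if "c\<^sup>2 = 1" for c
        using ip_nonneg[of "lincomb 1 P c Q"] that
          formD(1)[OF form_ip \<open>P \<in> S\<close> \<open>Q \<in> S\<close> lincomb_space_K0[OF \<open>P \<in> S\<close> \<open>Q \<in> S\<close>], of 1 c 1 c]
          formD(2)[OF form_ip \<open>P \<in> S\<close> \<open>Q \<in> S\<close> \<open>P \<in> S\<close>, of 1 c] formD(2)[OF form_ip \<open>P \<in> S\<close> \<open>Q \<in> S\<close> \<open>Q \<in> S\<close>, of 1 c]
          ip_commute[of Q P]
        by (simp add: algebra_simps power2_eq_square flip: mult.assoc)
      from this[of 1] this[of "- 1"] show "\<bar>ip P Q\<bar> \<le> 1 / 2 * (ip P P + ip Q Q)" by simp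
    qed
    \<comment> \<open>The quadratic bound with constant \<open>1 / 2\<close> becomes Cauchy-Schwarz
      with constant 1.\<close>
    from form_bound[OF form_ip _ this P Q] show ?thesis by simp
  qed
  have "(nrm (lincomb 1 P c Q))\<^sup>2 = ip P P + 2 * (c * ip P Q) + c\<^sup>2 * ip Q Q"
    unfolding nrm_square
    using formD(1)[OF form_ip P Q lincomb_space_K0[OF P Q], of 1 c 1 c]
      formD(2)[OF form_ip P Q P, of 1 c] formD(2)[OF form_ip P Q Q, of 1 c] ip_commute[of Q P]
    by (simp add: algebra_simps power2_eq_square)
  also have "\<dots> \<le> ip P P + 2 * (\<bar>c\<bar> * (nrm P * nrm Q)) + c\<^sup>2 * ip Q Q"
  proof -
    have "c * ip P Q \<le> \<bar>c\<bar> * \<bar>ip P Q\<bar>" using abs_ge_self[of "c * ip P Q"] by (simp add: abs_mult)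
    also have "\<dots> \<le> \<bar>c\<bar> * (nrm P * nrm Q)" by (intro mult_left_mono CS) simp
    finally show ?thesis by simp
  qed
  also have "\<dots> = (nrm P + \<bar>c\<bar> * nrm Q)\<^sup>2"
    by (simp add: power2_sum power_mult_distrib nrm_square)
  finally show ?thesis by (rule power2_le_imp_le) simp
qed

lemma nrm_cong: "P \<in> S \<Longrightarrow> state_eq P Q \<Longrightarrow> nrm Q = nrm P"
proof -
  assume P: "P \<in> S" and e: "state_eq P Q"
  have "Q \<in> S" by (rule state_eq_space_K0(1)[OF P e])
  hence "ip Q Q = ip P Q" "ip P Q = ip P P"
    using formD(3)[OF form_ip P _ _ e] formD(4)[OF form_ip P _ P e] by blast+
  thus ?thesis by (simp add: nrm_eq)
qed

lemma nrm_eq_K2rep: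
  assumes P: "K2rep (fst P) u' g" and v: "in_L2 (snd P)"
  shows "ip P P = (\<integral>x. a x * (g x)\<^sup>2 \<partial>leb01) + (\<integral>x. (snd P x)\<^sup>2 \<partial>leb01) + \<beta> * (fst P 1)\<^sup>2 + \<gamma> * (u' 1)\<^sup>2"
proof -
  have S: "P \<in> S" by (rule space_K0I[OF P v])
  have [measurable]: "g \<in> borel_measurable leb01" "dxx (fst P) \<in> borel_measurable leb01"
    using K2repD(9)[OF P] K2repD(9)[OF space_K0D(1)[OF S]] by auto
  have "(\<integral>x. a x * (dxx (fst P) x * dxx (fst P) x) \<partial>leb01) = (\<integral>x. a x * (g x)\<^sup>2 \<partial>leb01)"
    using K2rep_imp_K2(2)[OF P] by (intro integral_cong_AE) (auto simp: power2_eq_square)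
  thus ?thesis using K2repD(10)[OF P, of 1] by (simp add: ip_def power2_eq_square mult.assoc)
qed

text \<open>Differentiability of the curve in the energy norm carries over to every bounded form by
  the product rule. The derivative is taken within \<open>{0..}\<close>, so that the initial time is
  covered as well.\<close>

lemma form_has_derivative:
  assumes b: "form b" and Y: "\<And>s. 0 \<le> s \<Longrightarrow> Y s \<in> S" and Z: "Z \<in> S" and t: "0 \<le> t"
    and lim: "((\<lambda>s. nrm (lincomb 1 (lincomb (1 / (s - t)) (Y s) (- 1 / (s - t)) (Y t)) (- 1) Z)) \<longlongrightarrow> 0) (at t within {0..})"
  shows "((\<lambda>s. b (Y s) (Y s)) has_real_derivative b Z (Y t) + b (Y t) Z) (at t within {0..})"
proof -
  obtain C where C: "0 \<le> C" "\<forall>P\<in>S. \<forall>Q\<in>S. \<bar>b P Q\<bar> \<le> C * (ip P P + ip Q Q)"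
    by (rule form_boundE[OF b])
  note B = form_bound[OF b C]
  define D where "D = (\<lambda>s. lincomb 1 (lincomb (1 / (s - t)) (Y s) (- 1 / (s - t)) (Y t)) (- 1) Z)"
  have D: "D s \<in> S" if "0 \<le> s" for s unfolding D_def by (intro lincomb_space_K0 Y that t Z)
  note Yt = Y[OF t]
  define F where "F = (\<lambda>s. 2 * C * (nrm (D s) * nrm (Y t)) + 2 * C * (nrm (Y t) * nrm (D s))
      + \<bar>s - t\<bar> * (2 * C * ((nrm Z + nrm (D s)) * (nrm Z + nrm (D s)))))"
  have est: "\<bar>(b (Y s) (Y s) - b (Y t) (Y t)) / (s - t) - (b Z (Y t) + b (Y t) Z)\<bar> \<le> F s"
    if s: "0 \<le> s" "s \<noteq> t" for s
  proof -
    define h where "h = s - t"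
    have h: "h \<noteq> 0" using s by (simp add: h_def)
    define X where "X = lincomb 1 Z 1 (D s)"
    have X: "X \<in> S" unfolding X_def by (intro lincomb_space_K0 Z D s)
    \<comment> \<open>Solving the difference quotient for \<open>Y s\<close> gives
      \<open>Y t + h * (Z + D s)\<close>. After expansion every error term contains
      \<open>D s\<close> or an extra factor \<open>h\<close>.\<close>
    have "Y s = lincomb 1 (Y t) h X"
      using h unfolding X_def D_def h_def[symmetric]
      by (intro prod_eqI ext) (auto simp: field_simps)
    hence "b (Y s) (Y s) = b (lincomb 1 (Y t) h X) (lincomb 1 (Y t) h X)" by simp
    also have "\<dots> = b (Y t) (Y t) + h * (b X (Y t) + b (Y t) X) + h * (h * b X X)"
      using formD(1)[OF b Yt X lincomb_space_K0[OF Yt X], of 1 h 1 h] formD(2)[OF b Yt X Yt, of 1 h] formD(2)[OF b Yt X X, of 1 h]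
      by (simp add: algebra_simps)
    also have "b X (Y t) = b Z (Y t) + b (D s) (Y t)"
      unfolding X_def using formD(1)[OF b Z D[OF s(1)] Yt, of 1 1] by simp
    also have "b (Y t) X = b (Y t) Z + b (Y t) (D s)"
      unfolding X_def using formD(2)[OF b Z D[OF s(1)] Yt, of 1 1] by simp
    finally have "(b (Y s) (Y s) - b (Y t) (Y t)) / h - (b Z (Y t) + b (Y t) Z)
        = b (D s) (Y t) + b (Y t) (D s) + h * b X X"
      using h by (simp add: field_simps)
    hence "\<bar>(b (Y s) (Y s) - b (Y t) (Y t)) / h - (b Z (Y t) + b (Y t) Z)\<bar>
        \<le> \<bar>b (D s) (Y t)\<bar> + \<bar>b (Y t) (D s)\<bar> + \<bar>h\<bar> * \<bar>b X X\<bar>"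
      by (simp only: abs_mult[symmetric])
    also have "\<dots> \<le> F s"
    proof -
      have nX: "nrm X \<le> nrm Z + nrm (D s)"
        unfolding X_def using nrm_lincomb_le[OF Z D[OF s(1)], of 1] by simp
      have "\<bar>b X X\<bar> \<le> 2 * C * (nrm X * nrm X)" by (rule B[OF X X])
      also have "\<dots> \<le> 2 * C * ((nrm Z + nrm (D s)) * (nrm Z + nrm (D s)))"
        using C(1) nX by (intro mult_left_mono mult_mono) auto
      finally have "\<bar>h\<bar> * \<bar>b X X\<bar> \<le> \<bar>h\<bar> * \<dots>" by (intro mult_left_mono) auto
      thus ?thesis
        unfolding F_def h_def[symmetric] using B[OF D[OF s(1)] Yt] B[OF Yt D[OF s(1)]] by linarith
    qed
    finally show ?thesis by (simp only: h_def)
  qed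
  have lD: "((\<lambda>s. nrm (D s)) \<longlongrightarrow> 0) (at t within {0..})" using lim by (simp only: D_def)
  have lt: "((\<lambda>s. \<bar>s - t\<bar>) \<longlongrightarrow> 0) (at t within {0..})"
    by (intro tendsto_rabs_zero) (auto intro!: tendsto_eq_intros)
  have "(F \<longlongrightarrow> 2 * C * (0 * nrm (Y t)) + 2 * C * (nrm (Y t) * 0) + 0 * (2 * C * ((nrm Z + 0) * (nrm Z + 0)))) (at t within {0..})"
    unfolding F_def by (intro tendsto_intros lD lt)
  hence "(F \<longlongrightarrow> 0) (at t within {0..})" by simp
  hence "((\<lambda>s. (b (Y s) (Y s) - b (Y t) (Y t)) / (s - t) - (b Z (Y t) + b (Y t) Z)) \<longlongrightarrow> 0) (at t within {0..})"
    by (rule Lim_null_comparison[rotated]) (use est in \<open>auto simp: eventually_at_filter\<close>)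
  thus ?thesis unfolding has_field_derivative_iff by (subst (asm) LIM_zero_iff)
qed

end

section \<open>The Lyapunov functional along the semigroup\<close>

context wd
begin

lemma dom_calB_space_K0: "p \<in> dom_calB a \<beta> \<gamma> \<Longrightarrow> p \<in> space_K0 a"
  by (auto simp: dom_calB_def dom_B_def space_K0_def in_K2_def in_H1_def)

lemma op_calB_space_K0:
  assumes "p \<in> dom_calB a \<beta> \<gamma>"
  shows "op_calB a p \<in> space_K0 a"
proof -
  have u: "fst p \<in> dom_B a" and v: "in_K2 a (snd p)" using assms by (auto simp: dom_calB_def)
  obtain W W' w where "ac W W'" "ac W' w" "in_L2 w" "AE x in leb01. a x * dxx (fst p) x = W x"
    "cont_rep (bending a (fst p)) 1 = W 1" "dx (cont_rep (bending a (fst p))) 1 = W' 1"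
    and w: "AE x in leb01. op_B a (fst p) x = w x"
    by (rule dom_B_rep[OF u])
  have "in_L2 (\<lambda>x. - 1 * w x + 0 * w x)" by (rule in_L2_lincomb) fact+
  moreover have "AE x in leb01. - 1 * w x + 0 * w x = - op_B a (fst p) x"
    using w by eventually_elim simp
  ultimately have "in_L2 (\<lambda>x. - op_B a (fst p) x)" by (rule in_L2_cong_AE)
  thus ?thesis using v by (simp add: op_calB_def space_K0_def)
qed

end

context beam
begin

definition bq :: "state \<Rightarrow> state \<Rightarrow> real" where
  "bq P Q = dx (fst P) 1 * dx (fst Q) 1"

lemma ip_ge_parts:
  "(\<integral>x. a x * (dxx (fst P) x)\<^sup>2 \<partial>leb01) \<le> ip P P" "(\<integral>x. (snd P x)\<^sup>2 \<partial>leb01) \<le> ip P P"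
  "(\<integral>x. a x * (dxx (fst P) x)\<^sup>2 \<partial>leb01) + \<beta> * (fst P 1)\<^sup>2 + \<gamma> * (dx (fst P) 1)\<^sup>2 \<le> ip P P"
proof -
  have "0 \<le> \<beta> * (fst P 1)\<^sup>2" "0 \<le> \<gamma> * (dx (fst P) 1)\<^sup>2" using \<beta>_nonneg \<gamma>_nonneg by simp_all
  moreover have "0 \<le> (\<integral>x. (snd P x)\<^sup>2 \<partial>leb01)" by (rule integral_leb01_nonneg) simp
  moreover have "ip P P = (\<integral>x. a x * (dxx (fst P) x)\<^sup>2 \<partial>leb01) + (\<integral>x. (snd P x)\<^sup>2 \<partial>leb01)
      + \<beta> * (fst P 1)\<^sup>2 + \<gamma> * (dx (fst P) 1)\<^sup>2"
    by (simp add: ip_def power2_eq_square mult.assoc)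
  ultimately show "(\<integral>x. a x * (dxx (fst P) x)\<^sup>2 \<partial>leb01) \<le> ip P P" "(\<integral>x. (snd P x)\<^sup>2 \<partial>leb01) \<le> ip P P"
    "(\<integral>x. a x * (dxx (fst P) x)\<^sup>2 \<partial>leb01) + \<beta> * (fst P 1)\<^sup>2 + \<gamma> * (dx (fst P) 1)\<^sup>2 \<le> ip P P"
    using bending_energy_nonneg[of "dxx (fst P)"] by linarith+
qed

lemma form_bq: "form bq"
proof (rule formI)
  have "\<bar>bq P Q\<bar> \<le> I * (ip P P + ip Q Q)" if "P \<in> S" "Q \<in> S" for P Q
  proof -
    have d: "(dx (fst P) 1)\<^sup>2 \<le> I * ip P P" if "P \<in> S" for P
    proof -
      have "(dx (fst P) 1)\<^sup>2 \<le> I * (\<integral>x. a x * (dxx (fst P) x)\<^sup>2 \<partial>leb01)"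
        by (rule K2_deriv_bound[OF space_K0D(1)[OF that]]) simp
      also have "\<dots> \<le> I * ip P P" using I_pos by (intro mult_left_mono ip_ge_parts) simp
      finally show ?thesis .
    qed
    have "\<bar>x * y\<bar> \<le> x\<^sup>2 + y\<^sup>2" for x y :: real
    proof -
      have "0 \<le> (\<bar>x\<bar> - \<bar>y\<bar>)\<^sup>2" by simp
      hence "2 * \<bar>x * y\<bar> \<le> x\<^sup>2 + y\<^sup>2" by (simp add: power2_diff abs_mult)
      thus ?thesis by simp
    qed
    from this[of "dx (fst P) 1" "dx (fst Q) 1"] show ?thesis
      using d[OF that(1)] d[OF that(2)] unfolding bq_def distrib_left by linarith
  qed
  thus "\<exists>C\<ge>0. \<forall>P\<in>S. \<forall>Q\<in>S. \<bar>bq P Q\<bar> \<le> C * (ip P P + ip Q Q)"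
    using I_pos by (intro exI[of _ I]) auto
next
  fix P Q T :: state and c d assume S: "P \<in> S" "Q \<in> S"
  have "dx (fst (lincomb c P d Q)) 1 = c * dx (fst P) 1 + d * dx (fst Q) 1"
    unfolding fst_lincomb by (rule lincomb_dx(1)[OF S]) simp
  thus "bq (lincomb c P d Q) T = c * bq P T + d * bq Q T" "bq T (lincomb c P d Q) = c * bq T P + d * bq T Q"
    unfolding bq_def by (simp_all add: algebra_simps)
  assume "state_eq P Q"
  hence "dx (fst Q) 1 = dx (fst P) 1" by (rule state_eq_space_K0(2)[OF S(1)]) simp
  thus "bq Q T = bq P T" "bq T Q = bq T P" by (simp_all add: bq_def)
qed

end

context beam_decay
begin

lemma zs_lin: "zs (c * p + d * p') (c * q + d * q') x = c * zs p q x + d * zs p' q' x"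
  unfolding zs_def kap_def lam_def by (simp add: algebra_simps add_divide_distrib diff_divide_distrib)

definition Mf :: "state \<Rightarrow> real \<Rightarrow> real" where
  "Mf P = mult_fun (fst P) (dx (fst P))"

definition bG :: "state \<Rightarrow> state \<Rightarrow> real" where
  "bG P Q = (\<integral>x. snd P x * Mf Q x \<partial>leb01)"

lemma Mf_lincomb:
  assumes "P \<in> S" "Q \<in> S" "x \<in> {0..1}"
  shows "Mf (lincomb c P d Q) x = c * Mf P x + d * Mf Q x"
proof -
  have 1: "(1::real) \<in> {0..1}" by simp
  show ?thesis
    unfolding Mf_def mult_fun_def fst_lincomb lincomb_dx(1)[OF assms] lincomb_dx(1)[OF assms(1,2) 1] zs_lin
    by (simp add: algebra_simps)
qed

lemma integrable_snd_Mf: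
  assumes "P \<in> S" "Q \<in> S"
  shows "integrable leb01 (\<lambda>x. snd P x * Mf Q x)"
  using integrable_mult_continuous[OF continuous_on_mult_fun[OF space_K0D(1)[OF assms(2)]]
      in_L2D(3)[OF space_K0D(2)[OF assms(1)]]]
  by (simp add: Mf_def mult.commute)

lemma en_le_ip: "en (fst Q) (dx (fst Q)) (dxx (fst Q)) (snd P) \<le> 1 / 2 * (ip P P + ip Q Q)"
  using ip_ge_parts(2)[of P] ip_ge_parts(3)[of Q] unfolding en_def by (simp add: field_simps)

lemma en_eq_ip: "en (fst P) (dx (fst P)) (dxx (fst P)) (snd P) = 1 / 2 * ip P P"
  by (simp add: en_def ip_def power2_eq_square mult.assoc algebra_simps)

lemma form_bG: "form bG"
proof (rule formI)
  fix P Q T :: state and c d assume S: "P \<in> S" "Q \<in> S" "T \<in> S"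
  show "bG (lincomb c P d Q) T = c * bG P T + d * bG Q T"
    unfolding bG_def using integrable_snd_Mf[OF S(1,3)] integrable_snd_Mf[OF S(2,3)]
    by (simp add: distrib_right mult.assoc)
  have "bG T (lincomb c P d Q) = (\<integral>x. c * (snd T x * Mf P x) + d * (snd T x * Mf Q x) \<partial>leb01)"
    unfolding bG_def
    by (rule Bochner_Integration.integral_cong) (auto simp: Mf_lincomb[OF S(1,2)] algebra_simps)
  also have "\<dots> = c * bG T P + d * bG T Q"
    unfolding bG_def using integrable_snd_Mf[OF S(3,1)] integrable_snd_Mf[OF S(3,2)] by simp
  finally show "bG T (lincomb c P d Q) = c * bG T P + d * bG T Q" .
next
  fix P Q T :: state assume S: "P \<in> S" "Q \<in> S" "T \<in> S" "state_eq P Q"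
  show "bG Q T = bG P T"
    unfolding bG_def
  proof (rule integral_cong_AE)
    show "AE x in leb01. snd Q x * Mf T x = snd P x * Mf T x"
      using S(4) by (auto simp: state_eq_def elim: eventually_mono)
  qed (use integrable_snd_Mf S in auto)
  have "Mf Q x = Mf P x" if "x \<in> {0..1}" for x
    using that S(4) state_eq_space_K0(2)[OF S(1,4)] by (simp add: Mf_def mult_fun_def state_eq_def)
  thus "bG T Q = bG T P"
    unfolding bG_def by (intro Bochner_Integration.integral_cong) auto
next
  have "\<bar>bG P Q\<bar> \<le> C0 * (ip P P + ip Q Q)" if "P \<in> S" "Q \<in> S" for P Q
  proof -
    have "\<bar>bG P Q\<bar> \<le> C0 * en (fst Q) (dx (fst Q)) (dxx (fst Q)) (snd P)"
      unfolding bG_def Mf_def by (rule functional_bound[OF space_K0D(1)[OF that(2)] space_K0D(2)[OF that(1)]])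
    also have "\<dots> \<le> C0 * (1 / 2 * (ip P P + ip Q Q))" by (rule mult_left_mono[OF en_le_ip C0_nonneg])
    also have "\<dots> \<le> C0 * (ip P P + ip Q Q)"
      using ip_nonneg[of P] ip_nonneg[of Q] by (intro mult_left_mono C0_nonneg) simp
    finally show ?thesis .
  qed
  thus "\<exists>C\<ge>0. \<forall>P\<in>S. \<forall>Q\<in>S. \<bar>bG P Q\<bar> \<le> C * (ip P P + ip Q Q)"
    using C0_nonneg by blast
qed

text \<open>The Lyapunov functional is the diagonal of this form. There \<open>1 / 2 * ip\<close> is
  the energy, and half of \<open>2 - K / 2\<close> in front of \<open>u'(1)^2\<close> makes the
  derivative produce \<open>(2 - K / 2) * u'(1) * v'(1)\<close>. Because \<open>bG\<close> is not
  symmetric, derivatives involve both orders of the arguments.\<close>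

definition psi :: "state \<Rightarrow> state \<Rightarrow> real" where
  "psi P Q = bG P Q + ((2 - K / 2) / 2 * bq P Q + N1 / 2 * ip P Q)"

lemma form_psi: "form psi"
  unfolding psi_def[abs_def] by (intro form_add form_cmult form_bG form_bq form_ip)

abbreviation "C4 \<equiv> C4_const a \<beta> \<gamma> \<epsilon>0 \<delta>"
abbreviation "rate \<equiv> \<epsilon>0 - \<delta> * C3_const a \<beta> \<gamma> \<epsilon>0 \<delta>"

lemma C0_le_N1: "C0 \<le> N1"
  unfolding N1_def using Qd_nonneg N0_nonneg \<delta>(1) sg_ge(1) K_pos by simp

lemma C4_pos: "0 < C4"
proof -
  have "0 < sg" using sg_ge(1) K_pos by simp
  moreover have "0 \<le> (2 - K / 2) * (Cg / 2)" using K_less_1 Cb_const_pos[OF \<gamma>_nonneg] by simp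
  moreover have "0 \<le> Qd * ((1 + N0) / \<delta>)" using Qd_nonneg N0_nonneg \<delta>(1) by simp
  ultimately show ?thesis unfolding C4_eq using C0_nonneg by linarith
qed

text \<open>\<open>C0 \<le> N1\<close> lets the energy term dominate \<open>bG\<close>, whose sign
  is not known. The term in \<open>u'(1)^2\<close> is nonnegative and at most a multiple of the
  energy.\<close>

lemma psi_bounds:
  assumes "P \<in> S"
  shows "0 \<le> psi P P" "psi P P \<le> C4 * (1 / 2 * ip P P)"
proof -
  define e where "e = 1 / 2 * ip P P"
  have e0: "0 \<le> e" using ip_nonneg[of P] by (simp add: e_def)
  have b: "\<bar>bG P P\<bar> \<le> C0 * e"
    unfolding bG_def Mf_def e_def en_eq_ip[symmetric]
    by (rule functional_bound[OF space_K0D[OF assms]])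
  have q: "0 \<le> bq P P" "bq P P \<le> Cg * e"
    using boundary_le_en(2)[OF space_K0D(1)[OF assms], of "snd P"] unfolding e_def en_eq_ip[symmetric]
    by (simp_all add: bq_def power2_eq_square)
  have psi: "psi P P = bG P P + (2 - K / 2) / 2 * bq P P + N1 * e" by (simp add: psi_def e_def)
  have "C0 * e \<le> N1 * e" by (rule mult_right_mono[OF C0_le_N1 e0])
  moreover have "0 \<le> (2 - K / 2) / 2 * bq P P" using K_less_1 q by simp
  ultimately show "0 \<le> psi P P" unfolding psi using b by linarith
  have "(2 - K / 2) / 2 * bq P P \<le> (2 - K / 2) / 2 * (Cg * e)"
    using K_less_1 q by (intro mult_left_mono) auto
  hence "psi P P \<le> C0 * e + (2 - K / 2) / 2 * (Cg * e) + N1 * e" unfolding psi using b by linarith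
  also have "(2 - K / 2) / 2 * (Cg * e) = ((2 - K / 2) * (Cg / 2)) * e" by simp
  also have "C0 * e + (2 - K / 2) * (Cg / 2) * e + N1 * e = C4 * e"
    unfolding C4_eq N1_def by (simp only: distrib_right mult_2)
  finally show "psi P P \<le> C4 * (1 / 2 * ip P P)" unfolding e_def .
qed

lemma psi_dissipation:
  assumes p: "p \<in> dom_calB a \<beta> \<gamma>"
  shows "psi (op_calB a p) p + psi p (op_calB a p) \<le> - rate * (1 / 2 * ip p p)"
proof -
  have S: "p \<in> S" "op_calB a p \<in> S" by (rule dom_calB_space_K0[OF p], rule op_calB_space_K0[OF p])
  define u where "u = fst p" define v where "v = snd p"
  have u: "u \<in> dom_B a" and v: "in_K2 a v"
    and bc: "\<beta> * u 1 - dx (cont_rep (bending a u)) 1 + v 1 = 0"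
      "\<gamma> * dx u 1 + cont_rep (bending a u) 1 + dx v 1 = 0"
    using p by (auto simp: dom_calB_def u_def v_def)
  obtain W W' w where W: "ac W W'" "ac W' w" "in_L2 w" "AE x in leb01. a x * dxx u x = W x"
    "cont_rep (bending a u) 1 = W 1" "dx (cont_rep (bending a u)) 1 = W' 1"
    and w: "AE x in leb01. op_B a u x = w x"
    by (rule dom_B_rep[OF u])
  have op: "fst (op_calB a p) = v" "snd (op_calB a p) = (\<lambda>x. - op_B a u x)"
    by (simp_all add: op_calB_def u_def v_def)
  have Ku: "K2rep u (dx u) (dxx u)" using space_K0D(1)[OF S(1)] by (simp add: u_def)
  have Kv: "K2rep v (dx v) (dxx v)" by (rule K2rep_K2[OF v])
  have mop: "op_B a u \<in> borel_measurable leb01" and mw: "w \<in> borel_measurable leb01"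
    using in_L2D(1)[OF space_K0D(2)[OF S(2)]] in_L2D(1)[OF W(3)] unfolding op
    by (auto dest: borel_measurable_uminus)
  have int: "(\<integral>x. - op_B a u x * f x \<partial>leb01) = - (\<integral>x. w x * f x \<partial>leb01)"
    if "continuous_on {0..1} f" for f
  proof -
    have [measurable]: "f \<in> borel_measurable leb01"
      by (rule borel_measurable_leb01_continuous[OF continuous_on_subset[OF that]]) auto
    have "(\<integral>x. - op_B a u x * f x \<partial>leb01) = (\<integral>x. - (w x * f x) \<partial>leb01)"
      using mop mw w by (intro integral_cong_AE) auto
    thus ?thesis by simp
  qed
  have 1: "bG (op_calB a p) p = - (\<integral>x. w x * mult_fun u (dx u) x \<partial>leb01)"
    unfolding bG_def op Mf_def u_def[symmetric] by (rule int[OF continuous_on_mult_fun[OF Ku]])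
  have 2: "bG p (op_calB a p) = (\<integral>x. v x * mult_fun v (dx v) x \<partial>leb01)"
    unfolding bG_def op Mf_def v_def ..
  have 3: "bq (op_calB a p) p = dx u 1 * dx v 1" "bq p (op_calB a p) = dx u 1 * dx v 1"
    unfolding bq_def op u_def[symmetric] by simp_all
  have 4: "ip p (op_calB a p) = (\<integral>x. a x * (dxx u x * dxx v x) \<partial>leb01) - (\<integral>x. w x * v x \<partial>leb01)
      + \<beta> * u 1 * v 1 + \<gamma> * dx u 1 * dx v 1"
    using int[OF K2repD(7)[OF Kv]] unfolding ip_def op u_def[symmetric] v_def[symmetric]
    by (simp add: mult.commute)
  have "psi (op_calB a p) p + psi p (op_calB a p)
     = - (\<integral>x. w x * mult_fun u (dx u) x \<partial>leb01) + (\<integral>x. v x * mult_fun v (dx v) x \<partial>leb01)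
      + (2 - K / 2) * (dx u 1 * dx v 1) + N1 * ip p (op_calB a p)"
    unfolding psi_def 1 2 3 ip_commute[of "op_calB a p" p] by (simp add: field_simps)
  also have "\<dots> \<le> - rate * en u (dx u) (dxx u) v"
    unfolding 4 by (rule dissipation[OF Ku Kv W(1,2,4)]) (use bc W(5,6) in auto)
  also have "en u (dx u) (dxx u) v = 1 / 2 * ip p p"
    unfolding u_def v_def by (rule en_eq_ip)
  finally show ?thesis .
qed

end

section \<open>Differentiability of orbits that start in the domain of the generator\<close>

locale beam_semigroup = beam +
  fixes R :: "real \<Rightarrow> state \<Rightarrow> state"
  assumes cs: "contraction_semigroup a \<beta> \<gamma> R" and gen: "generated_by_calB a \<beta> \<gamma> R"
begin

lemma R_mem: "0 \<le> t \<Longrightarrow> p \<in> S \<Longrightarrow> R t p \<in> S"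
  and R_lin: "0 \<le> t \<Longrightarrow> p \<in> S \<Longrightarrow> q \<in> S \<Longrightarrow> state_eq (R t (lincomb c p d q)) (lincomb c (R t p) d (R t q))"
  and R_le: "0 \<le> t \<Longrightarrow> p \<in> S \<Longrightarrow> nrm (R t p) \<le> nrm p"
  and R_0: "p \<in> S \<Longrightarrow> state_eq (R 0 p) p"
  and R_add: "0 \<le> s \<Longrightarrow> 0 \<le> t \<Longrightarrow> p \<in> S \<Longrightarrow> state_eq (R (s + t) p) (R s (R t p))"
  and R_cont: "p \<in> S \<Longrightarrow> ((\<lambda>t. nrm (lincomb 1 (R t p) (- 1) p)) \<longlongrightarrow> 0) (at_right 0)"
  using cs unfolding contraction_semigroup_def by blast+

abbreviation quot :: "real \<Rightarrow> state \<Rightarrow> state \<Rightarrow> state \<Rightarrow> state" where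
  "quot h P P' Q \<equiv> lincomb 1 (lincomb (1 / h) P (- 1 / h) P') (- 1) Q"

lemma quot_mem: "P \<in> S \<Longrightarrow> P' \<in> S \<Longrightarrow> Q \<in> S \<Longrightarrow> quot h P P' Q \<in> S"
  by (intro lincomb_space_K0)

lemma quot_cong: "state_eq P1 P2 \<Longrightarrow> state_eq P1' P2' \<Longrightarrow> state_eq Q1 Q2 \<Longrightarrow> state_eq (quot h P1 P1' Q1) (quot h P2 P2' Q2)"
  by (intro state_eq_lincomb)

lemma R_quot:
  assumes "0 \<le> t" "P \<in> S" "P' \<in> S" "Q \<in> S"
  shows "state_eq (R t (quot h P P' Q)) (quot h (R t P) (R t P') (R t Q))"
  by (rule state_eq_trans[OF R_lin[OF assms(1) lincomb_space_K0[OF assms(2,3)] assms(4)]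
      state_eq_lincomb[OF R_lin[OF assms(1-3)] state_eq_refl]])

text \<open>\<open>R t\<close> commutes with difference quotients, modulo \<open>state_eq\<close>,
  and is a contraction; convergence at time 0 therefore yields convergence at every time from the
  right.\<close>

lemma quot_step_le:
  assumes t: "0 \<le> t" and h: "0 < h" and p: "p \<in> S" and q: "q \<in> S"
  shows "nrm (quot h (R (t + h) p) (R t p) (R t q)) \<le> nrm (quot h (R h p) p q)"
proof -
  have Rh: "R h p \<in> S" using R_mem[OF _ p] h by simp
  have m: "quot h (R h p) p q \<in> S" by (rule quot_mem[OF Rh p q])
  have "state_eq (R t (quot h (R h p) p q)) (quot h (R t (R h p)) (R t p) (R t q))"
    by (rule R_quot[OF t Rh p q])
  moreover have "state_eq (quot h (R t (R h p)) (R t p) (R t q)) (quot h (R (t + h) p) (R t p) (R t q))"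
    using R_add[OF t _ p, of h] h by (intro quot_cong state_eq_sym[of "R (t + h) p"] state_eq_refl) auto
  ultimately have "nrm (quot h (R (t + h) p) (R t p) (R t q)) = nrm (R t (quot h (R h p) p q))"
    by (intro nrm_cong[OF R_mem[OF t m]]) (rule state_eq_trans)
  thus ?thesis using R_le[OF t m] by simp
qed

lemma generator_limit:
  assumes p: "p \<in> dom_calB a \<beta> \<gamma>"
  shows "((\<lambda>h. nrm (quot h (R h p) p (op_calB a p))) \<longlongrightarrow> 0) (at_right 0)"
  using gen p dom_calB_space_K0[OF p] op_calB_space_K0[OF p] state_eq_refl
  unfolding generated_by_calB_def by blast

text \<open>The generator controls only right difference quotients. For the left ones the orbit is
  restarted at the earlier time \<open>s\<close>, which replaces \<open>R t q\<close> by
  \<open>R s q\<close>; the resulting error is controlled by strong continuity at 0. The function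
  \<open>G\<close> collects both errors.\<close>

lemma quot_limit:
  assumes p: "p \<in> dom_calB a \<beta> \<gamma>" and t: "0 \<le> t"
  shows "((\<lambda>s. nrm (quot (s - t) (R s p) (R t p) (R t (op_calB a p)))) \<longlongrightarrow> 0) (at t within {0..})"
proof -
  define q where "q = op_calB a p"
  have pS: "p \<in> S" and qS: "q \<in> S" unfolding q_def by (rule dom_calB_space_K0[OF p], rule op_calB_space_K0[OF p])
  define G where "G = (\<lambda>h. nrm (quot h (R h p) p q) + nrm (lincomb 1 (R h q) (- 1) q))"
  have "(G \<longlongrightarrow> 0 + 0) (at_right 0)"
    unfolding G_def q_def by (intro tendsto_add generator_limit[OF p] R_cont op_calB_space_K0[OF p])
  hence G: "(G \<longlongrightarrow> 0) (at_right 0)" by simp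
  have "filterlim (\<lambda>s. \<bar>s - t\<bar>) (at_right 0) (at t within {0..})"
    unfolding filterlim_at
  proof
    show "((\<lambda>s. \<bar>s - t\<bar>) \<longlongrightarrow> 0) (at t within {0..})"
      by (intro tendsto_rabs_zero) (auto intro!: tendsto_eq_intros)
  qed (auto simp: eventually_at_filter)
  from filterlim_compose[OF G this] have lim: "((\<lambda>s. G \<bar>s - t\<bar>) \<longlongrightarrow> 0) (at t within {0..})" .
  have est: "nrm (quot (s - t) (R s p) (R t p) (R t q)) \<le> G \<bar>s - t\<bar>" if s: "0 \<le> s" "s \<noteq> t" for s
  proof (cases "t < s")
    case True
    thus ?thesis using quot_step_le[OF t _ pS qS, of "s - t"] by (simp add: G_def add_increasing2)
  next
    case False
    define h where "h = t - s"
    have h: "0 < h" "t = s + h" using False s by (auto simp: h_def)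
    have Rh: "R h q \<in> S" using R_mem[OF _ qS] h by simp
    define X where "X = quot h (R (s + h) p) (R s p) (R s q)"
    define Y where "Y = R s (lincomb 1 (R h q) (- 1) q)"
    have XS: "X \<in> S" unfolding X_def using h s by (intro quot_mem R_mem pS qS) auto
    have dS: "lincomb 1 (R h q) (- 1) q \<in> S" by (rule lincomb_space_K0[OF Rh qS])
    have YS: "Y \<in> S" unfolding Y_def by (rule R_mem[OF s(1) dS])
    have "state_eq Y (lincomb 1 (R s (R h q)) (- 1) (R s q))"
      unfolding Y_def by (rule R_lin[OF s(1) Rh qS])
    moreover have "state_eq (lincomb 1 (R s (R h q)) (- 1) (R s q)) (lincomb 1 (R t q) (- 1) (R s q))"
      using R_add[OF s(1) _ qS, of h] h by (intro state_eq_lincomb state_eq_refl) (auto intro: state_eq_sym)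
    ultimately have Y: "state_eq Y (lincomb 1 (R t q) (- 1) (R s q))" by (rule state_eq_trans)
    \<comment> \<open>The left quotient with limit candidate \<open>R t q\<close> is the right
      quotient at \<open>s\<close> with candidate \<open>R s q\<close>, minus the difference of the
      two candidates.\<close>
    have "lincomb 1 X (- 1) (lincomb 1 (R t q) (- 1) (R s q)) = quot (s - t) (R s p) (R t p) (R t q)"
      using h unfolding X_def h(2)[symmetric] by (intro prod_eqI ext) (auto simp: field_simps h_def)
    with state_eq_lincomb[OF state_eq_refl[of X] Y, of 1 "- 1"]
    have "state_eq (lincomb 1 X (- 1) Y) (quot (s - t) (R s p) (R t p) (R t q))" by simp
    from nrm_cong[OF lincomb_space_K0[OF XS YS] this]
    have "nrm (quot (s - t) (R s p) (R t p) (R t q)) = nrm (lincomb 1 X (- 1) Y)" .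
    also have "\<dots> \<le> nrm X + \<bar>- 1\<bar> * nrm Y" by (rule nrm_lincomb_le[OF XS YS])
    also have "\<dots> = nrm X + nrm Y" by simp
    also have "nrm X \<le> nrm (quot h (R h p) p q)" unfolding X_def by (rule quot_step_le[OF s(1) h(1) pS qS])
    also have "nrm Y \<le> nrm (lincomb 1 (R h q) (- 1) q)" unfolding Y_def by (rule R_le[OF s(1) dS])
    finally show ?thesis using h by (simp add: G_def)
  qed
  show ?thesis
    unfolding q_def[symmetric]
    by (rule Lim_null_comparison[OF _ lim]) (use est in \<open>auto simp: eventually_at_filter\<close>)
qed

text \<open>The domain is invariant, and the generator commutes with the semigroup. The graph of the
  generator is described only modulo \<open>state_eq\<close>, hence the representative
  \<open>p'\<close>.\<close>

lemma R_dom: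
  assumes p: "p \<in> dom_calB a \<beta> \<gamma>" and t: "0 \<le> t"
  obtains p' where "p' \<in> dom_calB a \<beta> \<gamma>" "state_eq p' (R t p)" "state_eq (op_calB a p') (R t (op_calB a p))"
proof -
  have pS: "p \<in> S" and qS: "op_calB a p \<in> S" by (rule dom_calB_space_K0[OF p], rule op_calB_space_K0[OF p])
  have RS: "R t p \<in> S" "R t (op_calB a p) \<in> S" by (rule R_mem[OF t pS], rule R_mem[OF t qS])
  have "((\<lambda>h. nrm (quot h (R h (R t p)) (R t p) (R t (op_calB a p)))) \<longlongrightarrow> 0) (at_right 0)"
  proof (rule Lim_null_comparison[OF _ generator_limit[OF p]])
    show "eventually (\<lambda>h. norm (nrm (quot h (R h (R t p)) (R t p) (R t (op_calB a p))))
        \<le> nrm (quot h (R h p) p (op_calB a p))) (at_right 0)"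
      unfolding eventually_at_filter
    proof (intro always_eventually allI impI)
      fix h :: real assume "h \<in> {0<..}"
      hence h: "0 < h" by simp
      have "state_eq (quot h (R (t + h) p) (R t p) (R t (op_calB a p))) (quot h (R h (R t p)) (R t p) (R t (op_calB a p)))"
        using R_add[OF _ t pS, of h] h by (intro quot_cong state_eq_refl) (simp add: add.commute)
      from nrm_cong[OF quot_mem[OF R_mem[OF _ pS] RS] this]
      have "nrm (quot h (R h (R t p)) (R t p) (R t (op_calB a p))) = nrm (quot h (R (t + h) p) (R t p) (R t (op_calB a p)))"
        using t h by simp
      thus "norm (nrm (quot h (R h (R t p)) (R t p) (R t (op_calB a p)))) \<le> nrm (quot h (R h p) p (op_calB a p))"
        using quot_step_le[OF t h pS qS] by simp
    qed
  qed
  hence "\<exists>p'\<in>dom_calB a \<beta> \<gamma>. state_eq p' (R t p) \<and> state_eq (op_calB a p') (R t (op_calB a p))"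
    using gen RS unfolding generated_by_calB_def by blast
  thus thesis using that by blast
qed

end

section \<open>Density of the domain and exponential decay\<close>

lemma in_L2_continuous_on:
  assumes "continuous_on {0..1} f"
  shows "in_L2 f"
  unfolding in_L2_def
proof
  show "f \<in> borel_measurable leb01"
    by (rule borel_measurable_leb01_continuous[OF continuous_on_subset[OF assms]]) auto
  show "integrable leb01 (\<lambda>x. (f x)\<^sup>2)"
    by (intro integrable_leb01_continuous continuous_intros assms)
qed

lemma ac_polynomial:
  assumes "real_polynomial_function p"
  obtains p' where "real_polynomial_function p'" "\<And>x. (p has_real_derivative p' x) (at x)" "ac p p'"
proof -
  obtain p' where p': "real_polynomial_function p'" "\<And>x. (p has_real_derivative p' x) (at x)"
    using has_real_derivative_polynomial_function[OF assms] by blast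
  moreover have "ac p p'"
    by (intro ac_derivative continuous_on_real_polynomial_function p' has_field_derivative_at_within)
  ultimately show thesis by (rule that)
qed

lemma in_H2_AE_polynomial:
  assumes p: "real_polynomial_function p" and b: "AE x in leb01. b x = p x"
  shows "in_H2 b"
proof -
  obtain p' where p': "real_polynomial_function p'" "ac p p'" by (rule ac_polynomial[OF p]) blast
  obtain p'' where p'': "real_polynomial_function p''" "ac p' p''" by (rule ac_polynomial[OF p'(1)]) blast
  have b': "AE x in leb01. p x = b x" using b by (auto elim: eventually_mono)
  have "in_L2 p" "in_L2 p'" "in_L2 p''"
    by (intro in_L2_continuous_on continuous_on_real_polynomial_function p p' p'')+
  moreover have "in_L2 b" using in_L2_cong_AE[OF _ b'] \<open>in_L2 p\<close> by blast
  moreover have "has_weak_deriv p' p''" by (rule has_weak_deriv_ac[OF p''(2)])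
  moreover have "has_weak_deriv b p'"
    by (rule has_weak_deriv_cong_AE[OF has_weak_deriv_ac[OF p'(2)] b']) simp
  ultimately show ?thesis by (auto simp: in_H2_def in_H1_def)
qed

text \<open>The function \<open>x ^ n * (1 + n * (1 - x))\<close> has value \<open>1\<close> and derivative \<open>0\<close> at \<open>1\<close>, the function
  \<open>x ^ n * (x - 1)\<close> has value \<open>0\<close> and derivative \<open>1\<close>; both tend to \<open>0\<close> in \<open>L\<^sup>2\<close>, so that
  boundary values can be prescribed at no cost.\<close>

definition corr :: "real \<Rightarrow> real \<Rightarrow> nat \<Rightarrow> real \<Rightarrow> real" where
  "corr \<alpha> \<kappa> n x = \<alpha> * (x ^ n * (1 + real n * (1 - x))) + \<kappa> * (x ^ n * (x - 1))"

text \<open>The first building block decreases in \<open>n\<close> from the value 1: consecutive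
  members differ by \<open>(n + 1) * x ^ n * (1 - x)^2\<close>. The uniform bound permits dominated
  convergence.\<close>

lemma corr_bound:
  assumes "0 < x" "x < 1"
  shows "\<bar>corr \<alpha> \<kappa> n x\<bar> \<le> \<bar>\<alpha>\<bar> + \<bar>\<kappa>\<bar>"
proof -
  have 1: "x ^ n * (1 + real n * (1 - x)) \<le> 1"
  proof (induction n)
    case (Suc n)
    have "x ^ Suc n * (1 + real (Suc n) * (1 - x))
        = x ^ n * (1 + real n * (1 - x)) - real (Suc n) * (x ^ n * (1 - x)\<^sup>2)"
      by (simp add: algebra_simps power2_eq_square)
    also have "\<dots> \<le> x ^ n * (1 + real n * (1 - x))" using assms by simp
    also have "\<dots> \<le> 1" by (rule Suc)
    finally show ?case .
  qed simp
  have 2: "0 \<le> x ^ n * (1 + real n * (1 - x))" using assms by simp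
  have "\<bar>x ^ n * (x - 1)\<bar> = x ^ n * (1 - x)" using assms by (simp add: abs_mult)
  also have "\<dots> \<le> 1 * 1" using assms by (intro mult_mono power_le_one) auto
  finally have 3: "\<bar>x ^ n * (x - 1)\<bar> \<le> 1" by simp
  have "\<bar>corr \<alpha> \<kappa> n x\<bar> \<le> \<bar>\<alpha>\<bar> * \<bar>x ^ n * (1 + real n * (1 - x))\<bar> + \<bar>\<kappa>\<bar> * \<bar>x ^ n * (x - 1)\<bar>"
    unfolding corr_def abs_mult[symmetric] by (rule abs_triangle_ineq)
  also have "\<dots> \<le> \<bar>\<alpha>\<bar> * 1 + \<bar>\<kappa>\<bar> * 1"
    using 1 2 3 by (intro add_mono mult_left_mono) auto
  finally show ?thesis by simp
qed

lemma corr_tendsto: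
  assumes "0 < x" "x < 1"
  shows "(\<lambda>n. corr \<alpha> \<kappa> n x) \<longlonglongrightarrow> 0"
proof -
  have 1: "(\<lambda>n. x ^ n) \<longlonglongrightarrow> 0" using assms by (intro LIMSEQ_power_zero) auto
  have 2: "(\<lambda>n. real n * x ^ n) \<longlonglongrightarrow> 0" using assms powser_times_n_limit_0[of x] by simp
  have "(\<lambda>n. \<alpha> * (x ^ n + (1 - x) * (real n * x ^ n)) + \<kappa> * (x ^ n * (x - 1))) \<longlonglongrightarrow>
      \<alpha> * (0 + (1 - x) * 0) + \<kappa> * (0 * (x - 1))"
    by (intro tendsto_intros 1 2)
  thus ?thesis by (simp add: corr_def algebra_simps)
qed

lemma real_polynomial_function_corr: "real_polynomial_function (corr \<alpha> \<kappa> n)"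
proof -
  have id: "real_polynomial_function (\<lambda>x::real. x)"
    by (rule real_polynomial_function.intros(1)) (rule bounded_linear_ident)
  show ?thesis
    unfolding corr_def[abs_def]
    by (intro real_polynomial_function.intros(3) real_polynomial_function.intros(4) real_polynomial_function.intros(2)
        real_polynomial_function_power real_polynomial_function_diff id)
qed

lemma corr_at_1: "corr \<alpha> \<kappa> n 1 = \<alpha>" "(corr \<alpha> \<kappa> n has_real_derivative \<kappa>) (at 1)"
proof -
  show "corr \<alpha> \<kappa> n 1 = \<alpha>" by (simp add: corr_def)
  show "(corr \<alpha> \<kappa> n has_real_derivative \<kappa>) (at 1)"
    unfolding corr_def[abs_def] by (auto intro!: derivative_eq_intros)
qed

text \<open>Approximating \<open>v / x^2\<close> with weight \<open>x ^ 4\<close> is the same as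
  approximating \<open>v\<close> by \<open>x^2\<close> times a polynomial, and the factor
  \<open>x^2\<close> secures the clamped conditions at 0. Value and slope at 1 are repaired
  afterwards.\<close>

lemma L2_approx_prescribed:
  assumes v: "in_L2 v" and e: "0 < e"
  obtains T where "real_polynomial_function T" "T 1 = c1" "(T has_real_derivative c2) (at 1)"
    "(\<integral>x. (v x - x\<^sup>2 * T x)\<^sup>2 \<partial>leb01) < e"
proof -
  note V = in_L2D[OF v]
  have [measurable]: "v \<in> borel_measurable leb01" by (rule V)
  define f where "f = (\<lambda>x. v x / x\<^sup>2)"
  have f: "(f x - q)\<^sup>2 * x ^ 4 = (v x - x\<^sup>2 * q)\<^sup>2" if "x \<in> {0<..<1}" for x q
  proof -
    have "(f x - q)\<^sup>2 * x ^ 4 = ((f x - q) * x\<^sup>2)\<^sup>2" by (simp add: power_mult_distrib)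
    also have "(f x - q) * x\<^sup>2 = v x - x\<^sup>2 * q" using that by (simp add: f_def field_simps)
    finally show ?thesis .
  qed
  have e8: "0 < e / 8" using e by simp
  obtain p where p: "real_polynomial_function p" "integrable leb01 (\<lambda>x. (f x - p x)\<^sup>2 * x ^ 4)"
    "(\<integral>x. (f x - p x)\<^sup>2 * x ^ 4 \<partial>leb01) < e / 8"
  proof (rule polynomial_approx[of f "\<lambda>x. x ^ 4", OF _ _ _ _ e8])
    show "f \<in> borel_measurable leb01" unfolding f_def by measurable
    show "integrable leb01 (\<lambda>x::real. x ^ 4)" by (intro integrable_leb01_continuous continuous_intros)
    show "integrable leb01 (\<lambda>x. (f x)\<^sup>2 * x ^ 4)"
      using V(2) by (rule Bochner_Integration.integrable_cong[THEN iffD1, rotated 2]) (use f[of _ 0] in auto)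
  qed auto
  have i1: "integrable leb01 (\<lambda>x. (v x - x\<^sup>2 * p x)\<^sup>2)"
    using p(2) by (rule Bochner_Integration.integrable_cong[THEN iffD1, rotated 2]) (use f in auto)
  have "(\<integral>x. (v x - x\<^sup>2 * p x)\<^sup>2 \<partial>leb01) = (\<integral>x. (f x - p x)\<^sup>2 * x ^ 4 \<partial>leb01)"
    by (rule Bochner_Integration.integral_cong) (use f in auto)
  hence p1: "(\<integral>x. (v x - x\<^sup>2 * p x)\<^sup>2 \<partial>leb01) < e / 8" using p(3) by simp
  obtain p' where p': "\<And>x. (p has_real_derivative p' x) (at x)"
    using has_real_derivative_polynomial_function[OF p(1)] by blast
  \<comment> \<open>The defects in value and slope at 1 of the unconstrained approximation;
    \<open>corr\<close> supplies them with small \<open>L^2\<close> norm.\<close>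
  define \<alpha> where "\<alpha> = c1 - p 1"
  define \<kappa> where "\<kappa> = c2 - p' 1"
  have mc: "corr \<alpha> \<kappa> n \<in> borel_measurable leb01" for n
    by (intro borel_measurable_leb01_continuous continuous_on_real_polynomial_function real_polynomial_function_corr)
  have "(\<lambda>n. \<integral>x. (x\<^sup>2 * corr \<alpha> \<kappa> n x)\<^sup>2 \<partial>leb01) \<longlonglongrightarrow> (\<integral>x. 0 \<partial>leb01)"
  proof (rule integral_dominated_convergence[where w = "\<lambda>_. (\<bar>\<alpha>\<bar> + \<bar>\<kappa>\<bar>)\<^sup>2"])
    show "(\<lambda>x. (x\<^sup>2 * corr \<alpha> \<kappa> n x)\<^sup>2) \<in> borel_measurable leb01" for n using mc by measurable
    show "AE x in leb01. (\<lambda>n. (x\<^sup>2 * corr \<alpha> \<kappa> n x)\<^sup>2) \<longlonglongrightarrow> 0"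
      using AE_leb01_Ioo
    proof eventually_elim
      fix x :: real assume "x \<in> {0<..<1}"
      hence "(\<lambda>n. corr \<alpha> \<kappa> n x) \<longlonglongrightarrow> 0" by (intro corr_tendsto) auto
      hence "(\<lambda>n. (x\<^sup>2 * corr \<alpha> \<kappa> n x)\<^sup>2) \<longlonglongrightarrow> (x\<^sup>2 * 0)\<^sup>2" by (intro tendsto_intros)
      thus "(\<lambda>n. (x\<^sup>2 * corr \<alpha> \<kappa> n x)\<^sup>2) \<longlonglongrightarrow> 0" by simp
    qed
    show "AE x in leb01. norm ((x\<^sup>2 * corr \<alpha> \<kappa> n x)\<^sup>2) \<le> (\<bar>\<alpha>\<bar> + \<bar>\<kappa>\<bar>)\<^sup>2" for n
      using AE_leb01_Ioo
    proof eventually_elim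
      fix x :: real assume x: "x \<in> {0<..<1}"
      have "\<bar>x\<^sup>2 * corr \<alpha> \<kappa> n x\<bar> \<le> 1 * (\<bar>\<alpha>\<bar> + \<bar>\<kappa>\<bar>)"
        unfolding abs_mult using x corr_bound[of x] by (intro mult_mono) (auto simp: power_le_one)
      hence "(x\<^sup>2 * corr \<alpha> \<kappa> n x)\<^sup>2 \<le> (\<bar>\<alpha>\<bar> + \<bar>\<kappa>\<bar>)\<^sup>2"
        by (intro abs_le_square_iff[THEN iffD1]) simp
      thus "norm ((x\<^sup>2 * corr \<alpha> \<kappa> n x)\<^sup>2) \<le> (\<bar>\<alpha>\<bar> + \<bar>\<kappa>\<bar>)\<^sup>2" by simp
    qed
  qed auto
  hence "eventually (\<lambda>n. (\<integral>x. (x\<^sup>2 * corr \<alpha> \<kappa> n x)\<^sup>2 \<partial>leb01) < e / 8) sequentially"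
    using e8 by (intro order_tendstoD(2)) auto
  then obtain n where n: "(\<integral>x. (x\<^sup>2 * corr \<alpha> \<kappa> n x)\<^sup>2 \<partial>leb01) < e / 8"
    by (auto simp: eventually_sequentially)
  define T where "T = (\<lambda>x. p x + corr \<alpha> \<kappa> n x)"
  have cT: "real_polynomial_function T"
    unfolding T_def by (intro real_polynomial_function.intros(3) p real_polynomial_function_corr)
  have i2: "integrable leb01 (\<lambda>x. (x\<^sup>2 * corr \<alpha> \<kappa> n x)\<^sup>2)"
    by (intro integrable_leb01_continuous continuous_intros continuous_on_real_polynomial_function real_polynomial_function_corr)
  have i3: "integrable leb01 (\<lambda>x. (v x - x\<^sup>2 * T x)\<^sup>2)"
    using in_L2D(2)[OF in_L2_lincomb[OF v in_L2_continuous_on, of "\<lambda>x. x\<^sup>2 * T x" 1 "- 1"]]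
      continuous_on_real_polynomial_function[OF cT]
    by (simp add: continuous_intros)
  have "(\<integral>x. (v x - x\<^sup>2 * T x)\<^sup>2 \<partial>leb01)
      \<le> (\<integral>x. 2 * (v x - x\<^sup>2 * p x)\<^sup>2 + 2 * (x\<^sup>2 * corr \<alpha> \<kappa> n x)\<^sup>2 \<partial>leb01)"
  proof (rule integral_leb01_mono[OF i3])
    show "integrable leb01 (\<lambda>x. 2 * (v x - x\<^sup>2 * p x)\<^sup>2 + 2 * (x\<^sup>2 * corr \<alpha> \<kappa> n x)\<^sup>2)" using i1 i2 by simp
    fix x :: real
    have "v x - x\<^sup>2 * T x = (v x - x\<^sup>2 * p x) + - (x\<^sup>2 * corr \<alpha> \<kappa> n x)" by (simp add: T_def algebra_simps)
    thus "(v x - x\<^sup>2 * T x)\<^sup>2 \<le> 2 * (v x - x\<^sup>2 * p x)\<^sup>2 + 2 * (x\<^sup>2 * corr \<alpha> \<kappa> n x)\<^sup>2"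
      using square_sum_le[of "v x - x\<^sup>2 * p x" "- (x\<^sup>2 * corr \<alpha> \<kappa> n x)"] by (simp only: power2_minus)
  qed
  also have "\<dots> = 2 * (\<integral>x. (v x - x\<^sup>2 * p x)\<^sup>2 \<partial>leb01) + 2 * (\<integral>x. (x\<^sup>2 * corr \<alpha> \<kappa> n x)\<^sup>2 \<partial>leb01)"
    using i1 i2 by simp
  finally have fin: "(\<integral>x. (v x - x\<^sup>2 * T x)\<^sup>2 \<partial>leb01) < e" using p1 n e by linarith
  have "T 1 = c1" by (simp add: T_def corr_at_1 \<alpha>_def)
  moreover have "(T has_real_derivative c2) (at 1)"
    unfolding T_def using DERIV_add[OF p'[of 1] corr_at_1(2)[of \<alpha> \<kappa> n]] by (simp add: \<kappa>_def)
  ultimately show thesis by (rule that[OF cT _ _ fin])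
qed

context wd
begin

lemma K2rep_square_mult:
  assumes T: "real_polynomial_function T" "(T has_real_derivative c) (at 1)"
  shows "\<exists>v' h. K2rep (\<lambda>x. x\<^sup>2 * T x) v' h \<and> v' 1 = 2 * T 1 + c"
proof -
  obtain T' where T': "real_polynomial_function T'" "\<And>x. (T has_real_derivative T' x) (at x)" "ac T T'"
    by (rule ac_polynomial[OF T(1)], blast)
  obtain T'' where T'': "real_polynomial_function T''" "ac T' T''" by (rule ac_polynomial[OF T'(1)]) blast
  have ac2: "ac (\<lambda>x. x\<^sup>2) (\<lambda>x. 2 * x)"
    by (rule ac_derivative) (auto intro!: derivative_eq_intros continuous_intros)
  have acv: "ac (\<lambda>x. x\<^sup>2 * T x) (\<lambda>x. 2 * x * T x + x\<^sup>2 * T' x)"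
    by (rule ac_mult[OF ac2 T'(3)])
  have acv': "ac (\<lambda>x. 2 * x * T x + x\<^sup>2 * T' x)
      (\<lambda>x. (2 * 1 * T x + 2 * x * T' x) + (2 * x * T' x + x\<^sup>2 * T'' x))"
    by (intro ac_add ac_mult ac_cmult ac_ident ac2 T' T'')
  have "K2rep (\<lambda>x. x\<^sup>2 * T x) (\<lambda>x. 2 * x * T x + x\<^sup>2 * T' x)
      (\<lambda>x. (2 * 1 * T x + 2 * x * T' x) + (2 * x * T' x + x\<^sup>2 * T'' x))"
    unfolding K2rep_def
    by (intro conjI acv acv' integrable_leb01_continuous continuous_intros a_cont
        continuous_on_real_polynomial_function T T' T'') auto
  moreover have "T' 1 = c" using DERIV_unique[OF T'(2)[of 1] T(2)] .
  ultimately show ?thesis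
    by (intro exI[of _ "\<lambda>x. 2 * x * T x + x\<^sup>2 * T' x"] exI conjI) auto
qed

lemma prim_polynomial_dom_B:
  assumes p: "real_polynomial_function p"
  shows "prim (prim (\<lambda>x. p x / a x)) \<in> dom_B a"
proof -
  note r = K2rep_continuous_over_a[OF continuous_on_real_polynomial_function[OF p]]
  have "AE x in leb01. bending a (prim (prim (\<lambda>x. p x / a x))) x = p x"
    using K2rep_imp_K2(2)[OF r(1)] r(2) by eventually_elim (simp add: bending_def)
  thus ?thesis using K2rep_imp_K2(1)[OF r(1)] in_H2_AE_polynomial[OF p] by (simp add: dom_B_def)
qed

text \<open>Approximating the moment \<open>a * g\<close> in the weight \<open>1 / a\<close> is
  approximation of \<open>g\<close> in the bending energy. The approximant has a polynomial moment,
  so it lies in the domain of the operator.\<close>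

lemma bending_approx:
  assumes u: "K2rep u u' g" and e: "0 < e"
  obtains p where "real_polynomial_function p" "(\<integral>x. a x * (g x - p x / a x)\<^sup>2 \<partial>leb01) < e"
proof -
  note U = K2repD[OF u]
  have [measurable]: "g \<in> borel_measurable leb01" by (rule U)
  have f: "(a x * g x - q)\<^sup>2 * (1 / a x) = a x * (g x - q / a x)\<^sup>2" if "x \<in> {0<..<1}" for x q
  proof -
    have A: "0 < a x" using that a_pos by auto
    have "a x * g x - q = a x * (g x - q / a x)" using A by (simp add: field_simps)
    thus ?thesis using A by (simp add: power_mult_distrib power2_eq_square)
  qed
  obtain p where p: "real_polynomial_function p" "integrable leb01 (\<lambda>x. (a x * g x - p x)\<^sup>2 * (1 / a x))"
    "(\<integral>x. (a x * g x - p x)\<^sup>2 * (1 / a x) \<partial>leb01) < e"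
  proof (rule polynomial_approx[of "\<lambda>x. a x * g x" "\<lambda>x. 1 / a x", OF _ integrable_inv_a _ _ e])
    show "integrable leb01 (\<lambda>x. (a x * g x)\<^sup>2 * (1 / a x))"
      using U(5) by (rule Bochner_Integration.integrable_cong[THEN iffD1, rotated 2]) (use f[of _ 0] in auto)
  qed (auto simp: a_pos less_imp_le)
  have "(\<integral>x. (a x * g x - p x)\<^sup>2 * (1 / a x) \<partial>leb01) = (\<integral>x. a x * (g x - p x / a x)\<^sup>2 \<partial>leb01)"
    by (rule Bochner_Integration.integral_cong) (use f in auto)
  thus thesis using p that by simp
qed

end

context beam
begin

text \<open>The position \<open>u\<close> is chosen first, and the feedback conditions are then
  solved for \<open>v(1)\<close> and \<open>v'(1)\<close>. This is possible because the norm sees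
  \<open>v\<close> only in \<open>L^2\<close>, where boundary values can be changed at arbitrarily
  small cost.\<close>

lemma dom_calB_dense:
  assumes P: "P \<in> S" and e: "0 < e"
  obtains p where "p \<in> dom_calB a \<beta> \<gamma>" "nrm (lincomb 1 P (- 1) p) < e"
proof -
  note KP = space_K0D[OF P]
  \<comment> \<open>Bending and velocity errors cost \<open>\<eta>\<close> each; the elastic
    boundary terms cost at most \<open>\<beta> * I * \<eta>\<close> and
    \<open>\<gamma> * I * \<eta>\<close>.\<close>
  define \<eta> where "\<eta> = e\<^sup>2 / (2 + \<beta> * I + \<gamma> * I)"
  have bI: "0 \<le> \<beta> * I" "0 \<le> \<gamma> * I" using \<beta>_nonneg \<gamma>_nonneg I_pos by auto
  hence d: "0 < 2 + \<beta> * I + \<gamma> * I" by linarith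
  have \<eta>: "0 < \<eta>" unfolding \<eta>_def using e d by simp
  obtain f where f: "real_polynomial_function f" "(\<integral>x. a x * (dxx (fst P) x - f x / a x)\<^sup>2 \<partial>leb01) < \<eta>"
    by (rule bending_approx[OF KP(1) \<eta>])
  define u where "u = prim (prim (\<lambda>x. f x / a x))"
  have Ku: "K2rep u (prim (\<lambda>x. f x / a x)) (\<lambda>x. f x / a x)"
    unfolding u_def by (rule K2rep_continuous_over_a[OF continuous_on_real_polynomial_function[OF f(1)]])
  have uB: "u \<in> dom_B a" unfolding u_def by (rule prim_polynomial_dom_B[OF f(1)])
  define c1 where "c1 = dx (cont_rep (bending a u)) 1 - \<beta> * u 1"
  define c2 where "c2 = - \<gamma> * dx u 1 - cont_rep (bending a u) 1"
  \<comment> \<open>The slope of \<open>x^2 * T x\<close> at 1 is \<open>2 * T 1\<close> plus the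
    slope of \<open>T\<close>, so prescribing \<open>c2\<close> for the velocity means
    \<open>c2 - 2 * c1\<close> for \<open>T\<close>.\<close>
  obtain T where T: "real_polynomial_function T" "T 1 = c1" "(T has_real_derivative (c2 - 2 * c1)) (at 1)"
    "(\<integral>x. (snd P x - x\<^sup>2 * T x)\<^sup>2 \<partial>leb01) < \<eta>"
    by (rule L2_approx_prescribed[OF KP(2) \<eta>])
  define v where "v = (\<lambda>x. x\<^sup>2 * T x)"
  obtain v' h where Kv: "K2rep v v' h" "v' 1 = c2"
    using K2rep_square_mult[OF T(1,3)] T(2) unfolding v_def by auto
  have v1: "v 1 = c1" by (simp add: v_def T)
  have "dx v 1 = c2" using K2repD(10)[OF Kv(1), of 1] Kv(2) by simp
  hence p: "(u, v) \<in> dom_calB a \<beta> \<gamma>"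
    using uB K2rep_imp_K2(1)[OF Kv(1)] v1 by (simp add: dom_calB_def c1_def c2_def)
  let ?D = "lincomb 1 P (- 1) (u, v)"
  let ?g = "\<lambda>x. 1 * dxx (fst P) x + (- 1) * (f x / a x)"
  let ?u' = "\<lambda>x. 1 * dx (fst P) x + (- 1) * prim (\<lambda>x. f x / a x) x"
  have KD: "K2rep (fst ?D) ?u' ?g"
    using K2rep_lincomb[OF KP(1) Ku, of 1 "- 1"] by simp
  have LD: "in_L2 (snd ?D)"
    using space_K0D(2)[OF lincomb_space_K0[OF P dom_calB_space_K0[OF p], of 1 "- 1"]] .
  define E where "E = (\<integral>x. a x * (?g x)\<^sup>2 \<partial>leb01)"
  have E: "E < \<eta>" using f(2) by (simp add: E_def)
  have "ip ?D ?D = E + (\<integral>x. (snd ?D x)\<^sup>2 \<partial>leb01) + \<beta> * (fst ?D 1)\<^sup>2 + \<gamma> * (?u' 1)\<^sup>2"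
    unfolding E_def by (rule nrm_eq_K2rep[OF KD LD])
  also have "(\<integral>x. (snd ?D x)\<^sup>2 \<partial>leb01) < \<eta>" using T(4) by (simp add: v_def)
  also have "\<beta> * (fst ?D 1)\<^sup>2 \<le> \<beta> * (I * \<eta>)"
  proof (rule mult_left_mono[OF _ \<beta>_nonneg])
    have "(fst ?D 1)\<^sup>2 \<le> I * E" unfolding E_def by (rule K2_bound[OF KD]) simp
    also have "\<dots> \<le> I * \<eta>" using E I_pos by simp
    finally show "(fst ?D 1)\<^sup>2 \<le> I * \<eta>" .
  qed
  also have "\<gamma> * (?u' 1)\<^sup>2 \<le> \<gamma> * (I * \<eta>)"
  proof (rule mult_left_mono[OF _ \<gamma>_nonneg])
    have "(?u' 1)\<^sup>2 \<le> I * E" unfolding E_def by (rule K2_deriv_bound[OF KD]) simp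
    also have "\<dots> \<le> I * \<eta>" using E I_pos by simp
    finally show "(?u' 1)\<^sup>2 \<le> I * \<eta>" .
  qed
  finally have "ip ?D ?D < E + \<eta> + \<beta> * (I * \<eta>) + \<gamma> * (I * \<eta>)" by simp
  also have "\<dots> < \<eta> + \<eta> + \<beta> * (I * \<eta>) + \<gamma> * (I * \<eta>)" using E by simp
  also have "\<dots> = (2 + \<beta> * I + \<gamma> * I) * \<eta>" by (simp add: algebra_simps)
  also have "\<dots> = e\<^sup>2" using d by (simp add: \<eta>_def)
  finally have "(nrm ?D)\<^sup>2 < e\<^sup>2" unfolding nrm_square .
  hence "nrm ?D < e" by (rule power2_less_imp_less[OF _ less_imp_le[OF e]])
  thus thesis using p by (rule that[rotated])
qed

end

section \<open>Decay of the functional, Komornik's argument, and extension by density\<close>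

locale beam_decay_semigroup = beam_decay + beam_semigroup +
  assumes rate_pos: "\<delta> * C3_const a \<beta> \<gamma> \<epsilon>0 \<delta> < \<epsilon>0"
begin

text \<open>The dissipation inequality is available at the representative \<open>p'\<close> in the
  domain; compatibility of forms with \<open>state_eq\<close> carries it to the orbit.\<close>

lemma psi_derivative:
  assumes p: "p \<in> dom_calB a \<beta> \<gamma>" and t: "0 \<le> t"
  obtains D where "((\<lambda>s. psi (R s p) (R s p)) has_real_derivative D) (at t within {0..})"
    "D \<le> - rate * (1 / 2 * ip (R t p) (R t p))"
proof -
  define q where "q = op_calB a p"
  have pS: "p \<in> S" and qS: "q \<in> S" unfolding q_def by (rule dom_calB_space_K0[OF p], rule op_calB_space_K0[OF p])
  have RpS: "R t p \<in> S" and RqS: "R t q \<in> S" by (rule R_mem[OF t pS], rule R_mem[OF t qS])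
  obtain p' where p': "p' \<in> dom_calB a \<beta> \<gamma>" "state_eq p' (R t p)" "state_eq (op_calB a p') (R t q)"
    unfolding q_def by (rule R_dom[OF p t])
  have p'S: "p' \<in> S" "op_calB a p' \<in> S" by (rule dom_calB_space_K0[OF p'(1)], rule op_calB_space_K0[OF p'(1)])
  have "((\<lambda>s. psi (R s p) (R s p)) has_real_derivative psi (R t q) (R t p) + psi (R t p) (R t q)) (at t within {0..})"
    by (rule form_has_derivative[OF form_psi R_mem[OF _ pS] RqS t quot_limit[OF p t, folded q_def]])
  moreover have "psi (R t q) (R t p) + psi (R t p) (R t q) = psi (op_calB a p') p' + psi p' (op_calB a p')"
    using formD(3)[OF form_psi p'S(2) RqS RpS p'(3)] formD(4)[OF form_psi p'S(2) RqS RpS p'(3)]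
      formD(3)[OF form_psi p'S(1) RpS p'S(2) p'(2)] formD(4)[OF form_psi p'S(1) RpS p'S(2) p'(2)] by simp
  moreover have "ip p' p' = ip (R t p) (R t p)"
    using nrm_cong[OF p'S(1) p'(2)] by (metis nrm_square)
  ultimately show thesis
    using psi_dissipation[OF p'(1)] that by simp
qed

lemma ip_antimono:
  assumes p: "p \<in> S" and s: "0 \<le> s" "s \<le> t"
  shows "ip (R t p) (R t p) \<le> ip (R s p) (R s p)"
proof -
  have RS: "R s p \<in> S" "R t p \<in> S" using R_mem[OF _ p] s by auto
  have "state_eq (R t p) (R (t - s) (R s p))" using R_add[OF _ s(1) p, of "t - s"] s by simp
  hence "nrm (R t p) = nrm (R (t - s) (R s p))" by (rule nrm_cong[OF RS(2), symmetric])
  also have "\<dots> \<le> nrm (R s p)" using R_le[OF _ RS(1), of "t - s"] s by simp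
  finally have "(nrm (R t p))\<^sup>2 \<le> (nrm (R s p))\<^sup>2" by (intro power_mono) auto
  thus ?thesis by (simp only: nrm_square)
qed

text \<open>Two uses of one inequality \<open>f' \<le> - rate * e\<close>. On \<open>[0, r]\<close>
  it is combined with \<open>f \<le> C4 * e\<close> and gives \<open>f' \<le> - f / M\<close>. On
  \<open>[r, t]\<close> it is integrated with \<open>e\<close> replaced by its smallest value
  \<open>e t\<close>, which bounds the energy by the functional although \<open>f\<close> has no
  lower bound by \<open>e\<close> at the same time.\<close>

lemma decay_dom:
  assumes p: "p \<in> dom_calB a \<beta> \<gamma>" and t: "0 < t"
  shows "ip (R t p) (R t p) \<le> ip p p * exp (1 - t / (C4 / rate))"
proof -
  define M where "M = C4 / rate"
  have rate: "0 < rate" using rate_pos by simp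
  have M: "0 < M" unfolding M_def using C4_pos rate by simp
  have pS: "p \<in> S" by (rule dom_calB_space_K0[OF p])
  define f where "f = (\<lambda>s. psi (R s p) (R s p))"
  define e where "e = (\<lambda>s. 1 / 2 * ip (R s p) (R s p))"
  have e0: "0 \<le> e s" for s using ip_nonneg[of "R s p"] by (simp add: e_def)
  have "nrm (R 0 p) = nrm p" using nrm_cong[OF pS state_eq_sym[OF R_0[OF pS]]] .
  hence ip0: "ip (R 0 p) (R 0 p) = ip p p" by (metis nrm_square)
  have anti: "e y \<le> e x" if "0 \<le> x" "x \<le> y" for x y
    using ip_antimono[OF pS that] by (simp add: e_def)
  have fe: "f s \<le> C4 * e s" "0 \<le> f s" if "0 \<le> s" for s
    using psi_bounds[OF R_mem[OF that pS]] by (simp_all add: f_def e_def)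
  have ex: "\<exists>d. (f has_real_derivative d) (at s within {0..}) \<and> d \<le> - rate * e s" if s: "0 \<le> s" for s
  proof -
    obtain d where "((\<lambda>s. psi (R s p) (R s p)) has_real_derivative d) (at s within {0..})"
      "d \<le> - rate * (1 / 2 * ip (R s p) (R s p))"
      by (rule psi_derivative[OF p s])
    thus ?thesis unfolding f_def e_def by blast
  qed
  \<comment> \<open>A derivative is selected at every time, so that differentiability on the whole
    half line, and with it continuity of \<open>f\<close>, can be stated.\<close>
  define D where "D = (\<lambda>s. SOME d. (f has_real_derivative d) (at s within {0..}) \<and> d \<le> - rate * e s)"
  have D: "(f has_real_derivative D s) (at s within {0..})" "D s \<le> - rate * e s" if "0 \<le> s" for s
    using someI_ex[OF ex[OF that]] unfolding D_def by blast+
  have fc: "continuous_on {x..y} f" if "0 \<le> x" for x y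
    by (rule continuous_on_subset[OF DERIV_continuous_on[of "{0..}" f D]]) (use D(1) that in auto)
  have fD: "(f has_real_derivative D s) (at s)" if "0 < s" for s
    using D(1)[of s] that at_within_interior[of s "{0..}"] by simp
  show ?thesis
  proof (cases "t \<le> M")
    \<comment> \<open>Up to time \<open>M\<close> the exponential factor is at least 1 and
      contractivity is enough.\<close>
    case True
    hence "1 \<le> exp (1 - t / M)" using M by simp
    hence "ip p p * 1 \<le> ip p p * exp (1 - t / M)" using ip_nonneg by (intro mult_left_mono)
    thus ?thesis using ip_antimono[OF pS order_refl, of t] t unfolding ip0 M_def by simp
  next
    case False
    \<comment> \<open>The lag \<open>M\<close> is the source of the 1 in the exponent:
      \<open>- (r / M) = 1 - t / M\<close>.\<close>
    define r where "r = t - M"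
    have r: "0 \<le> r" "r \<le> t" using False M by (auto simp: r_def)
    have "f r * exp (r / M) \<le> f 0 * exp (0 / M)"
    proof (rule DERIV_nonpos_imp_decreasing_open[of 0 r "\<lambda>s. f s * exp (s / M)"])
      show "0 \<le> r" by (rule r)
      fix s assume s: "0 < s" "s < r"
      have "((\<lambda>s. f s * exp (s / M)) has_real_derivative (D s * exp (s / M) + (exp (s / M) * (1 / M)) * f s)) (at s)"
        using M by (intro DERIV_mult fD s) (auto intro!: derivative_eq_intros)
      moreover have "D s * exp (s / M) + (exp (s / M) * (1 / M)) * f s \<le> 0"
      proof -
        have "f s / M \<le> C4 * e s / M" using fe[of s] s M by (intro divide_right_mono) auto
        also have "C4 * e s / M = rate * e s" using C4_pos rate by (simp add: M_def)
        finally have "D s + f s / M \<le> 0" using D(2)[of s] s unfolding mult_minus_left by linarith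
        hence "exp (s / M) * (D s + f s / M) \<le> 0" by (simp add: mult_nonneg_nonpos)
        thus ?thesis by (simp add: algebra_simps)
      qed
      ultimately show "\<exists>y. ((\<lambda>s. f s * exp (s / M)) has_real_derivative y) (at s) \<and> y \<le> 0" by blast
    next
      show "continuous_on {0..r} (\<lambda>s. f s * exp (s / M))" using M by (intro continuous_intros fc) auto
    qed
    hence f1: "f r \<le> f 0 * exp (- (r / M))" by (simp add: exp_minus field_simps)
    \<comment> \<open>With \<open>e t\<close> frozen this compensated function is nonincreasing,
      because \<open>e s\<close> is at least \<open>e t\<close> for \<open>s\<close> before
      \<open>t\<close>; as \<open>f t\<close> is nonnegative, \<open>rate * M * e t\<close>, that is
      \<open>C4 * e t\<close>, is at most \<open>f r\<close>.\<close>
    have "f t + rate * e t * t \<le> f r + rate * e t * r"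
    proof (rule DERIV_nonpos_imp_decreasing_open[of r t "\<lambda>s. f s + rate * e t * s"])
      show "r \<le> t" by (rule r)
      fix s assume s: "r < s" "s < t"
      have "((\<lambda>s. f s + rate * e t * s) has_real_derivative D s + rate * e t) (at s)"
        using s r by (auto intro!: derivative_eq_intros fD)
      moreover have "D s + rate * e t \<le> 0"
      proof -
        have "rate * e t \<le> rate * e s" using anti[of s t] s r rate by (intro mult_left_mono) auto
        thus ?thesis using D(2)[of s] s r unfolding mult_minus_left by linarith
      qed
      ultimately show "\<exists>y. ((\<lambda>s. f s + rate * e t * s) has_real_derivative y) (at s) \<and> y \<le> 0" by blast
    next
      show "continuous_on {r..t} (\<lambda>s. f s + rate * e t * s)" using r by (intro continuous_intros fc) auto
    qed
    hence "rate * e t * M \<le> f r" using fe(2)[of t] t by (simp add: r_def algebra_simps)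
    moreover have "rate * e t * M = C4 * e t" using rate by (simp add: M_def)
    ultimately have "C4 * e t \<le> f 0 * exp (- (r / M))" using f1 by simp
    also have "\<dots> \<le> C4 * e 0 * exp (- (r / M))" using fe(1)[of 0] by (intro mult_right_mono) auto
    finally have "e t \<le> e 0 * exp (- (r / M))" using C4_pos by (simp add: mult.assoc)
    also have "- (r / M) = 1 - t / M" using M by (simp add: r_def field_simps)
    finally show ?thesis unfolding e_def M_def ip0 by simp
  qed
qed

text \<open>For norms the decay estimate has factor \<open>c\<close>, the square root of the
  exponential. It passes to the limit because both sides are continuous in the initial state, by
  contractivity and linearity.\<close>

lemma decay:
  assumes P: "P \<in> S" and t: "0 < t"
  shows "ip (R t P) (R t P) \<le> ip P P * exp (1 - t / (C4 / rate))"
proof -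
  define c where "c = sqrt (exp (1 - t / (C4 / rate)))"
  have c: "0 \<le> c" "c\<^sup>2 = exp (1 - t / (C4 / rate))" by (auto simp: c_def)
  have RP: "R t P \<in> S" using R_mem[OF _ P] t by simp
  have "nrm (R t P) \<le> c * nrm P + e" if e: "0 < e" for e
  proof -
    \<comment> \<open>The approximation error enters once through the orbit of the difference, with
      factor 1, and once through the norm of \<open>p\<close>, with factor \<open>c\<close>.\<close>
    define \<eta> where "\<eta> = e / (1 + c)"
    have \<eta>: "0 < \<eta>" "(1 + c) * \<eta> = e" using e c by (auto simp: \<eta>_def)
    obtain p where p: "p \<in> dom_calB a \<beta> \<gamma>" "nrm (lincomb 1 P (- 1) p) < \<eta>"
      by (rule dom_calB_dense[OF P \<eta>(1)])
    have pS: "p \<in> S" by (rule dom_calB_space_K0[OF p(1)])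
    have Rp: "R t p \<in> S" using R_mem[OF _ pS] t by simp
    define d where "d = lincomb 1 P (- 1) p"
    have dS: "d \<in> S" unfolding d_def by (rule lincomb_space_K0[OF P pS])
    have "p = lincomb 1 P (- 1) d" unfolding d_def by (intro prod_eqI ext) auto
    hence np: "nrm p \<le> nrm P + nrm d" using nrm_lincomb_le[OF P dS, of "- 1"] by simp
    define D where "D = lincomb 1 (R t P) (- 1) (R t p)"
    have DS: "D \<in> S" unfolding D_def by (rule lincomb_space_K0[OF RP Rp])
    have "state_eq (R t d) D" unfolding d_def D_def using R_lin[OF _ P pS] t by simp
    from nrm_cong[OF R_mem[OF _ dS] this] have "nrm D = nrm (R t d)" using t by simp
    hence nD: "nrm D \<le> nrm d" using R_le[OF _ dS] t by simp
    have "R t P = lincomb 1 (R t p) 1 D" unfolding D_def by (intro prod_eqI ext) auto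
    hence n1: "nrm (R t P) \<le> nrm (R t p) + nrm D" using nrm_lincomb_le[OF Rp DS, of 1] by simp
    have n2: "nrm (R t p) \<le> c * nrm p"
    proof (rule power2_le_imp_le)
      show "(nrm (R t p))\<^sup>2 \<le> (c * nrm p)\<^sup>2"
        using decay_dom[OF p(1) t] by (simp add: nrm_square power_mult_distrib c mult.commute)
    qed (use c in simp)
    have n3: "c * nrm p \<le> c * nrm P + c * nrm d"
      using mult_left_mono[OF np c(1)] by (simp add: distrib_left)
    have "(1 + c) * nrm d \<le> (1 + c) * \<eta>"
      using p(2) c unfolding d_def[symmetric] by (intro mult_left_mono) auto
    thus ?thesis using n1 n2 n3 nD unfolding \<eta>(2) by (simp add: distrib_right)
  qed
  hence "nrm (R t P) \<le> c * nrm P" by (rule field_le_epsilon)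
  hence "(nrm (R t P))\<^sup>2 \<le> (c * nrm P)\<^sup>2" by (intro power_mono) auto
  thus ?thesis by (simp add: nrm_square power_mult_distrib c mult.commute)
qed

end

lemma (in beam) energy_eq_ip:
  assumes "(y t, yt t) \<in> S"
  shows "energy a \<beta> \<gamma> y yt t = 1 / 2 * ip (y t, yt t) (y t, yt t)"
proof -
  note D = space_K0D[OF assms]
  have "integrable leb01 (\<lambda>x. (yt t x)\<^sup>2)" "integrable leb01 (\<lambda>x. a x * (dxx (y t) x)\<^sup>2)"
    using in_L2D(2)[OF D(2)] K2repD(5)[OF D(1)] by simp_all
  thus ?thesis by (simp add: energy_def ip_def power2_eq_square mult.assoc algebra_simps)
qed

theorem theorem4p5:
  fixes a y0 y1 :: "real \<Rightarrow> real"
    and y yt :: "real \<Rightarrow> real \<Rightarrow> real"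
    and \<beta> \<gamma> \<epsilon>0 :: real
  assumes "weakly_degenerate a"
    and "\<beta> \<ge> 0" and "\<gamma> \<ge> 0"
    and "0 < \<epsilon>0" and "\<epsilon>0 \<le> 2 - degen_const a"
    and "mild_solution a \<beta> \<gamma> y0 y1 y yt"
  shows "\<forall>t>0. \<forall>\<delta>. 0 < \<delta> \<and> \<delta> < nu_const a \<beta> \<gamma> \<and> \<delta> * C3_const a \<beta> \<gamma> \<epsilon>0 \<delta> < \<epsilon>0 \<longrightarrow>
           energy a \<beta> \<gamma> y yt t
             \<le> energy a \<beta> \<gamma> y yt 0
                * exp (1 - t / (C4_const a \<beta> \<gamma> \<epsilon>0 \<delta> / (\<epsilon>0 - \<delta> * C3_const a \<beta> \<gamma> \<epsilon>0 \<delta>)))"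
proof (intro allI impI, elim conjE)
  fix t \<delta> :: real
  assume t: "0 < t" and \<delta>: "0 < \<delta>" "\<delta> < nu_const a \<beta> \<gamma>" "\<delta> * C3_const a \<beta> \<gamma> \<epsilon>0 \<delta> < \<epsilon>0"
  obtain R where P: "(y0, y1) \<in> space_K0 a" and R: "contraction_semigroup a \<beta> \<gamma> R" "generated_by_calB a \<beta> \<gamma> R"
    and y: "\<And>t. 0 \<le> t \<Longrightarrow> state_eq (y t, yt t) (R t (y0, y1))"
    using assms(6) unfolding mild_solution_def by blast
  interpret beam_decay_semigroup a \<beta> \<gamma> \<epsilon>0 \<delta> R
    by unfold_locales (use assms \<delta> R in auto)
  \<comment> \<open>The mild solution agrees with the orbit only modulo \<open>state_eq\<close>; the
    inner product respects this relation, so the energies coincide.\<close>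
  have eq: "energy a \<beta> \<gamma> y yt s = 1 / 2 * ip (R s (y0, y1)) (R s (y0, y1))" if "0 \<le> s" for s
  proof -
    have RS: "R s (y0, y1) \<in> space_K0 a" by (rule R_mem[OF that P])
    note e = state_eq_sym[OF y[OF that]]
    have S: "(y s, yt s) \<in> space_K0 a" by (rule state_eq_space_K0(1)[OF RS e])
    have "ip (y s, yt s) (y s, yt s) = ip (R s (y0, y1)) (R s (y0, y1))"
      using nrm_cong[OF RS e] by (metis nrm_square)
    thus ?thesis using energy_eq_ip[of y s yt, OF S] by simp
  qed
  have "nrm (R 0 (y0, y1)) = nrm (y0, y1)" using nrm_cong[OF P state_eq_sym[OF R_0[OF P]]] .
  hence "ip (R 0 (y0, y1)) (R 0 (y0, y1)) = ip (y0, y1) (y0, y1)" by (metis nrm_square)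
  thus "energy a \<beta> \<gamma> y yt t
             \<le> energy a \<beta> \<gamma> y yt 0
                * exp (1 - t / (C4_const a \<beta> \<gamma> \<epsilon>0 \<delta> / (\<epsilon>0 - \<delta> * C3_const a \<beta> \<gamma> \<epsilon>0 \<delta>)))"
    using decay[OF P t] unfolding eq[OF less_imp_le[OF t]] eq[OF order_refl] by simp
qed

end
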